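(* Let $c=0$, $\alpha>0$, $\beta,h,\mu\in\mathbb{R}$, $s=0$ and $\Omega=\beta/\alpha$. Consider solutions of $$\partial_t\boldsymbol m=\boldsymbol m\times\big[\alpha\partial_t\boldsymbol m-\partial_x^2\boldsymbol m+(\mu m_3-h)\boldsymbol{\hat e}_3+\beta\,\boldsymbol m\times\boldsymbol{\hat e}_3\big]$$ of the form $\boldsymbol m=(e^{i\varphi}\sin\theta,\cos\theta)$ with $\varphi=\phi(\xi)+\Omega t$, $\theta=\theta(\xi)$, $\xi=x$, and $q=\phi'\neq0$, that is, solutions of $$\theta''=\sin\theta\,\big(h-\Omega+(q^2-\mu)\cos\theta\big),\qquad q'=-2\cot(\theta)\,\theta'\,q. \qquad( * )$$ For $C>0$ let $\mathcal C$ be the curve $q=C/\sin^2\theta$ in $(q,\theta)$-space and let $\mathcal W$ be the wavetrain existence curves given by $$\cos\theta=\frac{h-\beta/\alpha}{\mu-q^2}\qquad(q^2\neq\mu).$$ Intersections of $\mathcal C$ with $\mathcal W$ in $(q,\theta)$-space are in one-to-one correspondence with equilibria of $( * )$ (with first integral value $C$). Consider supercritical anisotropy $0\leq h-\Omega<\mu$ and assume $C$ is such that $\mathcal C$ transversely intersects the component of $\mathcal W$ which intersects $\{q=0\}$. Then the intersection point with smaller $q$-value corresponds to a spectrally stable wavetrain, and in $( * )$ there is a pair of homoclinic solutions to this wavetrain. All other intersection points are unstable wavetrains. All other non-equilibrium solutions of the form $\boldsymbol m=(e^{i\varphi}\sin\theta,\cos\theta)$ with $\varphi=\phi(\xi)+\Omega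 t$, $\theta=\theta(\xi)$, $\xi=x-st$, with $s=0$ (and $q=\phi'\ne0$) are periodic in $\xi$, and this is also the case for all other parameter settings.
   Context: Here $\boldsymbol m(x,t)\in\mathbb{S}^2$, $x\in\mathbb{R}$, and the $(m_1,m_2)$-plane is identified with $\mathbb{C}$. For $q\neq0$ the system $( * )$ has the first integral $C=\sin^2(\theta)|q|$; by the reflection symmetry $q\to-q$ of $( * )$ one may take $q=C/\sin^2\theta>0$, and then $\theta\in(0,\pi)$ satisfies $\theta''=\sin\theta\,(h-\Omega-\mu\cos\theta)+C^2\cos\theta/\sin^3\theta$. Equilibria of $( * )$ correspond to wavetrains, i.e. solutions with $\varphi=kx-\omega t$ and constant $\theta$, with wavenumber $k=q$ and frequency $\omega=-\beta/\alpha$. Periodicity in $\xi$ refers to $(\theta,\theta',q)$. Spectral stability/instability of a wavetrain means that the $L^2(\mathbb{R})$-spectrum of the linearization of the equation in the wavetrain (in a frame in which it is an equilibrium) has no/some element with positive real part.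
   Formalization: For h=Ω the correspondence covers only equilibria with q²≠μ (others exist off W); "all other parameter settings" excludes tangency and −μ<h−Ω<0 with C meeting the component, where homoclinics exist; there non-equilibrium solutions are periodic or homoclinic. *)

theory Defs
  imports "HOL-Analysis.Analysis"
begin

section \<open>The equation\<close>

abbreviation e3 :: "real^3" where "e3 \<equiv> axis 3 1"

definition llgs_rhs :: "real \<Rightarrow> real \<Rightarrow> real \<Rightarrow> real \<Rightarrow> real^3 \<Rightarrow> real^3 \<Rightarrow> real^3 \<Rightarrow> real^3" where
  "llgs_rhs \<alpha> \<beta> h \<mu> m mt mxx =
     cross3 m (\<alpha> *\<^sub>R mt - mxx + (\<mu> * m $ 3 - h) *\<^sub>R e3 + \<beta> *\<^sub>R cross3 m e3)"

text \<open>Functions \<open>m\<close> of space and time, in this order.\<close>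

definition llgs_solution :: "real \<Rightarrow> real \<Rightarrow> real \<Rightarrow> real \<Rightarrow> (real \<Rightarrow> real \<Rightarrow> real^3) \<Rightarrow> bool" where
  "llgs_solution \<alpha> \<beta> h \<mu> m \<longleftrightarrow>
     (\<forall>x t. norm (m x t) = 1) \<and>
     (\<exists>mt mx mxx. \<forall>x t.
        ((\<lambda>\<tau>. m x \<tau>) has_vector_derivative mt x t) (at t) \<and>
        ((\<lambda>y. m y t) has_vector_derivative mx x t) (at x) \<and>
        ((\<lambda>y. mx y t) has_vector_derivative mxx x t) (at x) \<and>
        mt x t = llgs_rhs \<alpha> \<beta> h \<mu> (m x t) (mt x t) (mxx x t))"

text \<open>The point \<open>(e\<^sup>i\<^sup>\<phi> sin \<theta>, cos \<theta>)\<close> of the sphere.\<close>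

definition sph :: "real \<Rightarrow> real \<Rightarrow> real^3" where
  "sph \<phi> \<theta> = vector [cos \<phi> * sin \<theta>, sin \<phi> * sin \<theta>, cos \<theta>]"

section \<open>The coherent structure system\<close>

text \<open>
  The system is written in first order form for \<open>(\<theta>, p, q)\<close> with \<open>p = \<theta>'\<close>;
  the angle \<open>\<theta>\<close> is the polar angle in the open interval from \<open>0\<close> to \<open>\<pi>\<close>.
\<close>

definition phase_space :: "(real \<times> real \<times> real) set" where
  "phase_space = {(\<theta>, p, q). 0 < \<theta> \<and> \<theta> < pi \<and> q \<noteq> 0}"

definition cs_field :: "real \<Rightarrow> real \<Rightarrow> real \<Rightarrow> real \<times> real \<times> real \<Rightarrow> real \<times> real \<times> real" where
  "cs_field h \<Omega> \<mu> = (\<lambda>(\<theta>, p, q).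
     (p, sin \<theta> * (h - \<Omega> + (q\<^sup>2 - \<mu>) * cos \<theta>), - 2 * cot \<theta> * p * q))"

definition cs_solution :: "real \<Rightarrow> real \<Rightarrow> real \<Rightarrow> (real \<Rightarrow> real \<times> real \<times> real) \<Rightarrow> bool" where
  "cs_solution h \<Omega> \<mu> \<gamma> \<longleftrightarrow>
     (\<forall>\<xi>. \<gamma> \<xi> \<in> phase_space \<and> (\<gamma> has_vector_derivative cs_field h \<Omega> \<mu> (\<gamma> \<xi>)) (at \<xi>))"

definition cs_equilibria :: "real \<Rightarrow> real \<Rightarrow> real \<Rightarrow> (real \<times> real \<times> real) set" where
  "cs_equilibria h \<Omega> \<mu> = {e \<in> phase_space. cs_field h \<Omega> \<mu> e = 0}"

definition first_integral :: "real \<times> real \<times> real \<Rightarrow> real" where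
  "first_integral = (\<lambda>(\<theta>, p, q). (sin \<theta>)\<^sup>2 * \<bar>q\<bar>)"

text \<open>
  By the reflection \<open>q \<mapsto> -q\<close> equilibria with a given value of the first integral are
  considered for \<open>q > 0\<close> only, as on the curve \<open>q = C / sin\<^sup>2 \<theta>\<close>.
\<close>

definition cs_equilibria_at :: "real \<Rightarrow> real \<Rightarrow> real \<Rightarrow> real \<Rightarrow> (real \<times> real \<times> real) set" where
  "cs_equilibria_at h \<Omega> \<mu> C =
     {(\<theta>, p, q). (\<theta>, p, q) \<in> cs_equilibria h \<Omega> \<mu> \<and> q > 0 \<and> first_integral (\<theta>, p, q) = C}"

definition reflect :: "real \<times> real \<times> real \<Rightarrow> real \<times> real \<times> real" where
  "reflect = (\<lambda>(\<theta>, p, q). (\<theta>, p, - q))"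

definition nonconst_cs_solution :: "real \<Rightarrow> real \<Rightarrow> real \<Rightarrow> (real \<Rightarrow> real \<times> real \<times> real) \<Rightarrow> bool" where
  "nonconst_cs_solution h \<Omega> \<mu> \<gamma> \<longleftrightarrow> cs_solution h \<Omega> \<mu> \<gamma> \<and> \<not> \<gamma> constant_on UNIV"

definition homoclinic_to :: "real \<Rightarrow> real \<Rightarrow> real \<Rightarrow> real \<times> real \<times> real \<Rightarrow> (real \<Rightarrow> real \<times> real \<times> real) \<Rightarrow> bool" where
  "homoclinic_to h \<Omega> \<mu> e \<gamma> \<longleftrightarrow>
     nonconst_cs_solution h \<Omega> \<mu> \<gamma> \<and> (\<gamma> \<longlongrightarrow> e) at_top \<and> (\<gamma> \<longlongrightarrow> e) at_bot"

definition translates :: "(real \<Rightarrow> 'a) \<Rightarrow> (real \<Rightarrow> 'a) \<Rightarrow> bool" where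
  "translates \<gamma> \<delta> \<longleftrightarrow> (\<exists>d. \<forall>\<xi>. \<gamma> \<xi> = \<delta> (\<xi> + d))"

definition periodic :: "(real \<Rightarrow> 'a) \<Rightarrow> bool" where
  "periodic \<gamma> \<longleftrightarrow> (\<exists>T>0. \<forall>\<xi>. \<gamma> (\<xi> + T) = \<gamma> \<xi>)"

section \<open>Curves in the \<open>(q, \<theta>)\<close>-plane\<close>

definition level_curve :: "real \<Rightarrow> (real \<times> real) set" where
  "level_curve C = {(q, \<theta>). 0 < \<theta> \<and> \<theta> < pi \<and> q = C / (sin \<theta>)\<^sup>2}"

definition wavetrain_curves :: "real \<Rightarrow> real \<Rightarrow> real \<Rightarrow> (real \<times> real) set" where
  "wavetrain_curves h \<Omega> \<mu> =
     {(q, \<theta>). 0 < \<theta> \<and> \<theta> < pi \<and> q\<^sup>2 \<noteq> \<mu> \<and> cos \<theta> = (h - \<Omega>) / (\<mu> - q\<^sup>2)}"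

definition axis_components :: "real \<Rightarrow> real \<Rightarrow> real \<Rightarrow> (real \<times> real) set set" where
  "axis_components h \<Omega> \<mu> =
     {K \<in> components (wavetrain_curves h \<Omega> \<mu>). K \<inter> {(q, \<theta>). q = 0} \<noteq> {}}"

definition tangent_vectors :: "'a::real_normed_vector set \<Rightarrow> 'a \<Rightarrow> 'a set" where
  "tangent_vectors S a =
     {v. \<exists>\<gamma>. \<gamma> 0 = a \<and> (\<forall>\<^sub>F s in nhds 0. \<gamma> s \<in> S) \<and> (\<gamma> has_vector_derivative v) (at (0::real))}"

definition transversely_intersects :: "'a::real_normed_vector set \<Rightarrow> 'a set \<Rightarrow> bool" where
  "transversely_intersects A B \<longleftrightarrow>
     A \<inter> B \<noteq> {} \<and> (\<forall>a \<in> A \<inter> B. span (tangent_vectors A a \<union> tangent_vectors B a) = UNIV)"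

section \<open>Wavetrains and their spectral stability\<close>

definition wavetrain :: "real \<Rightarrow> real \<Rightarrow> real \<Rightarrow> real \<Rightarrow> real \<Rightarrow> real^3" where
  "wavetrain k \<omega> \<theta> x t = sph (k * x - \<omega> * t) \<theta>"

text \<open>
  In the frame rotating about \<open>e3\<close> with angular velocity \<open>-\<omega>\<close>, that is, for
  \<open>m(x,t) = R(-\<omega>t) n(x,t)\<close> with \<open>R\<close> the rotation about \<open>e3\<close>, one has
  \<open>m\<^sub>t = R(-\<omega>t) (n\<^sub>t - \<omega> e3 \<times> n)\<close> and \<open>m\<^sub>x\<^sub>x = R(-\<omega>t) n\<^sub>x\<^sub>x\<close>; the equation commutes with \<open>R\<close>, so it
  becomes \<open>rot_residual (n, n\<^sub>t, n\<^sub>x\<^sub>x) = 0\<close>. A wavetrain with frequency \<open>\<omega>\<close> is an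
  equilibrium in this frame, namely its own profile at time \<open>0\<close>.
\<close>

definition rot_residual :: "real \<Rightarrow> real \<Rightarrow> real \<Rightarrow> real \<Rightarrow> real \<Rightarrow> (real^3) \<times> (real^3) \<times> (real^3) \<Rightarrow> real^3" where
  "rot_residual \<alpha> \<beta> h \<mu> \<omega> = (\<lambda>(n, nt, nxx).
     let mt = nt - \<omega> *\<^sub>R cross3 e3 n in mt - llgs_rhs \<alpha> \<beta> h \<mu> n mt nxx)"

text \<open>
  The linearization at the profile \<open>n\<close> is the Frechet derivative of the residual at
  \<open>(n, 0, n\<^sub>x\<^sub>x)\<close>; it relates a perturbation \<open>v\<close> (with second derivative \<open>w\<close>) to its time
  derivative \<open>p\<close>.
\<close>

definition lin_residual ::
    "real \<Rightarrow> real \<Rightarrow> real \<Rightarrow> real \<Rightarrow> real \<Rightarrow> (real \<Rightarrow> real^3) \<Rightarrow> real \<Rightarrow> real^3 \<Rightarrow> real^3 \<Rightarrow> real^3 \<Rightarrow> real^3" where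
  "lin_residual \<alpha> \<beta> h \<mu> \<omega> n x v p w =
     frechet_derivative (rot_residual \<alpha> \<beta> h \<mu> \<omega>)
       (at (n x, 0, vector_derivative (\<lambda>y. vector_derivative n (at y)) (at x))) (v, p, w)"

definition Re_vec :: "complex^3 \<Rightarrow> real^3" where "Re_vec z = (\<chi> i. Re (z $ i))"
definition Im_vec :: "complex^3 \<Rightarrow> real^3" where "Im_vec z = (\<chi> i. Im (z $ i))"

text \<open>
  Elements of \<open>L\<^sup>2\<close> are handled through representatives. \<open>H1_deriv f g\<close> says that \<open>f\<close> is the
  continuous representative of an element of \<open>H\<^sup>1\<close> with weak derivative \<open>g\<close>.
\<close>

definition L2_fun :: "(real \<Rightarrow> complex^3) set" where
  "L2_fun = {f \<in> borel_measurable lborel. integrable lborel (\<lambda>x. (norm (f x))\<^sup>2)}"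

definition L2_nrm :: "(real \<Rightarrow> complex^3) \<Rightarrow> real" where
  "L2_nrm f = sqrt (\<integral>x. (norm (f x))\<^sup>2 \<partial>lborel)"

definition H1_deriv :: "(real \<Rightarrow> complex^3) \<Rightarrow> (real \<Rightarrow> complex^3) \<Rightarrow> bool" where
  "H1_deriv f g \<longleftrightarrow> f \<in> L2_fun \<and> g \<in> L2_fun \<and>
     (\<forall>a b. a \<le> b \<longrightarrow> (g has_integral (f b - f a)) {a..b})"

text \<open>Complexified \<open>L\<^sup>2\<close> vector fields tangent to the sphere along \<open>n\<close>.\<close>

definition L2_tangent :: "(real \<Rightarrow> real^3) \<Rightarrow> (real \<Rightarrow> complex^3) set" where
  "L2_tangent n =
     {f \<in> L2_fun. AE x in lborel. n x \<bullet> Re_vec (f x) = 0 \<and> n x \<bullet> Im_vec (f x) = 0}"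

text \<open>
  The linearized equation is \<open>v\<^sub>t = L v\<close>, where \<open>L\<close> has domain the tangent \<open>H\<^sup>2\<close> fields;
  the pairs \<open>(v, p)\<close> below form the graph of \<open>L\<close>.
\<close>

definition lin_graph ::
    "real \<Rightarrow> real \<Rightarrow> real \<Rightarrow> real \<Rightarrow> real \<Rightarrow> (real \<Rightarrow> real^3) \<Rightarrow> ((real \<Rightarrow> complex^3) \<times> (real \<Rightarrow> complex^3)) set" where
  "lin_graph \<alpha> \<beta> h \<mu> \<omega> n =
     {(v, p). v \<in> L2_tangent n \<and> p \<in> L2_tangent n \<and>
        (\<exists>v' v''. H1_deriv v v' \<and> H1_deriv v' v'' \<and>
           (AE x in lborel.
              lin_residual \<alpha> \<beta> h \<mu> \<omega> n x (Re_vec (v x)) (Re_vec (p x)) (Re_vec (v'' x)) = 0 \<and>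
              lin_residual \<alpha> \<beta> h \<mu> \<omega> n x (Im_vec (v x)) (Im_vec (p x)) (Im_vec (v'' x)) = 0))}"

text \<open>
  For a linear operator with graph \<open>G\<close> in the space \<open>X\<close> of square integrable functions,
  \<open>z\<close> belongs to the resolvent set if \<open>z - L\<close> is bijective with bounded inverse. The
  equation \<open>(z - L) v = f\<close> is \<open>L v = z v - f\<close>; the norm bound includes uniqueness up to null
  sets (take \<open>f = 0\<close>).
\<close>

definition resolvent_set ::
    "(real \<Rightarrow> complex^3) set \<Rightarrow> ((real \<Rightarrow> complex^3) \<times> (real \<Rightarrow> complex^3)) set \<Rightarrow> complex set" where
  "resolvent_set X G =
     {z. \<exists>B. \<forall>f\<in>X.
        (\<exists>v. (v, \<lambda>x. z *s v x - f x) \<in> G) \<and>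
        (\<forall>v. (v, \<lambda>x. z *s v x - f x) \<in> G \<longrightarrow> L2_nrm v \<le> B * L2_nrm f)}"

definition wavetrain_spectrum :: "real \<Rightarrow> real \<Rightarrow> real \<Rightarrow> real \<Rightarrow> real \<Rightarrow> real \<Rightarrow> real \<Rightarrow> complex set" where
  "wavetrain_spectrum \<alpha> \<beta> h \<mu> k \<omega> \<theta> =
     (let n = (\<lambda>x. wavetrain k \<omega> \<theta> x 0)
      in - resolvent_set (L2_tangent n) (lin_graph \<alpha> \<beta> h \<mu> \<omega> n))"

definition stable_wavetrain :: "real \<Rightarrow> real \<Rightarrow> real \<Rightarrow> real \<Rightarrow> real \<Rightarrow> real \<Rightarrow> real \<Rightarrow> bool" where
  "stable_wavetrain \<alpha> \<beta> h \<mu> k \<omega> \<theta> \<longleftrightarrow>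
     llgs_solution \<alpha> \<beta> h \<mu> (wavetrain k \<omega> \<theta>) \<and>
     (\<forall>z \<in> wavetrain_spectrum \<alpha> \<beta> h \<mu> k \<omega> \<theta>. \<not> Re z > 0)"

definition unstable_wavetrain :: "real \<Rightarrow> real \<Rightarrow> real \<Rightarrow> real \<Rightarrow> real \<Rightarrow> real \<Rightarrow> real \<Rightarrow> bool" where
  "unstable_wavetrain \<alpha> \<beta> h \<mu> k \<omega> \<theta> \<longleftrightarrow>
     llgs_solution \<alpha> \<beta> h \<mu> (wavetrain k \<omega> \<theta>) \<and>
     (\<exists>z \<in> wavetrain_spectrum \<alpha> \<beta> h \<mu> k \<omega> \<theta>. Re z > 0)"

end

theory Submission
  imports Defs "HOL-Computational_Algebra.Fundamental_Theorem_Algebra" "HOL-Real_Asymp.Real_Asymp"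
begin

text \<open>
  With \<open>u = cos \<theta>\<close> the coherent structure system becomes \<open>u'\<^sup>2 = P(u)\<close> for a quartic \<open>P\<close> that is negative
  at \<open>\<plusminus>1\<close>. Two turning points of an orbit make it periodic (reflection symmetry), and otherwise the
  orbit tends on both sides to the same double root of \<open>P\<close>, because two distinct double roots would
  force \<open>P \<le> 0\<close>. The homoclinic orbits are explicit: \<open>1 / (u - L)\<close> is a shifted hyperbolic cosine.

  In the frame rotating with the wavetrain the linearization is \<open>(J - \<alpha>) A / (1 + \<alpha>\<^sup>2)\<close> with a rotation \<open>J\<close> and
  the symmetric Hessian \<open>A\<close> of the energy, whose Fourier symbol is positive semidefinite iff
  \<open>(\<mu> - q\<^sup>2) sin\<^sup>2 \<theta> \<ge> 4 q\<^sup>2 cos\<^sup>2 \<theta>\<close>. The same quantity is \<open>P''/2\<close> at the equilibrium, and its sign is that of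
  the derivative of the first integral along the wavetrain curve, so that stability, hyperbolicity and
  transversality are one condition. The resolvent is constructed without Fourier analysis, by inverting
  first-order factors of the determinant; instability follows from slowly modulated plane waves.
\<close>

section \<open>Constant-coefficient operators on square integrable functions\<close>

text \<open>A perturbation written in the tangent frame carried along the wavetrain satisfies an
  equation with constant coefficients. With S = (\<mu> - q^2) sin^2 \<theta> and \<kappa> = 2 q cos
  \<theta>, wave number l gives the dispersion relation (1 + \<alpha>^2) z^2 + (\<alpha> (2 l^2 + S)
  - 2 i \<kappa> l) z + l^2 (l^2 + S - \<kappa>^2) = 0. Its last term becomes negative for small l
  exactly when S < \<kappa>^2; this is the origin of the stability condition. Equality is still
  stable, but the explicit homoclinic orbits break down there, and transversality serves to exclude
  it. Elements of the domain have only square integrable derivatives. Hence the product rule for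
  absolutely continuous functions: the a priori estimates all come from differentiating |u|^2. A
  second obstacle is h = \<Omega>. Then all points with q^2 = \<mu> are equilibria, the wavetrain
  curves do not contain them, and both their instability and their role as possible limits of orbits
  need separate arguments.\<close>

text \<open>\<open>u\<close> is locally absolutely continuous with derivative \<open>g\<close> almost everywhere.\<close>

definition ac_deriv :: "(real \<Rightarrow> complex) \<Rightarrow> (real \<Rightarrow> complex) \<Rightarrow> bool" where
  "ac_deriv u g \<longleftrightarrow> (\<forall>a b. a \<le> b \<longrightarrow> set_integrable lborel {a..b} g \<and> (LINT x:{a..b}|lborel. g x) = u b - u a)"

lemma ac_derivD:
  assumes "ac_deriv u g" "a \<le> b"
  shows "set_integrable lborel {a..b} g" "(LINT x:{a..b}|lborel. g x) = u b - u a"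
  using assms by (auto simp: ac_deriv_def)

text \<open>H^1 is defined through the gauge integral, while Fubini and monotonicity are used in
  Lebesgue form. The two integrals agree as soon as \<open>g\<close> is Lebesgue integrable on
  compact intervals.\<close>

lemma ac_deriv_iff_has_integral:
  "ac_deriv u g \<longleftrightarrow> (\<forall>a b. a \<le> b \<longrightarrow> set_integrable lborel {a..b} g \<and> (g has_integral (u b - u a)) {a..b})"
  unfolding ac_deriv_def
  by (metis has_integral_integrable_integral integral_unique set_borel_integral_eq_integral)

lemma ac_deriv_continuous:
  assumes "ac_deriv u g"
  shows "continuous_on UNIV u"
proof -
  have "isCont u x" for x
  proof -
    have int: "g integrable_on {x-1..x+1}"
      using ac_derivD(1)[OF assms, of "x-1" "x+1"] set_borel_integral_eq_integral(1) by auto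
    have "continuous_on {x-1..x+1} (\<lambda>y. integral {x-1..y} g + u (x-1))"
      by (intro continuous_intros indefinite_integral_continuous_1 int)
    moreover have "integral {x-1..y} g + u (x-1) = u y" if "y \<in> {x-1..x+1}" for y
      using assms that unfolding ac_deriv_iff_has_integral
      by (metis (no_types, lifting) atLeastAtMost_iff diff_add_cancel integral_unique)
    ultimately have "continuous_on {x-1..x+1} u"
      by (metis (no_types, lifting) continuous_on_cong)
    thus ?thesis
      by (simp add: continuous_on_interior)
  qed
  thus ?thesis by (simp add: continuous_at_imp_continuous_on)
qed

lemma ac_deriv_add: "ac_deriv u g \<Longrightarrow> ac_deriv v h \<Longrightarrow> ac_deriv (\<lambda>x. u x + v x) (\<lambda>x. g x + h x)"
  by (auto simp: ac_deriv_def)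

lemma ac_deriv_cmult: "ac_deriv u g \<Longrightarrow> ac_deriv (\<lambda>x. c * u x) (\<lambda>x. c * g x)"
  by (auto simp: ac_deriv_def right_diff_distrib)

lemma ac_deriv_C1:
  assumes d: "\<And>x. (u has_vector_derivative g x) (at x)" and c: "continuous_on UNIV g"
  shows "ac_deriv u g"
  unfolding ac_deriv_iff_has_integral
proof (intro allI impI conjI)
  fix a b :: real assume ab: "a \<le> b"
  show "set_integrable lborel {a..b} g"
    by (intro borel_integrable_atLeastAtMost' continuous_on_subset[OF c]) auto
  show "(g has_integral u b - u a) {a..b}"
    using ab by (intro fundamental_theorem_of_calculus) (auto intro: has_vector_derivative_at_within d)
qed

lemma ac_deriv_cnj:
  assumes "ac_deriv u g"
  shows "ac_deriv (\<lambda>x. cnj (u x)) (\<lambda>x. cnj (g x))"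
  unfolding ac_deriv_iff_has_integral
proof (intro allI impI conjI)
  fix a b :: real assume ab: "a \<le> b"
  have s: "set_integrable lborel {a..b} g" and h: "(g has_integral u b - u a) {a..b}"
    using assms ab by (auto simp: ac_deriv_iff_has_integral)
  have "integrable lborel (\<lambda>x. cnj (indicator {a..b} x *\<^sub>R g x))"
    using s unfolding set_integrable_def complex_integrable_cnj .
  thus "set_integrable lborel {a..b} (\<lambda>x. cnj (g x))"
    by (simp add: set_integrable_def)
  show "((\<lambda>x. cnj (g x)) has_integral cnj (u b) - cnj (u a)) {a..b}"
    using has_integral_linear[OF h bounded_linear_cnj] by (simp add: o_def)
qed

text \<open>Both sides of the product rule are the integral of \<open>g(x) h(y)\<close> over the square; Fubini is
  applied to the two triangles \<open>y \<le> x\<close> and \<open>x < y\<close>.\<close>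

lemma ac_deriv_mult:
  assumes u: "ac_deriv u g" and v: "ac_deriv v h"
  shows "ac_deriv (\<lambda>x. u x * v x) (\<lambda>x. g x * v x + u x * h x)"
  unfolding ac_deriv_def
proof (intro allI impI)
  fix a b :: real assume ab: "a \<le> b"
  define f where "f x = indicator {a..b} x *\<^sub>R g x" for x
  define k where "k x = indicator {a..b} x *\<^sub>R h x" for x
  have f: "integrable lborel f" and k: "integrable lborel k"
    using ac_derivD(1)[OF u ab] ac_derivD(1)[OF v ab] unfolding f_def k_def set_integrable_def by auto
  have [measurable]: "f \<in> borel_measurable borel" "k \<in> borel_measurable borel"
    using f k by (auto dest: borel_measurable_integrable)
  have If: "(LINT x|lborel. f x) = u b - u a" and Ik: "(LINT x|lborel. k x) = v b - v a"
    using ac_derivD(2)[OF u ab] ac_derivD(2)[OF v ab] unfolding f_def k_def set_lebesgue_integral_def by auto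
  have prod: "integrable (lborel \<Otimes>\<^sub>M lborel) (\<lambda>(x, y). f x * k y)"
  proof (rule lborel_pair.Fubini_integrable)
    show "(\<lambda>(x, y). f x * k y) \<in> borel_measurable (lborel \<Otimes>\<^sub>M lborel)" by measurable
    show "integrable lborel (\<lambda>x. LINT y|lborel. norm (case (x, y) of (x, y) \<Rightarrow> f x * k y))"
      using f by (simp add: norm_mult)
    show "AE x in lborel. integrable lborel (\<lambda>y. case (x, y) of (x, y) \<Rightarrow> f x * k y)"
      using k by simp
  qed
  let ?A = "{z :: real \<times> real. snd z \<le> fst z}"
  have A: "?A \<in> sets (lborel \<Otimes>\<^sub>M lborel)"
    unfolding lborel_prod sets_lborel by (intro borel_closed closed_Collect_le continuous_intros)
  have p1: "integrable (lborel \<Otimes>\<^sub>M lborel) (\<lambda>(x, y). indicator {..x} y *\<^sub>R (f x * k y))"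
    using integrable_mult_indicator[OF A prod]
    by (rule Bochner_Integration.integrable_cong[THEN iffD1, rotated -1]) (auto simp: indicator_def)
  have p2: "integrable (lborel \<Otimes>\<^sub>M lborel) (\<lambda>(x, y). indicator {..<y} x *\<^sub>R (f x * k y))"
    using Bochner_Integration.integrable_diff[OF prod p1]
    by (rule Bochner_Integration.integrable_cong[THEN iffD1, rotated -1]) (auto simp: indicator_def)
  have "(LINT z|(lborel \<Otimes>\<^sub>M lborel). (case z of (x, y) \<Rightarrow> f x * k y)) =
        (LINT z|(lborel \<Otimes>\<^sub>M lborel). (case z of (x, y) \<Rightarrow> indicator {..x} y *\<^sub>R (f x * k y))) +
        (LINT z|(lborel \<Otimes>\<^sub>M lborel). (case z of (x, y) \<Rightarrow> indicator {..<y} x *\<^sub>R (f x * k y)))"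
    by (subst Bochner_Integration.integral_add[OF p1 p2, symmetric])
       (auto intro!: Bochner_Integration.integral_cong simp: indicator_def)
  moreover have "(LINT z|(lborel \<Otimes>\<^sub>M lborel). (case z of (x, y) \<Rightarrow> f x * k y)) = (u b - u a) * (v b - v a)"
    using lborel_pair.integral_fst[OF prod] If Ik by simp
  moreover have e1: "(LINT y|lborel. indicator {..x} y *\<^sub>R (f x * k y)) = f x * (v x - v a)" for x
  proof (cases "x \<in> {a..b}")
    case True
    have "(LINT y|lborel. indicator {..x} y *\<^sub>R (f x * k y)) = (LINT y|lborel. f x * (indicator {a..x} y *\<^sub>R h y))"
      using True by (intro Bochner_Integration.integral_cong) (auto simp: k_def indicator_def)
    also have "\<dots> = f x * (v x - v a)"
      using ac_derivD(2)[OF v, of a x] True by (simp only: integral_mult_right_zero) (simp add: set_lebesgue_integral_def)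
    finally show ?thesis .
  qed (simp add: f_def)
  moreover have e2: "(LINT x|lborel. indicator {..<y} x *\<^sub>R (f x * k y)) = (u y - u a) * k y" for y
  proof (cases "y \<in> {a..b}")
    case True
    \<comment> \<open>The second triangle omits the diagonal, so \<open>{..<y}\<close> and
      \<open>{a..y}\<close> have to be compared up to the single point y.\<close>
    have "(LINT x|lborel. indicator {..<y} x *\<^sub>R (f x * k y)) = (LINT x|lborel. (indicator {a..y} x *\<^sub>R g x) * k y)"
    proof (rule integral_cong_AE)
      show "AE x in lborel. indicator {..<y} x *\<^sub>R (f x * k y) = indicator {a..y} x *\<^sub>R g x * k y"
        using AE_lborel_singleton[of y] by eventually_elim (use True in \<open>auto simp: f_def indicator_def\<close>)
      have "integrable lborel (\<lambda>x. indicator {a..y} x *\<^sub>R g x)"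
        using ac_derivD(1)[OF u, of a y] True by (simp add: set_integrable_def)
      thus "(\<lambda>x. indicator {a..y} x *\<^sub>R g x * k y) \<in> borel_measurable lborel"
        by (rule borel_measurable_times[OF borel_measurable_integrable borel_measurable_const])
    qed measurable
    also have "\<dots> = (u y - u a) * k y"
      using ac_derivD(2)[OF u, of a y] True by (simp only: integral_mult_left_zero) (simp add: set_lebesgue_integral_def)
    finally show ?thesis .
  qed (simp add: k_def)
  moreover note lborel_pair.integral_fst[OF p1] lborel_pair.integral_snd[OF p2]
  ultimately have eq: "(LINT x|lborel. f x * (v x - v a)) + (LINT y|lborel. (u y - u a) * k y) = (u b - u a) * (v b - v a)"
    by simp
  have i1: "integrable lborel (\<lambda>x. f x * (v x - v a))"
    using lborel_pair.integrable_fst[OF p1] by (simp only: e1)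
  have i2: "integrable lborel (\<lambda>x. (u x - u a) * k x)"
    using lborel_pair.integrable_snd[OF p2] by (simp only: e2)
  \<comment> \<open>Fubini sees \<open>u\<close> and \<open>v\<close> only relative to their values
    at \<open>a\<close>; the second bracket restores the full products.\<close>
  have i3: "integrable lborel (\<lambda>x. (f x * (v x - v a) + (u x - u a) * k x) + (f x * v a + u a * k x))"
    using i1 i2 f k by auto
  have i4: "(\<lambda>x. (f x * (v x - v a) + (u x - u a) * k x) + (f x * v a + u a * k x)) =
        (\<lambda>x. indicator {a..b} x *\<^sub>R (g x * v x + u x * h x))"
    by (auto simp: f_def k_def indicator_def algebra_simps)
  have "(LINT x|lborel. (f x * (v x - v a) + (u x - u a) * k x) + (f x * v a + u a * k x)) = 
        (u b - u a) * (v b - v a) + ((u b - u a) * v a + u a * (v b - v a))"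
    using i1 i2 f k by (subst Bochner_Integration.integral_add) (auto simp: eq If Ik)
  thus "set_integrable lborel {a..b} (\<lambda>x. g x * v x + u x * h x) \<and>
        (LINT x:{a..b}|lborel. g x * v x + u x * h x) = u b * v b - u a * v a"
    using i3 unfolding i4 set_integrable_def set_lebesgue_integral_def by (simp add: algebra_simps)
qed

text \<open>The product rule for \<open>u\<close> and its conjugate. The resulting integrand is
  real, so the complex statement can be read as a real one.\<close>

lemma ac_deriv_energy:
  assumes u: "ac_deriv u g" and ab: "a \<le> b"
  shows "set_integrable lborel {a..b} (\<lambda>x. 2 * Re (cnj (u x) * g x))"
    and "(LINT x:{a..b}|lborel. 2 * Re (cnj (u x) * g x)) = (cmod (u b))\<^sup>2 - (cmod (u a))\<^sup>2"
proof -
  have "ac_deriv (\<lambda>x. of_real ((cmod (u x))\<^sup>2)) (\<lambda>x. of_real (2 * Re (cnj (u x) * g x)))"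
  proof -
    have "(\<lambda>x. g x * cnj (u x) + u x * cnj (g x)) = (\<lambda>x. of_real (2 * Re (cnj (u x) * g x)))"
      by (auto simp: fun_eq_iff complex_eq_iff algebra_simps)
    thus ?thesis
      using ac_deriv_mult[OF u ac_deriv_cnj[OF u]] by (simp only: complex_norm_square)
  qed
  from ac_derivD[OF this ab]
  have 1: "set_integrable lborel {a..b} (\<lambda>x. complex_of_real (2 * Re (cnj (u x) * g x)))"
    and 2: "(LINT x:{a..b}|lborel. complex_of_real (2 * Re (cnj (u x) * g x))) = of_real ((cmod (u b))\<^sup>2 - (cmod (u a))\<^sup>2)"
    by (auto simp only: of_real_diff)
  have "integrable lborel (\<lambda>x. complex_of_real (indicator {a..b} x *\<^sub>R (2 * Re (cnj (u x) * g x))))"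
    using 1 unfolding set_integrable_def by (simp add: scaleR_conv_of_real)
  thus "set_integrable lborel {a..b} (\<lambda>x. 2 * Re (cnj (u x) * g x))"
    unfolding set_integrable_def complex_of_real_integrable_eq .
  show "(LINT x:{a..b}|lborel. 2 * Re (cnj (u x) * g x)) = (cmod (u b))\<^sup>2 - (cmod (u a))\<^sup>2"
    using 2 by (simp only: set_integral_complex_of_real of_real_eq_iff)
qed

section \<open>Square integrable functions and H^1 on the line\<close>

definition sL2 :: "(real \<Rightarrow> complex) \<Rightarrow> bool" where
  "sL2 f \<longleftrightarrow> f \<in> borel_measurable borel \<and> integrable lborel (\<lambda>x. (cmod (f x))\<^sup>2)"

definition nsq :: "(real \<Rightarrow> complex) \<Rightarrow> real" where
  "nsq f = (LINT x|lborel. (cmod (f x))\<^sup>2)"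

definition sH1 :: "(real \<Rightarrow> complex) \<Rightarrow> (real \<Rightarrow> complex) \<Rightarrow> bool" where
  "sH1 u g \<longleftrightarrow> sL2 u \<and> sL2 g \<and> ac_deriv u g"

lemma nsq_nonneg: "0 \<le> nsq f"
  by (simp add: nsq_def)

lemma sL2_measurable[measurable_dest]: "sL2 f \<Longrightarrow> f \<in> borel_measurable borel"
  by (simp add: sL2_def)

lemma sL2_bound:
  assumes f: "sL2 f" and g[measurable]: "g \<in> borel_measurable borel" and le: "AE x in lborel. cmod (g x) \<le> K * cmod (f x)"
  shows "sL2 g" and "nsq g \<le> K\<^sup>2 * nsq f"
proof -
  have i: "integrable lborel (\<lambda>x. K\<^sup>2 * (cmod (f x))\<^sup>2)" using f by (simp add: sL2_def)
  have ae: "AE x in lborel. (cmod (g x))\<^sup>2 \<le> K\<^sup>2 * (cmod (f x))\<^sup>2"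
    using le
  proof eventually_elim
    case (elim x)
    thus ?case using power_mono[OF elim, of 2] by (simp add: power_mult_distrib)
  qed
  have ig: "integrable lborel (\<lambda>x. (cmod (g x))\<^sup>2)"
    using i by (rule Bochner_Integration.integrable_bound) (use ae in auto)
  thus "sL2 g" by (simp add: sL2_def)
  show "nsq g \<le> K\<^sup>2 * nsq f"
    using integral_mono_AE[OF ig i ae] by (simp add: nsq_def)
qed

lemma cmod_add_sq_le: "(cmod (z + w))\<^sup>2 \<le> 2 * (cmod z)\<^sup>2 + 2 * (cmod w)\<^sup>2"
proof -
  have "(cmod (z + w))\<^sup>2 \<le> (cmod z + cmod w)\<^sup>2"
    by (intro power_mono norm_triangle_ineq) auto
  also have "\<dots> \<le> 2 * (cmod z)\<^sup>2 + 2 * (cmod w)\<^sup>2"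
    using zero_le_power2[of "cmod z - cmod w"] by (simp add: power2_eq_square algebra_simps)
  finally show ?thesis .
qed

lemma sL2_add:
  assumes f: "sL2 f" and g: "sL2 g"
  shows "sL2 (\<lambda>x. f x + g x)" and "nsq (\<lambda>x. f x + g x) \<le> 2 * nsq f + 2 * nsq g"
proof -
  note [measurable] = f g
  have i: "integrable lborel (\<lambda>x. 2 * (cmod (f x))\<^sup>2 + 2 * (cmod (g x))\<^sup>2)"
    using f g by (simp add: sL2_def)
  have ig: "integrable lborel (\<lambda>x. (cmod (f x + g x))\<^sup>2)"
    using i by (rule Bochner_Integration.integrable_bound) (auto intro!: AE_I2 cmod_add_sq_le order_trans[OF cmod_add_sq_le])
  thus "sL2 (\<lambda>x. f x + g x)" by (simp add: sL2_def)
  have "nsq (\<lambda>x. f x + g x) \<le> (LINT x|lborel. 2 * (cmod (f x))\<^sup>2 + 2 * (cmod (g x))\<^sup>2)"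
    unfolding nsq_def by (intro integral_mono ig i cmod_add_sq_le)
  also have "\<dots> = 2 * nsq f + 2 * nsq g"
    using f g by (simp add: nsq_def sL2_def)
  finally show "nsq (\<lambda>x. f x + g x) \<le> 2 * nsq f + 2 * nsq g" .
qed

lemma sL2_cmult: "sL2 f \<Longrightarrow> sL2 (\<lambda>x. c * f x)"
  by (auto simp: sL2_def norm_mult power_mult_distrib)

lemma nsq_cmult: "nsq (\<lambda>x. c * f x) = (cmod c)\<^sup>2 * nsq f"
  by (simp add: nsq_def norm_mult power_mult_distrib)

lemma sL2_diff: "sL2 f \<Longrightarrow> sL2 g \<Longrightarrow> sL2 (\<lambda>x. f x - g x)"
  using sL2_add(1)[of f "\<lambda>x. (-1) * g x"] sL2_cmult[of g "-1"] by simp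

text \<open>The inequality t <= 1 + t^2 dominates |f| on a bounded interval, in place of
  Cauchy-Schwarz.\<close>

lemma sL2_imp_set_integrable:
  assumes "sL2 f"
  shows "set_integrable lborel {a..b} f"
proof -
  note [measurable] = assms
  have "integrable lborel (\<lambda>x. indicat_real {a..b} x + (cmod (f x))\<^sup>2)"
    using assms by (intro Bochner_Integration.integrable_add) (auto simp: sL2_def integrable_indicator_iff emeasure_lborel_Icc_eq)
  thus ?thesis unfolding set_integrable_def
  proof (rule Bochner_Integration.integrable_bound)
    have "t \<le> 1 + t\<^sup>2" for t :: real
      using zero_le_power2[of "2*t-1"] by (simp add: power2_eq_square algebra_simps)
    thus "AE x in lborel. norm (indicat_real {a..b} x *\<^sub>R f x) \<le> norm (indicat_real {a..b} x + (cmod (f x))\<^sup>2)"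
      by (intro AE_I2) (auto simp: indicator_def)
  qed measurable
qed

lemma sH1_iff_has_integral:
  "sH1 u g \<longleftrightarrow> sL2 u \<and> sL2 g \<and> (\<forall>a b. a \<le> b \<longrightarrow> (g has_integral (u b - u a)) {a..b})"
  by (auto simp: sH1_def ac_deriv_iff_has_integral sL2_imp_set_integrable)

lemma sH1_add: "sH1 u g \<Longrightarrow> sH1 v h \<Longrightarrow> sH1 (\<lambda>x. u x + v x) (\<lambda>x. g x + h x)"
  by (auto simp: sH1_def ac_deriv_add sL2_add)

lemma sH1_cmult: "sH1 u g \<Longrightarrow> sH1 (\<lambda>x. c * u x) (\<lambda>x. c * g x)"
  by (auto simp: sH1_def ac_deriv_cmult sL2_cmult)

lemma sH1_diff: "sH1 u g \<Longrightarrow> sH1 v h \<Longrightarrow> sH1 (\<lambda>x. u x - v x) (\<lambda>x. g x - h x)"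
  using sH1_add[of u g "\<lambda>x. (-1) * v x" "\<lambda>x. (-1) * h x"] sH1_cmult[of v h "-1"] by simp

text \<open>Used for multiplication by the components of the moving frame, which are bounded and
  have bounded derivatives.\<close>

lemma sH1_mult_C1:
  assumes u: "sH1 u g" and d: "\<And>x. (c has_vector_derivative c' x) (at x)" and c': "continuous_on UNIV c'"
    and b: "\<And>x. cmod (c x) \<le> K" and b': "\<And>x. cmod (c' x) \<le> K'"
  shows "sH1 (\<lambda>x. c x * u x) (\<lambda>x. c' x * u x + c x * g x)"
proof -
  have c: "continuous_on UNIV c"
    using d by (meson continuous_at_imp_continuous_on has_vector_derivative_continuous)
  have [measurable]: "c \<in> borel_measurable borel" "c' \<in> borel_measurable borel"
    using c c' by (auto intro: borel_measurable_continuous_onI)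
  have s: "sL2 u" "sL2 g" using u by (auto simp: sH1_def)
  note [measurable] = s
  have "sL2 (\<lambda>x. c x * u x)" "sL2 (\<lambda>x. c' x * u x)" "sL2 (\<lambda>x. c x * g x)"
    by (rule sL2_bound(1)[of _ _ K] sL2_bound(1)[of _ _ K'], rule s, measurable, auto simp: norm_mult intro!: mult_right_mono b b')+
  moreover have "ac_deriv (\<lambda>x. c x * u x) (\<lambda>x. c' x * u x + c x * g x)"
    using u by (intro ac_deriv_mult[OF ac_deriv_C1[OF d c']]) (auto simp: sH1_def)
  ultimately show ?thesis by (simp add: sH1_def sL2_add)
qed

text \<open>Monotone convergence along the intervals [-n, n]. It turns uniform bounds on compact
  intervals into integrability on the whole line.\<close>

lemma integrable_of_bounded_truncations:
  fixes g :: "real \<Rightarrow> real"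
  assumes [measurable]: "g \<in> borel_measurable borel" and nn: "\<And>x. 0 \<le> g x"
    and int: "\<And>n::nat. set_integrable lborel {-real n..real n} g"
    and K: "\<And>n::nat. (LINT x:{-real n..real n}|lborel. g x) \<le> K"
  shows "integrable lborel g" and "(LINT x|lborel. g x) \<le> K"
proof -
  let ?g = "\<lambda>n x. ennreal (indicator {-real n..real n} x * g x)"
  have "incseq ?g"
    by (auto simp: incseq_def le_fun_def indicator_def intro!: ennreal_leI nn)
  moreover have "(SUP n. ?g n x) = ennreal (g x)" for x
  proof (rule antisym)
    show "(SUP n. ?g n x) \<le> ennreal (g x)"
      by (auto simp: SUP_le_iff indicator_def intro!: ennreal_leI nn)
    obtain n :: nat where "\<bar>x\<bar> \<le> n" using real_arch_simple by blast
    thus "ennreal (g x) \<le> (SUP n. ?g n x)"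
      by (intro SUP_upper2[of n]) (auto simp: indicator_def)
  qed
  ultimately have "(\<integral>\<^sup>+x. ennreal (g x) \<partial>lborel) = (SUP n. \<integral>\<^sup>+x. ?g n x \<partial>lborel)"
    by (subst nn_integral_monotone_convergence_SUP[symmetric]) (auto simp flip: SUP_apply)
  also have "\<dots> \<le> ennreal K"
  proof (rule SUP_least)
    fix n :: nat
    have "(\<integral>\<^sup>+x. ?g n x \<partial>lborel) = ennreal (LINT x|lborel. indicator {-real n..real n} x * g x)"
      using int[of n] nn by (intro nn_integral_eq_integral) (auto simp: set_integrable_def)
    also have "\<dots> \<le> ennreal K"
      using K[of n] by (intro ennreal_leI) (simp add: set_lebesgue_integral_def)
    finally show "(\<integral>\<^sup>+x. ?g n x \<partial>lborel) \<le> ennreal K" .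
  qed
  finally have le: "(\<integral>\<^sup>+x. ennreal (g x) \<partial>lborel) \<le> ennreal K" .
  show i: "integrable lborel g"
    by (rule integrableI_nonneg) (use nn le in \<open>auto simp: less_top top_unique intro: le_less_trans\<close>)
  have "0 \<le> K" using K[of 0] nn by (auto intro: order_trans[rotated] simp: set_lebesgue_integral_def)
  thus "(LINT x|lborel. g x) \<le> K"
    using le nn_integral_eq_integral[OF i] nn by (simp add: ennreal_le_iff)
qed

text \<open>A nonnegative function that stays above \<open>e\<close> on an interval of length m has
  integral at least e m. This replaces the decay of H^1 functions at infinity: endpoints with small
  boundary terms exist arbitrarily far out.\<close>

lemma integrable_small_somewhere:
  fixes g :: "real \<Rightarrow> real"
  assumes i: "integrable lborel g" and nn: "\<And>x. 0 \<le> g x" and e: "0 < e"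
  shows "\<exists>m>0. \<forall>c. \<exists>x\<in>{c..c+m}. g x < e"
proof -
  \<comment> \<open>The extra 1 makes e m exceed the integral strictly.\<close>
  define m where "m = (integral\<^sup>L lborel g + 1) / e"
  have I: "0 \<le> integral\<^sup>L lborel g" using nn by simp
  have m: "m > 0" using I e by (auto simp: m_def intro!: divide_pos_pos)
  have "\<exists>x\<in>{c..c+m}. g x < e" for c
  proof (rule ccontr)
    assume "\<not> ?thesis"
    hence "e * indicator {c..c+m} x \<le> g x" for x
      using nn by (auto simp: indicator_def not_less)
    moreover have "integrable lborel (\<lambda>x. e * indicator {c..c+m} x)"
      by (auto simp: integrable_indicator_iff emeasure_lborel_Icc_eq)
    ultimately have "(LINT x|lborel. e * indicator {c..c+m} x) \<le> integral\<^sup>L lborel g"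
      using i by (intro integral_mono) auto
    moreover have "(LINT x|lborel. e * indicator {c..c+m} x) = e * m" using m by simp
    ultimately show False using e by (simp add: m_def)
  qed
  thus ?thesis using m by blast
qed

section \<open>First-order equations u' = \<nu> u + f with nonzero Re \<nu>\<close>

text \<open>Young's inequality, weighted so that the cross term costs only half of the term 2 r
  |u|^2 in the energy identity.\<close>

lemma cross_term_bound:
  assumes "r > 0"
  shows "2 * \<bar>Re (cnj z * w)\<bar> \<le> r * (cmod z)\<^sup>2 + (cmod w)\<^sup>2 / r"
proof -
  have "\<bar>Re (cnj z * w)\<bar> \<le> cmod z * cmod w"
    using abs_Re_le_cmod[of "cnj z * w"] by (simp add: norm_mult)
  moreover have "2 * (cmod z * cmod w) \<le> r * (cmod z)\<^sup>2 + (cmod w)\<^sup>2 / r"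
    using zero_le_power2[of "r * cmod z - cmod w"] assms
    by (simp add: field_simps power2_eq_square)
  ultimately show ?thesis by linarith
qed

text \<open>The derivative of |u|^2 is 2 Re \<nu> |u|^2 + 2 Re (cnj u f). Multiplication by the sign
  of Re \<nu> makes the first term positive, and half of it absorbs the second. Both boundary terms
  are estimated with a plus sign, so one bound serves both signs.\<close>

lemma first_order_local_bound:
  assumes u: "ac_deriv u (\<lambda>x. \<nu> * u x + f x)" and f: "sL2 f" and r: "r = \<bar>Re \<nu>\<bar>" "r > 0" and ab: "a \<le> b"
  shows "r * (LINT x:{a..b}|lborel. (cmod (u x))\<^sup>2) \<le> (cmod (u a))\<^sup>2 + (cmod (u b))\<^sup>2 + nsq f / r"
proof -
  note [measurable] = f
  have cu: "continuous_on {a..b} u"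
    using ac_deriv_continuous[OF u] continuous_on_subset by blast
  have iu: "set_integrable lborel {a..b} (\<lambda>x. (cmod (u x))\<^sup>2)"
    by (intro borel_integrable_atLeastAtMost' continuous_intros cu)
  have iff: "set_integrable lborel {a..b} (\<lambda>x. (cmod (f x))\<^sup>2)"
    using f unfolding set_integrable_def by (intro integrable_mult_indicator) (auto simp: sL2_def)
  define g where "g x = 2 * Re (cnj (u x) * (\<nu> * u x + f x))" for x
  have ig: "set_integrable lborel {a..b} g" "(LINT x:{a..b}|lborel. g x) = (cmod (u b))\<^sup>2 - (cmod (u a))\<^sup>2"
    unfolding g_def by (rule ac_deriv_energy[OF u ab])+
  define \<sigma> where "\<sigma> = sgn (Re \<nu>)"
  have \<sigma>: "\<sigma> * Re \<nu> = r" "\<bar>\<sigma>\<bar> = 1" using r by (auto simp: \<sigma>_def sgn_real_def)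
  have "r * (cmod (u x))\<^sup>2 \<le> \<sigma> * g x + (cmod (f x))\<^sup>2 / r" for x
  proof -
    have "g x = 2 * Re \<nu> * (cmod (u x))\<^sup>2 + 2 * Re (cnj (u x) * f x)"
      unfolding g_def cmod_power2 by (simp add: power2_eq_square algebra_simps)
    hence "\<sigma> * g x = 2 * r * (cmod (u x))\<^sup>2 + \<sigma> * (2 * Re (cnj (u x) * f x))"
      using \<sigma>(1) by (simp add: algebra_simps)
    moreover have "\<bar>\<sigma> * (2 * Re (cnj (u x) * f x))\<bar> = 2 * \<bar>Re (cnj (u x) * f x)\<bar>"
      using \<sigma>(2) by (simp only: abs_mult)
    ultimately show ?thesis using cross_term_bound[OF r(2), of "u x" "f x"] by linarith
  qed
  hence "(LINT x:{a..b}|lborel. r * (cmod (u x))\<^sup>2) \<le> (LINT x:{a..b}|lborel. \<sigma> * g x + (cmod (f x))\<^sup>2 / r)"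
    using iu iff ig by (intro set_integral_mono) auto
  also have "\<dots> = \<sigma> * ((cmod (u b))\<^sup>2 - (cmod (u a))\<^sup>2) + (LINT x:{a..b}|lborel. (cmod (f x))\<^sup>2) / r"
    using iff ig by (simp add: set_integral_add)
  also have "(LINT x:{a..b}|lborel. (cmod (f x))\<^sup>2) \<le> nsq f"
    unfolding nsq_def set_lebesgue_integral_def using f iff
    by (intro integral_mono) (auto simp: sL2_def set_integrable_def indicator_def)
  also have "\<sigma> * ((cmod (u b))\<^sup>2 - (cmod (u a))\<^sup>2) \<le> (cmod (u a))\<^sup>2 + (cmod (u b))\<^sup>2"
    using \<sigma>(2) by (auto simp: abs_if split: if_splits)
  finally show ?thesis using r by (simp add: divide_right_mono)
qed

text \<open>The local bound, applied on intervals whose endpoints are chosen where |u|^2 is small,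
  so that the boundary terms contribute at most an arbitrary \<open>e\<close>.\<close>

lemma first_order_estimate:
  assumes u: "sH1 u u'" and r: "Re \<nu> \<noteq> 0"
  shows "nsq u \<le> nsq (\<lambda>x. u' x - \<nu> * u x) / (Re \<nu>)\<^sup>2"
proof -
  define r where "r = \<bar>Re \<nu>\<bar>"
  define f where "f x = u' x - \<nu> * u x" for x
  have r0: "r > 0" using r by (simp add: r_def)
  have f: "sL2 f" unfolding f_def using u by (auto simp: sH1_def intro!: sL2_diff sL2_cmult)
  have ac: "ac_deriv u (\<lambda>x. \<nu> * u x + f x)" using u by (simp add: sH1_def f_def)
  have u2: "integrable lborel (\<lambda>x. (cmod (u x))\<^sup>2)" using u by (simp add: sH1_def sL2_def)
  have "r * nsq u \<le> nsq f / r + e" if e: "e > 0" for e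
  proof -
    obtain m where m: "m > 0" "\<And>c. \<exists>x\<in>{c..c+m}. (cmod (u x))\<^sup>2 < e / 2"
      using integrable_small_somewhere[OF u2, of "e/2"] e by auto
    have "(LINT x:{-real n..real n}|lborel. (cmod (u x))\<^sup>2) \<le> (nsq f / r + e) / r" for n
    proof -
      \<comment> \<open>The left endpoint is sought in the interval of length \<open>m\<close> that
        ends at -n, so that it lies beyond the truncation.\<close>
      obtain a where a: "a \<le> -real n" "(cmod (u a))\<^sup>2 < e/2" using m(2)[of "-real n - m"] by auto
      obtain b where b: "b \<ge> real n" "(cmod (u b))\<^sup>2 < e/2" using m(2)[of "real n"] by auto
      have "a \<le> b" using a b by simp
      note l = first_order_local_bound[OF ac f r_def r0 this]
      have "r * (LINT x:{-real n..real n}|lborel. (cmod (u x))\<^sup>2) \<le> r * (LINT x:{a..b}|lborel. (cmod (u x))\<^sup>2)"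
        unfolding set_lebesgue_integral_def
      proof (intro mult_left_mono integral_mono integrable_mult_indicator u2)
        show "indicat_real {-real n..real n} x *\<^sub>R (cmod (u x))\<^sup>2 \<le> indicat_real {a..b} x *\<^sub>R (cmod (u x))\<^sup>2" for x
          using a b by (intro scaleR_right_mono) (auto split: split_indicator)
      qed (use r0 in auto)
      hence "r * (LINT x:{-real n..real n}|lborel. (cmod (u x))\<^sup>2) \<le> nsq f / r + e"
        using l a(2) b(2) by linarith
      thus ?thesis using r0 by (simp add: field_simps)
    qed
    hence "nsq u \<le> (nsq f / r + e) / r"
      unfolding nsq_def using u u2
      by (intro integrable_of_bounded_truncations(2))
         (auto simp: sH1_def sL2_def set_integrable_def simp del: real_scaleR_def intro!: integrable_mult_indicator)
    thus ?thesis using r0 by (simp add: field_simps)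
  qed
  hence "r * nsq u \<le> nsq f / r" by (rule field_le_epsilon)
  hence "nsq u \<le> nsq f / r\<^sup>2" using r0 by (simp add: field_simps power2_eq_square)
  moreover have "f = (\<lambda>x. u' x - \<nu> * u x)" by (simp add: f_def fun_eq_iff)
  ultimately show ?thesis by (simp add: r_def)
qed

lemma exp_tail_integral:
  assumes r: "r > (0::real)"
  shows "integrable lborel (\<lambda>s. indicator {x..} s * exp (2 * r * (x - s)))"
    and "(LINT s|lborel. indicator {x..} s * exp (2 * r * (x - s))) = 1 / (2 * r)"
proof -
  let ?F = "\<lambda>s. - exp (2 * r * (x - s)) / (2 * r)"
  have "(?F \<longlongrightarrow> 0) at_top"
    using r by real_asymp
  hence "(\<integral>\<^sup>+s. ennreal (exp (2 * r * (x - s))) * indicator {x..} s \<partial>lborel) = ennreal (0 - ?F x)"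
    using r by (intro nn_integral_FTC_atLeast) (auto intro!: derivative_eq_intros)
  hence nn: "(\<integral>\<^sup>+s. ennreal (indicator {x..} s * exp (2 * r * (x - s))) \<partial>lborel) = ennreal (1 / (2 * r))"
    by (simp add: ennreal_mult' ennreal_indicator mult.commute)
  show i: "integrable lborel (\<lambda>s. indicator {x..} s * exp (2 * r * (x - s)))"
    by (rule integrableI_nn_integral_finite[OF _ _ nn]) auto
  show "(LINT s|lborel. indicator {x..} s * exp (2 * r * (x - s))) = 1 / (2 * r)"
    using nn nn_integral_eq_integral[OF i] r by auto
qed

text \<open>Variation of constants from \<open>+\<infinity>\<close>; square integrability comes from the energy identity,
  so no convolution inequality is needed.\<close>

lemma first_order_solvable_pos:
  assumes f: "sL2 f" and r: "Re \<nu> > 0"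
  shows "\<exists>u. sH1 u (\<lambda>x. \<nu> * u x + f x)"
proof -
  note [measurable] = f
  define r where "r = Re \<nu>"
  have r0: "r > 0" using r by (simp add: r_def)
  have f2: "integrable lborel (\<lambda>x. (cmod (f x))\<^sup>2)" using f by (simp add: sL2_def)
  define w where "w x s = indicator {x..} s *\<^sub>R (exp (\<nu> * of_real (x - s)) * f s)" for x s :: real
  have [measurable]: "w x \<in> borel_measurable borel" for x
    unfolding w_def by measurable
  \<comment> \<open>A dominating function: a product is at most the sum of the squares of its
    factors, and the squared exponential has rate 2 r.\<close>
  define b where "b x s = indicator {x..} s * exp (2 * r * (x - s)) + (cmod (f s))\<^sup>2" for x s :: real
  have b: "integrable lborel (b x)" "integral\<^sup>L lborel (b x) = 1 / (2 * r) + nsq f" for x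
    using exp_tail_integral[OF r0, of x] f2 unfolding b_def nsq_def by auto
  have wb: "norm (w x s) \<le> b x s" for x s
  proof -
    have y: "y * z \<le> y\<^sup>2 + z\<^sup>2" for y z :: real
      using zero_le_power2[of "y - z"] zero_le_power2[of "y + z"] unfolding power2_diff power2_sum by linarith
    have "exp (r * (x - s)) * cmod (f s) \<le> exp (2 * r * (x - s)) + (cmod (f s))\<^sup>2"
      using y[of "exp (r * (x - s))" "cmod (f s)"] by (simp add: power2_eq_square mult.assoc flip: exp_add)
    thus ?thesis by (auto simp: w_def b_def indicator_def norm_mult norm_exp_eq_Re r_def)
  qed
  have iw: "integrable lborel (w x)" for x
    by (rule Bochner_Integration.integrable_bound[OF b(1)[of x]]) (auto intro!: AE_I2 order_trans[OF wb])
  define u where "u x = - (LINT s|lborel. w x s)" for x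
  have ub: "cmod (u x) \<le> 1 / (2 * r) + nsq f" for x
  proof -
    have "cmod (u x) \<le> (LINT s|lborel. norm (w x s))" unfolding u_def by simp
    also have "\<dots> \<le> integral\<^sup>L lborel (b x)"
      using iw b wb by (intro integral_mono) auto
    finally show ?thesis by (simp add: b)
  qed
  \<comment> \<open>Without the factor exp (\<nu> x) there remains a tail integral, whose derivative
    comes from additivity of the integral; the product rule then yields the equation for
    \<open>u\<close>.\<close>
  define J where "J x = - (LINT s:{x..}|lborel. exp (- \<nu> * of_real s) * f s)" for x :: real
  have e: "w x s = exp (\<nu> * of_real x) * (indicator {x..} s *\<^sub>R (exp (- \<nu> * of_real s) * f s))" for x s
    by (simp add: w_def exp_diff exp_minus field_simps)
  have iJ: "set_integrable lborel {x..} (\<lambda>s. exp (- \<nu> * of_real s) * f s)" for x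
  proof -
    have "integrable lborel (\<lambda>s. exp (- \<nu> * of_real x) * w x s)" using iw by simp
    moreover have "(\<lambda>s. exp (- \<nu> * of_real x) * w x s) = (\<lambda>s. indicator {x..} s *\<^sub>R (exp (- \<nu> * of_real s) * f s))"
      unfolding e by (simp add: mult.assoc[symmetric] flip: exp_add)
    ultimately show ?thesis by (simp add: set_integrable_def)
  qed
  have uJ: "u x = exp (\<nu> * of_real x) * J x" for x
    by (simp only: u_def J_def e set_lebesgue_integral_def integral_mult_right_zero mult_minus_right)
  have acJ: "ac_deriv J (\<lambda>s. exp (- \<nu> * of_real s) * f s)"
    unfolding ac_deriv_def
  proof (intro allI impI conjI)
    fix a b :: real assume ab: "a \<le> b"
    show i: "set_integrable lborel {a..b} (\<lambda>s. exp (- \<nu> * of_real s) * f s)"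
      by (rule set_integrable_subset[OF iJ[of a]]) auto
    have "{a..} = {a..b} \<union> {b..}" using ab by auto
    moreover have "(LINT s:{a..b} \<union> {b..}|lborel. exp (- \<nu> * of_real s) * f s) =
      (LINT s:{a..b}|lborel. exp (- \<nu> * of_real s) * f s) + (LINT s:{b..}|lborel. exp (- \<nu> * of_real s) * f s)"
    proof (rule set_integral_Un_AE[OF _ _ _ i iJ])
      show "AE x in lborel. \<not> (x \<in> {a..b} \<and> x \<in> {b..})"
        using AE_lborel_singleton[of b] by eventually_elim auto
    qed auto
    ultimately show "(LINT x:{a..b}|lborel. exp (- \<nu> * of_real x) * f x) = J b - J a"
      by (simp add: J_def)
  qed
  have "ac_deriv (\<lambda>x. exp (\<nu> * of_real x)) (\<lambda>x. \<nu> * exp (\<nu> * of_real x))"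
  proof (rule ac_deriv_C1)
    show "((\<lambda>x. exp (\<nu> * complex_of_real x)) has_vector_derivative \<nu> * exp (\<nu> * complex_of_real x)) (at x)" for x
      by (rule has_vector_derivative_real_field) (auto intro!: derivative_eq_intros)
  qed (intro continuous_intros)
  from ac_deriv_mult[OF this acJ] have "ac_deriv u (\<lambda>x. \<nu> * u x + f x)"
    unfolding uJ by (rule back_subst[where P="ac_deriv _"]) (auto simp: exp_minus field_simps)
  note ac = this
  have cu: "continuous_on UNIV u" by (rule ac_deriv_continuous[OF ac])
  hence [measurable]: "u \<in> borel_measurable borel" by (rule borel_measurable_continuous_onI)
  \<comment> \<open>Boundedness of \<open>u\<close> is enough to control the boundary terms of the
    local energy bound uniformly in n.\<close>
  define K where "K = (1 / (2 * r) + nsq f)\<^sup>2"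
  have uK: "(cmod (u x))\<^sup>2 \<le> K" for x
    unfolding K_def by (intro power_mono ub) auto
  have "integrable lborel (\<lambda>x. (cmod (u x))\<^sup>2)"
  proof (rule integrable_of_bounded_truncations(1))
    show "set_integrable lborel {-real n..real n} (\<lambda>x. (cmod (u x))\<^sup>2)" for n
      by (intro borel_integrable_atLeastAtMost' continuous_intros continuous_on_subset[OF cu]) auto
    show "(LINT x:{-real n..real n}|lborel. (cmod (u x))\<^sup>2) \<le> (2 * K + nsq f / r) / r" for n
    proof -
      have "r * (LINT x:{-real n..real n}|lborel. (cmod (u x))\<^sup>2) \<le> 2 * K + nsq f / r"
        using first_order_local_bound[OF ac f _ r0, of "-real n" "real n"] uK[of "real n"] uK[of "-real n"] r0
        by (simp add: r_def)
      thus ?thesis using r0 by (simp add: pos_le_divide_eq mult.commute)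
    qed
  qed auto
  hence "sL2 u" by (simp add: sL2_def)
  thus ?thesis using ac f by (auto simp: sH1_def intro!: exI[of _ u] sL2_add sL2_cmult)
qed

lemma sL2_reflect: "sL2 f \<Longrightarrow> sL2 (\<lambda>x. f (- x))"
  using lborel_integrable_real_affine[of "\<lambda>x. (cmod (f x))\<^sup>2" "-1" 0] by (auto simp: sL2_def)

text \<open>For Re \<nu> < 0 the reflection x -> -x leads to an equation with positive real part,
  which amounts to integrating from minus infinity.\<close>

lemma first_order_solvable:
  assumes f: "sL2 f" and r: "Re \<nu> \<noteq> 0"
  shows "\<exists>u. sH1 u (\<lambda>x. \<nu> * u x + f x)"
proof (cases "Re \<nu> > 0")
  case True
  thus ?thesis using first_order_solvable_pos f by blast
next
  case False
  hence "Re (- \<nu>) > 0" using r by simp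
  then obtain v where v: "sH1 v (\<lambda>x. - \<nu> * v x + - f (- x))"
    using first_order_solvable_pos[of "\<lambda>x. - f (- x)" "- \<nu>"] sL2_reflect[OF f] sL2_cmult[of "\<lambda>x. f (-x)" "-1"] by auto
  have "sH1 (\<lambda>x. v (- x)) (\<lambda>x. \<nu> * v (- x) + f x)"
    unfolding sH1_iff_has_integral
  proof (intro conjI allI impI)
    show s: "sL2 (\<lambda>x. v (- x))" using v by (intro sL2_reflect) (simp add: sH1_def)
    show "sL2 (\<lambda>x. \<nu> * v (- x) + f x)" by (intro sL2_add sL2_cmult s f)
    fix a b :: real assume "a \<le> b"
    hence "((\<lambda>x. - \<nu> * v x + - f (- x)) has_integral v (- a) - v (- b)) {- b..- a}"
      using v by (auto simp: sH1_iff_has_integral)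
    hence "((\<lambda>x. - \<nu> * v (- x) + - f x) has_integral v (- a) - v (- b)) {a..b}"
      using has_integral_reflect_real[where f="\<lambda>x. - \<nu> * v (- x) + - f x" and a=a and b=b] by simp
    from has_integral_neg[OF this] show "((\<lambda>x. \<nu> * v (- x) + f x) has_integral v (- b) - v (- a)) {a..b}"
      by (simp add: add.commute)
  qed
  thus ?thesis by blast
qed

section \<open>Scalar equations of order four and second-order systems\<close>

text \<open>Four applications of the fundamental theorem of algebra. The factorization is stated
  through the coefficients because it will be used for differential operators; the missing cubic
  term is the vanishing sum of the roots.\<close>

lemma monic_quartic_vieta:
  fixes c2 c1 c0 :: complex
  shows "\<exists>n1 n2 n3 n4. n1 + n2 + n3 + n4 = 0 \<and> c2 = n1*n2 + n1*n3 + n1*n4 + n2*n3 + n2*n4 + n3*n4 \<and>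
     c1 = - (n1*n2*n3 + n1*n2*n4 + n1*n3*n4 + n2*n3*n4) \<and> c0 = n1*n2*n3*n4"
proof -
  have q: "\<exists>n. p = [:- n, 1:] * (p div [:- n, 1:]) \<and> degree p = Suc (degree (p div [:- n, 1:])) \<and> lead_coeff (p div [:-n,1:]) = 1"
    if p: "degree p > 0" "lead_coeff p = 1" for p :: "complex poly"
  proof -
    obtain n where "poly p n = 0"
      using fundamental_theorem_of_algebra[of p] p constant_degree by (metis less_not_refl)
    hence e: "p = [:- n, 1:] * (p div [:- n, 1:])" by (metis dvd_mult_div_cancel poly_eq_0_iff_dvd)
    have nz: "p div [:- n, 1:] \<noteq> 0" using e p by (metis degree_0 less_not_refl mult_zero_right)
    have "degree p = degree [:- n, 1:] + degree (p div [:- n, 1:])"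
      using nz by (subst e, subst degree_mult_eq) auto
    moreover have "lead_coeff p = lead_coeff [:- n, 1:] * lead_coeff (p div [:- n, 1:])"
      by (metis e lead_coeff_mult)
    ultimately show ?thesis using e p by auto
  qed
  define p where "p = [:c0, c1, c2, 0, 1:]"
  have p: "degree p = 4" "lead_coeff p = 1" by (auto simp: p_def)
  obtain n1 p1 where 1: "p = [:- n1, 1:] * p1" "degree p1 = 3" "lead_coeff p1 = 1" using q[of p] p by auto
  obtain n2 p2 where 2: "p1 = [:- n2, 1:] * p2" "degree p2 = 2" "lead_coeff p2 = 1" using q[of p1] 1 by auto
  obtain n3 p3 where 3: "p2 = [:- n3, 1:] * p3" "degree p3 = 1" "lead_coeff p3 = 1" using q[of p2] 2 by auto
  obtain n4 p4 where 4: "p3 = [:- n4, 1:] * p4" "degree p4 = 0" "lead_coeff p4 = 1" using q[of p3] 3 by auto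
  have "p4 = 1" using 4(2,3) by (auto elim!: degree_eq_zeroE)
  hence "p = [:- n1, 1:] * ([:- n2, 1:] * ([:- n3, 1:] * [:- n4, 1:]))" using 1 2 3 4 by simp
  hence e: "[:c0, c1, c2, 0, 1:] = [:- n1, 1:] * ([:- n2, 1:] * ([:- n3, 1:] * [:- n4, 1:]))" by (simp only: p_def)
  have "n4 = - n1 - n2 - n3" using e by (simp add: algebra_simps)
  hence "n1 + n2 + n3 + n4 = 0" by simp
  moreover have "c2 = n1*n2 + n1*n3 + n1*n4 + n2*n3 + n2*n4 + n3*n4"
    "c1 = - (n1*n2*n3 + n1*n2*n4 + n1*n3*n4 + n2*n3*n4)" "c0 = n1*n2*n3*n4"
    using e by (simp_all add: algebra_simps)
  ultimately show ?thesis by blast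
qed

lemma nsq_comb:
  assumes "sL2 f" "sL2 g" "nsq f \<le> A * N" "nsq g \<le> B * N"
  shows "nsq (\<lambda>x. c * f x + d * g x) \<le> (2 * (cmod c)\<^sup>2 * A + 2 * (cmod d)\<^sup>2 * B) * N"
proof -
  have "nsq (\<lambda>x. c * f x + d * g x) \<le> 2 * ((cmod c)\<^sup>2 * nsq f) + 2 * ((cmod d)\<^sup>2 * nsq g)"
    using sL2_add(2)[OF sL2_cmult[OF assms(1)] sL2_cmult[OF assms(2)], of c d] by (simp add: nsq_cmult)
  also have "\<dots> \<le> 2 * ((cmod c)\<^sup>2 * (A * N)) + 2 * ((cmod d)\<^sup>2 * (B * N))"
    by (intro add_mono mult_left_mono assms) auto
  finally show ?thesis by (simp add: algebra_simps)
qed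

text \<open>A constant-coefficient operator of order four without purely imaginary characteristic roots
  is inverted one linear factor at a time.\<close>

lemma fourth_order_invertible:
  fixes c2 c1 c0 :: complex
  assumes nz: "\<And>k::real. (\<i>*k)^4 + c2 * (\<i>*k)\<^sup>2 + c1 * (\<i>*k) + c0 \<noteq> 0"
  shows "\<exists>K. (\<forall>F. sL2 F \<longrightarrow> (\<exists>W0 W1 W2 W3 W4. sH1 W0 W1 \<and> sH1 W1 W2 \<and> sH1 W2 W3 \<and> sH1 W3 W4 \<and>
             (\<forall>x. W4 x + c2 * W2 x + c1 * W1 x + c0 * W0 x = F x))) \<and>
           (\<forall>F W0 W1 W2 W3 W4. sH1 W0 W1 \<and> sH1 W1 W2 \<and> sH1 W2 W3 \<and> sH1 W3 W4 \<and>
             (\<forall>x. W4 x + c2 * W2 x + c1 * W1 x + c0 * W0 x = F x) \<longrightarrow>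
             nsq W0 \<le> K * nsq F \<and> nsq W1 \<le> K * nsq F \<and> nsq W2 \<le> K * nsq F)"
proof -
  obtain n1 n2 n3 n4 where v: "n1 + n2 + n3 + n4 = 0" "c2 = n1*n2 + n1*n3 + n1*n4 + n2*n3 + n2*n4 + n3*n4"
     "c1 = - (n1*n2*n3 + n1*n2*n4 + n1*n3*n4 + n2*n3*n4)" "c0 = n1*n2*n3*n4"
    using monic_quartic_vieta[of c2 c1 c0] by blast
  have n4: "n4 = - (n1 + n2 + n3)" using v(1) by (metis add.commute add_eq_0_iff)
  have fac: "\<nu>^4 + c2 * \<nu>\<^sup>2 + c1 * \<nu> + c0 = (\<nu> - n1) * (\<nu> - n2) * (\<nu> - n3) * (\<nu> - n4)" for \<nu>
  proof -
    have "(\<nu> - n1) * (\<nu> - n2) * (\<nu> - n3) * (\<nu> - n4) = \<nu>^4 - (n1 + n2 + n3 + n4) * \<nu>^3 + c2 * \<nu>\<^sup>2 + c1 * \<nu> + c0"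
      unfolding v(2-4) by (simp add: algebra_simps power4_eq_xxxx power3_eq_cube power2_eq_square)
    thus ?thesis using v(1) by simp
  qed
  \<comment> \<open>A root with vanishing real part has the form \<open>\<i> * Im n\<close>, where
    the symbol is assumed not to vanish.\<close>
  have re: "Re n1 \<noteq> 0" "Re n2 \<noteq> 0" "Re n3 \<noteq> 0" "Re n4 \<noteq> 0"
  proof -
    have "Re n \<noteq> 0" if "n \<in> {n1, n2, n3, n4}" for n
    proof
      assume "Re n = 0"
      hence "n = \<i> * Im n" by (simp add: complex_eq_iff)
      thus False using nz[of "Im n"] fac[of n] that by auto
    qed
    thus "Re n1 \<noteq> 0" "Re n2 \<noteq> 0" "Re n3 \<noteq> 0" "Re n4 \<noteq> 0" by auto
  qed
  have ex: "\<exists>W0 W1 W2 W3 W4. sH1 W0 W1 \<and> sH1 W1 W2 \<and> sH1 W2 W3 \<and> sH1 W3 W4 \<and>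
             (\<forall>x. W4 x + c2 * W2 x + c1 * W1 x + c0 * W0 x = F x)" if F: "sL2 F" for F
  proof -
    \<comment> \<open>The cascade (D - n1) u1 = F, (D - n2) u2 = u1, (D - n3) u3 = u2, (D - n4) w =
      u3. Differentiating these equations expresses the derivatives of \<open>w\<close> up to the
      fourth through u1, u2, u3, w and F, so no regularity argument is needed.\<close>
    obtain u1 where u1: "sH1 u1 (\<lambda>x. n1 * u1 x + F x)" using first_order_solvable[OF F re(1)] by blast
    obtain u2 where u2: "sH1 u2 (\<lambda>x. n2 * u2 x + u1 x)" using first_order_solvable[OF _ re(2)] u1 by (auto simp: sH1_def)
    obtain u3 where u3: "sH1 u3 (\<lambda>x. n3 * u3 x + u2 x)" using first_order_solvable[OF _ re(3)] u2 by (auto simp: sH1_def)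
    obtain w where w: "sH1 w (\<lambda>x. n4 * w x + u3 x)" using first_order_solvable[OF _ re(4)] u3 by (auto simp: sH1_def)
    define W1 where "W1 x = n4 * w x + u3 x" for x
    define d1u3 where "d1u3 x = n3 * u3 x + u2 x" for x
    define d1u2 where "d1u2 x = n2 * u2 x + u1 x" for x
    define d1u1 where "d1u1 x = n1 * u1 x + F x" for x
    define W2 where "W2 x = n4 * W1 x + d1u3 x" for x
    define d2u3 where "d2u3 x = n3 * d1u3 x + d1u2 x" for x
    define d2u2 where "d2u2 x = n2 * d1u2 x + d1u1 x" for x
    define W3 where "W3 x = n4 * W2 x + d2u3 x" for x
    define d3u3 where "d3u3 x = n3 * d2u3 x + d2u2 x" for x
    define W4 where "W4 x = n4 * W3 x + d3u3 x" for x
    have 1: "sH1 u1 d1u1" "sH1 u2 d1u2" "sH1 u3 d1u3" "sH1 w W1"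
      using u1 u2 u3 w unfolding d1u1_def d1u2_def d1u3_def W1_def .
    have 21: "sH1 d1u2 d2u2"
      using sH1_add[OF sH1_cmult[OF 1(2), of n2] 1(1)] unfolding d1u2_def d2u2_def .
    have 22: "sH1 d1u3 d2u3"
      using sH1_add[OF sH1_cmult[OF 1(3), of n3] 1(2)] unfolding d1u3_def d2u3_def .
    have 23: "sH1 W1 W2"
      using sH1_add[OF sH1_cmult[OF 1(4), of n4] 1(3)] unfolding W1_def W2_def .
    have 31: "sH1 d2u3 d3u3"
      using sH1_add[OF sH1_cmult[OF 22, of n3] 21] unfolding d2u3_def d3u3_def .
    have 32: "sH1 W2 W3"
      using sH1_add[OF sH1_cmult[OF 23, of n4] 22] unfolding W2_def W3_def .
    have 4: "sH1 W3 W4"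
      using sH1_add[OF sH1_cmult[OF 32, of n4] 31] unfolding W3_def W4_def .
    have "W4 x + c2 * W2 x + c1 * W1 x + c0 * w x = F x" for x
      unfolding v(2-4) W4_def d3u3_def W3_def d2u2_def d2u3_def W2_def d1u1_def d1u2_def d1u3_def W1_def n4
      by (simp add: algebra_simps)
    thus ?thesis using 1(4) 23 32 4 by blast
  qed
  define K1 where "K1 = 1 / (Re n1)\<^sup>2"
  define K2 where "K2 = K1 / (Re n2)\<^sup>2"
  define K3 where "K3 = K2 / (Re n3)\<^sup>2"
  define K4 where "K4 = K3 / (Re n4)\<^sup>2"
  \<comment> \<open>\<open>L1\<close> belongs to \<open>W1 = n4 * W0 + u3\<close>, \<open>M\<close>
    to the derivative of u3, and \<open>L2\<close> to \<open>W2\<close>; each is built from the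
    bounds of two summands.\<close>
  define L1 where "L1 = 2 * (cmod n4)\<^sup>2 * K4 + 2 * (cmod 1)\<^sup>2 * K3"
  define M where "M = 2 * (cmod n3)\<^sup>2 * K3 + 2 * (cmod 1)\<^sup>2 * K2"
  define L2 where "L2 = 2 * (cmod n4)\<^sup>2 * L1 + 2 * (cmod 1)\<^sup>2 * M"
  define K where "K = \<bar>K4\<bar> + \<bar>L1\<bar> + \<bar>L2\<bar>"
  have est: "nsq W0 \<le> K * nsq F \<and> nsq W1 \<le> K * nsq F \<and> nsq W2 \<le> K * nsq F"
    if c: "sH1 W0 W1" "sH1 W1 W2" "sH1 W2 W3" "sH1 W3 W4" "\<And>x. W4 x + c2 * W2 x + c1 * W1 x + c0 * W0 x = F x"
    for F W0 W1 W2 W3 W4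
  proof -
    \<comment> \<open>The cascade read backwards: applying the factors one by one to
      \<open>W0\<close> gives u3, u2, u1 and finally F, and the first-order estimate returns from F
      to \<open>W0\<close>.\<close>
    define u3 where "u3 x = W1 x - n4 * W0 x" for x
    define d1u3 where "d1u3 x = W2 x - n4 * W1 x" for x
    define d2u3 where "d2u3 x = W3 x - n4 * W2 x" for x
    define d3u3 where "d3u3 x = W4 x - n4 * W3 x" for x
    define u2 where "u2 x = d1u3 x - n3 * u3 x" for x
    define d1u2 where "d1u2 x = d2u3 x - n3 * d1u3 x" for x
    define d2u2 where "d2u2 x = d3u3 x - n3 * d2u3 x" for x
    define u1 where "u1 x = d1u2 x - n2 * u2 x" for x
    define d1u1 where "d1u1 x = d2u2 x - n2 * d1u2 x" for x
    have 3: "sH1 u3 d1u3" "sH1 d1u3 d2u3" "sH1 d2u3 d3u3"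
      unfolding u3_def d1u3_def d2u3_def d3u3_def by (intro sH1_diff sH1_cmult c)+
    have 2: "sH1 u2 d1u2" "sH1 d1u2 d2u2"
      unfolding u2_def d1u2_def d2u2_def by (intro sH1_diff sH1_cmult 3)+
    have 1: "sH1 u1 d1u1"
      unfolding u1_def d1u1_def by (intro sH1_diff sH1_cmult 2)
    have "d1u1 x - n1 * u1 x = F x" for x
      unfolding c(5)[symmetric] v(2-4) u1_def d1u1_def u2_def d1u2_def d2u2_def u3_def d1u3_def d2u3_def d3u3_def n4
      by (simp add: algebra_simps)
    hence b1: "nsq u1 \<le> K1 * nsq F"
      using first_order_estimate[OF 1 re(1)] by (simp add: K1_def)
    have eq: "(\<lambda>x. d1u2 x - n2 * u2 x) = u1" "(\<lambda>x. d1u3 x - n3 * u3 x) = u2" "(\<lambda>x. W1 x - n4 * W0 x) = u3"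
      by (simp_all add: fun_eq_iff u1_def u2_def u3_def)
    have div: "N / y\<^sup>2 \<le> k / y\<^sup>2 * nsq F" if "N \<le> k * nsq F" for N k and y :: real
      using divide_right_mono[OF that, of "y\<^sup>2"] by simp
    have b2: "nsq u2 \<le> K2 * nsq F"
      using first_order_estimate[OF 2(1) re(2)] div[OF b1, of "Re n2"] unfolding eq K2_def by linarith
    have b3: "nsq u3 \<le> K3 * nsq F"
      using first_order_estimate[OF 3(1) re(3)] div[OF b2, of "Re n3"] unfolding eq K3_def by linarith
    have b4: "nsq W0 \<le> K4 * nsq F"
      using first_order_estimate[OF c(1) re(4)] div[OF b3, of "Re n4"] unfolding eq K4_def by linarith
    have s: "sL2 u1" "sL2 u2" "sL2 u3" "sL2 W0" "sL2 W1" "sL2 d1u3" using 1 2 3 c by (auto simp: sH1_def)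
    have "nsq (\<lambda>x. n4 * W0 x + 1 * u3 x) \<le> L1 * nsq F"
      unfolding L1_def by (rule nsq_comb[OF s(4,3) b4 b3])
    hence b5: "nsq W1 \<le> L1 * nsq F" by (simp add: u3_def)
    have "nsq (\<lambda>x. n3 * u3 x + 1 * u2 x) \<le> M * nsq F"
      unfolding M_def by (rule nsq_comb[OF s(3,2) b3 b2])
    hence b6: "nsq d1u3 \<le> M * nsq F" by (simp add: u2_def)
    have "nsq (\<lambda>x. n4 * W1 x + 1 * d1u3 x) \<le> L2 * nsq F"
      unfolding L2_def by (rule nsq_comb[OF s(5,6) b5 b6])
    hence b7: "nsq W2 \<le> L2 * nsq F" by (simp add: d1u3_def)
    have "k * nsq F \<le> K * nsq F" if "k \<in> {K4, L1, L2}" for k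
      using that by (intro mult_right_mono nsq_nonneg) (auto simp: K_def)
    thus ?thesis using b4 b5 b7 by (blast intro: order_trans)
  qed
  show ?thesis using ex est by blast
qed

text \<open>The system with symbol \<open>M(D)\<close> is solved by the adjugate of \<open>M(D)\<close> applied to solutions of
  the scalar equation \<open>det M(D) w = F\<close>.\<close>

lemma second_order_system_invertible:
  fixes S \<kappa> \<alpha> :: real and z :: complex
  assumes a: "\<alpha> > 0" and S: "S \<ge> \<kappa>\<^sup>2" and z: "Re z > 0"
  shows "\<exists>K. (\<forall>F G. sL2 F \<and> sL2 G \<longrightarrow> (\<exists>a a' a'' b b' b''. sH1 a a' \<and> sH1 a' a'' \<and> sH1 b b' \<and> sH1 b' b'' \<and>
            (\<forall>x. a'' x - complex_of_real \<kappa> * b' x - (S + \<alpha> * z) * a x + z * b x = F x) \<and>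
            (\<forall>x. b'' x + complex_of_real \<kappa> * a' x - z * a x - \<alpha> * z * b x = G x))) \<and>
        (\<forall>F G a a' a'' b b' b''. sL2 F \<and> sL2 G \<and> sH1 a a' \<and> sH1 a' a'' \<and> sH1 b b' \<and> sH1 b' b'' \<and>
            (AE x in lborel. a'' x - complex_of_real \<kappa> * b' x - (S + \<alpha> * z) * a x + z * b x = F x) \<and>
            (AE x in lborel. b'' x + complex_of_real \<kappa> * a' x - z * a x - \<alpha> * z * b x = G x) \<longrightarrow>
             nsq a + nsq b \<le> K * (nsq F + nsq G))"
proof -
  \<comment> \<open>These are the coefficients of the determinant of the symbol, (D^2 - S - \<alpha>
    z) (D^2 - \<alpha> z) + (\<kappa> D - z)^2.\<close>
  define c2 where "c2 = \<kappa>\<^sup>2 - S - 2 * \<alpha> * z"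
  define c1 where "c1 = - 2 * \<kappa> * z"
  define c0 where "c0 = (S + \<alpha> * z) * (\<alpha> * z) + z\<^sup>2"
  note c_defs = c2_def c1_def c0_def
  have "(\<i>*k)^4 + c2 * (\<i>*k)\<^sup>2 + c1 * (\<i>*k) + c0 \<noteq> 0" for k :: real
  proof
    assume 0: "(\<i>*k)^4 + c2 * (\<i>*k)\<^sup>2 + c1 * (\<i>*k) + c0 = 0"
    define d where "d = k\<^sup>2 * (k\<^sup>2 + S - \<kappa>\<^sup>2)"
    define \<tau> where "\<tau> = \<alpha> * (2 * k\<^sup>2 + S)"
    define \<sigma> where "\<sigma> = 2 * \<kappa> * k"
    have "S \<ge> 0" using S order_trans[OF zero_le_power2] by blast
    hence d: "d \<ge> 0" and \<tau>: "\<tau> \<ge> 0"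
      using S a by (auto simp: d_def \<tau>_def intro!: mult_nonneg_nonneg add_nonneg_nonneg simp flip: add_diff_eq)
    \<comment> \<open>As a quadratic in \<open>z\<close> this is the dispersion relation.
      Multiplication by \<open>cnj z\<close> makes the contribution of \<sigma> imaginary; the real
      part consists of nonnegative terms, the first of them positive.\<close>
    have "(1 + \<alpha>\<^sup>2) * z\<^sup>2 + (\<tau> - \<i> * \<sigma>) * z + d = 0"
      using 0 unfolding c_defs d_def \<tau>_def \<sigma>_def
      by (simp add: power2_eq_square power4_eq_xxxx algebra_simps)
    hence "Re (((1 + \<alpha>\<^sup>2) * z\<^sup>2 + (\<tau> - \<i> * \<sigma>) * z + d) * cnj z) = 0" by simp
    hence "(1 + \<alpha>\<^sup>2) * (cmod z)\<^sup>2 * Re z + \<tau> * (cmod z)\<^sup>2 + d * Re z = 0"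
      unfolding cmod_power2 by (simp add: power2_eq_square algebra_simps)
    moreover have "(1 + \<alpha>\<^sup>2) * (cmod z)\<^sup>2 * Re z > 0"
      using z by (intro mult_pos_pos) (auto simp: add_pos_nonneg)
    moreover have "\<tau> * (cmod z)\<^sup>2 \<ge> 0" "d * Re z \<ge> 0" using d \<tau> z by auto
    ultimately show False by linarith
  qed
  from fourth_order_invertible[OF this] obtain K where
    ex: "\<And>F. sL2 F \<Longrightarrow> (\<exists>W0 W1 W2 W3 W4. sH1 W0 W1 \<and> sH1 W1 W2 \<and> sH1 W2 W3 \<and> sH1 W3 W4 \<and>
             (\<forall>x. W4 x + c2 * W2 x + c1 * W1 x + c0 * W0 x = F x))" and
    est: "\<And>F W0 W1 W2 W3 W4. sH1 W0 W1 \<Longrightarrow> sH1 W1 W2 \<Longrightarrow> sH1 W2 W3 \<Longrightarrow> sH1 W3 W4 \<Longrightarrow>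
             (\<And>x. W4 x + c2 * W2 x + c1 * W1 x + c0 * W0 x = F x) \<Longrightarrow>
             nsq W0 \<le> K * nsq F \<and> nsq W1 \<le> K * nsq F \<and> nsq W2 \<le> K * nsq F"
    by blast
  define A where "A = 2 * (cmod 1)\<^sup>2 * K + 2 * (cmod (- (\<alpha> * z)))\<^sup>2 * K"
  define A' where "A' = 2 * (cmod (complex_of_real \<kappa>))\<^sup>2 * K + 2 * (cmod (- z))\<^sup>2 * K"
  define B where "B = 2 * (cmod z)\<^sup>2 * K + 2 * (cmod (- complex_of_real \<kappa>))\<^sup>2 * K"
  define B' where "B' = 2 * (cmod 1)\<^sup>2 * K + 2 * (cmod (- (S + \<alpha> * z)))\<^sup>2 * K"
  define Q where "Q = 2 * \<bar>A\<bar> + 2 * \<bar>A'\<bar> + 2 * \<bar>B\<bar> + 2 * \<bar>B'\<bar>"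
  have sol: "\<exists>a a' a'' b b' b''. sH1 a a' \<and> sH1 a' a'' \<and> sH1 b b' \<and> sH1 b' b'' \<and>
            (\<forall>x. a'' x - complex_of_real \<kappa> * b' x - (S + \<alpha> * z) * a x + z * b x = F x) \<and>
            (\<forall>x. b'' x + complex_of_real \<kappa> * a' x - z * a x - \<alpha> * z * b x = G x) \<and> nsq a + nsq b \<le> Q * (nsq F + nsq G)"
    if F: "sL2 F" and G: "sL2 G" for F G
  proof -
    obtain V0 V1 V2 V3 V4 where V: "sH1 V0 V1" "sH1 V1 V2" "sH1 V2 V3" "sH1 V3 V4"
      "\<And>x. V4 x + c2 * V2 x + c1 * V1 x + c0 * V0 x = F x" using ex[OF F] by blast
    obtain U0 U1 U2 U3 U4 where U: "sH1 U0 U1" "sH1 U1 U2" "sH1 U2 U3" "sH1 U3 U4"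
      "\<And>x. U4 x + c2 * U2 x + c1 * U1 x + c0 * U0 x = G x" using ex[OF G] by blast
    note eV = est[OF V] and eU = est[OF U]
    \<comment> \<open>The rows of the adjugate: \<open>a\<close> is (D^2 - \<alpha> z) V + (\<kappa>
      D - z) U and \<open>b\<close> is (z - \<kappa> D) V + (D^2 - S - \<alpha> z) U, where the
      scalar operator maps V to \<open>F\<close> and U to \<open>G\<close>.\<close>
    define a where "a x = (1 * V2 x + - (\<alpha> * z) * V0 x) + (complex_of_real \<kappa> * U1 x + - z * U0 x)" for x
    define a' where "a' x = (1 * V3 x + - (\<alpha> * z) * V1 x) + (complex_of_real \<kappa> * U2 x + - z * U1 x)" for x
    define a'' where "a'' x = (1 * V4 x + - (\<alpha> * z) * V2 x) + (complex_of_real \<kappa> * U3 x + - z * U2 x)" for x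
    define b where "b x = (z * V0 x + - complex_of_real \<kappa> * V1 x) + (1 * U2 x + - (S + \<alpha> * z) * U0 x)" for x
    define b' where "b' x = (z * V1 x + - complex_of_real \<kappa> * V2 x) + (1 * U3 x + - (S + \<alpha> * z) * U1 x)" for x
    define b'' where "b'' x = (z * V2 x + - complex_of_real \<kappa> * V3 x) + (1 * U4 x + - (S + \<alpha> * z) * U2 x)" for x
    have h: "sH1 a a'" "sH1 a' a''" "sH1 b b'" "sH1 b' b''"
      unfolding a_def a'_def a''_def b_def b'_def b''_def
      by (intro sH1_add sH1_cmult V(1-4) U(1-4))+
    have e1: "a'' x - complex_of_real \<kappa> * b' x - (S + \<alpha> * z) * a x + z * b x = F x" for x
      unfolding a_def a''_def b_def b'_def V(5)[symmetric] c_defs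
      by (simp add: algebra_simps power2_eq_square)
    have e2: "b'' x + complex_of_real \<kappa> * a' x - z * a x - \<alpha> * z * b x = G x" for x
      unfolding a_def a'_def b_def b''_def U(5)[symmetric] c_defs
      by (simp add: algebra_simps power2_eq_square)
    have sV: "sL2 V0" "sL2 V1" "sL2 V2" "sL2 U0" "sL2 U1" "sL2 U2" using U V by (auto simp: sH1_def)
    have sc: "sL2 (\<lambda>x. 1 * V2 x + - (\<alpha> * z) * V0 x)" "sL2 (\<lambda>x. complex_of_real \<kappa> * U1 x + - z * U0 x)"
      "sL2 (\<lambda>x. z * V0 x + - complex_of_real \<kappa> * V1 x)" "sL2 (\<lambda>x. 1 * U2 x + - (S + \<alpha> * z) * U0 x)"
      by (intro sL2_add sL2_cmult sV)+
    have p: "nsq (\<lambda>x. 1 * V2 x + - (\<alpha> * z) * V0 x) \<le> A * nsq F" "nsq (\<lambda>x. complex_of_real \<kappa> * U1 x + - z * U0 x) \<le> A' * nsq G"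
      "nsq (\<lambda>x. z * V0 x + - complex_of_real \<kappa> * V1 x) \<le> B * nsq F" "nsq (\<lambda>x. 1 * U2 x + - (S + \<alpha> * z) * U0 x) \<le> B' * nsq G"
      unfolding A_def A'_def B_def B'_def
      using eV eU by (intro nsq_comb sV; simp)+
    have "nsq a \<le> 2 * (A * nsq F) + 2 * (A' * nsq G)"
      using sL2_add(2)[OF sc(1,2)] p(1,2) unfolding a_def by linarith
    moreover have "nsq b \<le> 2 * (B * nsq F) + 2 * (B' * nsq G)"
      using sL2_add(2)[OF sc(3,4)] p(3,4) unfolding b_def by linarith
    moreover have "2 * A + 2 * B \<le> Q" "2 * A' + 2 * B' \<le> Q" unfolding Q_def by linarith+
    hence "(2 * A + 2 * B) * nsq F \<le> Q * nsq F" "(2 * A' + 2 * B') * nsq G \<le> Q * nsq G"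
      by (auto intro!: mult_right_mono nsq_nonneg)
    ultimately have "nsq a + nsq b \<le> Q * (nsq F + nsq G)"
      by (simp add: algebra_simps)
    thus ?thesis using h e1 e2 by blast
  qed
  have hom: "nsq a \<le> 0 \<and> nsq b \<le> 0" if h: "sH1 a a'" "sH1 a' a''" "sH1 b b'" "sH1 b' b''"
    and e1: "AE x in lborel. a'' x - complex_of_real \<kappa> * b' x - (S + \<alpha> * z) * a x + z * b x = 0"
    and e2: "AE x in lborel. b'' x + complex_of_real \<kappa> * a' x - z * a x - \<alpha> * z * b x = 0" for a a' a'' b b' b''
  proof -
    \<comment> \<open>The equations hold only almost everywhere. Replacing a derivative on a null
      set does not change its integrals, so a'' and b'' may be replaced by the other terms of the
      equations, and regularity is gained from there.\<close>
    have spike: "sH1 u h" if u: "sH1 u g" and h: "sL2 h" and ae: "AE x in lborel. g x = h x" for u g h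
    proof -
      obtain N where N: "N \<in> null_sets lborel" "{x. g x \<noteq> h x} \<subseteq> N"
        using ae by (auto simp: eventually_ae_filter)
      have N2: "h x = g x" if "x \<notin> N" for x
        using N(2) that by (metis (mono_tags, lifting) mem_Collect_eq subsetD)
      have "negligible N" unfolding negligible_iff_null_sets by (rule null_sets_completionI[OF N(1)])
      hence "(h has_integral y) {p..q}" if "(g has_integral y) {p..q}" for p q y
        by (rule has_integral_spike[OF _ _ that]) (use N2 in auto)
      thus ?thesis
        using u h by (simp add: sH1_iff_has_integral)
    qed
    define A2 where "A2 x = complex_of_real \<kappa> * b' x + ((S + \<alpha> * z) * a x + - z * b x)" for x
    define B2 where "B2 x = - complex_of_real \<kappa> * a' x + (z * a x + \<alpha> * z * b x)" for x
    define A3 where "A3 x = complex_of_real \<kappa> * B2 x + ((S + \<alpha> * z) * a' x + - z * b' x)" for x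
    define B3 where "B3 x = - complex_of_real \<kappa> * A2 x + (z * a' x + \<alpha> * z * b' x)" for x
    define A4 where "A4 x = complex_of_real \<kappa> * B3 x + ((S + \<alpha> * z) * A2 x + - z * B2 x)" for x
    define B4 where "B4 x = - complex_of_real \<kappa> * A3 x + (z * A2 x + \<alpha> * z * B2 x)" for x
    have s: "sL2 a" "sL2 b" "sL2 a'" "sL2 b'" using h by (auto simp: sH1_def)
    have a2: "sH1 a' A2"
    proof (rule spike[OF h(2)])
      show "sL2 A2" unfolding A2_def by (intro sL2_add sL2_cmult s)
      show "AE x in lborel. a'' x = A2 x" using e1 by eventually_elim (unfold A2_def, algebra)
    qed
    have b2: "sH1 b' B2"
    proof (rule spike[OF h(4)])
      show "sL2 B2" unfolding B2_def by (intro sL2_add sL2_cmult s)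
      show "AE x in lborel. b'' x = B2 x" using e2 by eventually_elim (unfold B2_def, algebra)
    qed
    have 3: "sH1 A2 A3" "sH1 B2 B3"
      unfolding A2_def[abs_def] A3_def[abs_def] B2_def[abs_def] B3_def[abs_def]
      by (intro sH1_add sH1_cmult h a2[unfolded A2_def[abs_def]] b2[unfolded B2_def[abs_def]])+
    have 4: "sH1 A3 A4" "sH1 B3 B4"
      using sH1_add[OF sH1_cmult[OF 3(2), of "complex_of_real \<kappa>"] sH1_add[OF sH1_cmult[OF a2, of "S + \<alpha> * z"] sH1_cmult[OF b2, of "- z"]]]
        sH1_add[OF sH1_cmult[OF 3(1), of "- complex_of_real \<kappa>"] sH1_add[OF sH1_cmult[OF a2, of "z"] sH1_cmult[OF b2, of "\<alpha> * z"]]]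
      unfolding A3_def[abs_def] A4_def[abs_def] B3_def[abs_def] B4_def[abs_def] by this
    \<comment> \<open>Eliminating \<open>b\<close> leaves the scalar fourth-order equation for
      \<open>a\<close>; its a priori bound with right-hand side zero gives norm zero. The same holds
      for \<open>b\<close>.\<close>
    have "A4 x + c2 * A2 x + c1 * a' x + c0 * a x = 0" for x
      unfolding A4_def B3_def A2_def B2_def c_defs by (simp add: algebra_simps power2_eq_square)
    hence "nsq a \<le> K * nsq (\<lambda>x. 0)" using est[OF h(1) a2 3(1) 4(1)] by auto
    moreover have "B4 x + c2 * B2 x + c1 * b' x + c0 * b x = 0" for x
      unfolding B4_def A3_def A2_def B2_def c_defs by (simp add: algebra_simps power2_eq_square)
    hence "nsq b \<le> K * nsq (\<lambda>x. 0)" using est[OF h(3) b2 3(2) 4(2)] by auto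
    ultimately show ?thesis by (simp add: nsq_def)
  qed
  \<comment> \<open>Any solution differs from the constructed one by a homogeneous solution, which
    has norm zero; the factor 2 comes from the estimate of \<open>nsq\<close> for sums.\<close>
  have bd: "nsq a + nsq b \<le> (2 * Q) * (nsq F + nsq G)"
    if F: "sL2 F" "sL2 G" and h: "sH1 a a'" "sH1 a' a''" "sH1 b b'" "sH1 b' b''"
    and e1: "AE x in lborel. a'' x - complex_of_real \<kappa> * b' x - (S + \<alpha> * z) * a x + z * b x = F x"
    and e2: "AE x in lborel. b'' x + complex_of_real \<kappa> * a' x - z * a x - \<alpha> * z * b x = G x" for F G a a' a'' b b' b''
  proof -
    obtain p p' p'' q q' q'' where s: "sH1 p p'" "sH1 p' p''" "sH1 q q'" "sH1 q' q''"
      "\<And>x. p'' x - complex_of_real \<kappa> * q' x - (S + \<alpha> * z) * p x + z * q x = F x"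
      "\<And>x. q'' x + complex_of_real \<kappa> * p' x - z * p x - \<alpha> * z * q x = G x" "nsq p + nsq q \<le> Q * (nsq F + nsq G)"
      using sol[OF F] by blast
    have "nsq (\<lambda>x. a x - p x) \<le> 0 \<and> nsq (\<lambda>x. b x - q x) \<le> 0"
    proof (rule hom)
      show "sH1 (\<lambda>x. a x - p x) (\<lambda>x. a' x - p' x)" "sH1 (\<lambda>x. a' x - p' x) (\<lambda>x. a'' x - p'' x)"
       "sH1 (\<lambda>x. b x - q x) (\<lambda>x. b' x - q' x)" "sH1 (\<lambda>x. b' x - q' x) (\<lambda>x. b'' x - q'' x)"
        by (intro sH1_diff h s)+
      show "AE x in lborel. a'' x - p'' x - complex_of_real \<kappa> * (b' x - q' x) - (S + \<alpha> * z) * (a x - p x) + z * (b x - q x) = 0"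
        using e1 by eventually_elim (simp add: s(5)[symmetric] algebra_simps)
      show "AE x in lborel. b'' x - q'' x + complex_of_real \<kappa> * (a' x - p' x) - z * (a x - p x) - \<alpha> * z * (b x - q x) = 0"
        using e2 by eventually_elim (simp add: s(6)[symmetric] algebra_simps)
    qed
    moreover have "nsq a \<le> 2 * nsq (\<lambda>x. a x - p x) + 2 * nsq p" "nsq b \<le> 2 * nsq (\<lambda>x. b x - q x) + 2 * nsq q"
      using sL2_add(2)[of "\<lambda>x. a x - p x" p] sL2_add(2)[of "\<lambda>x. b x - q x" q] h s
      by (auto simp: sH1_def sL2_diff)
    ultimately show ?thesis using s(7) by (simp add: algebra_simps)
  qed
  have "\<forall>F G. sL2 F \<and> sL2 G \<longrightarrow> (\<exists>a a' a'' b b' b''. sH1 a a' \<and> sH1 a' a'' \<and> sH1 b b' \<and> sH1 b' b'' \<and>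
            (\<forall>x. a'' x - complex_of_real \<kappa> * b' x - (S + \<alpha> * z) * a x + z * b x = F x) \<and>
            (\<forall>x. b'' x + complex_of_real \<kappa> * a' x - z * a x - \<alpha> * z * b x = G x))"
  proof (intro allI impI)
    fix F G assume "sL2 F \<and> sL2 G"
    from sol[OF conjunct1[OF this] conjunct2[OF this]]
    show "\<exists>a a' a'' b b' b''. sH1 a a' \<and> sH1 a' a'' \<and> sH1 b b' \<and> sH1 b' b'' \<and>
            (\<forall>x. a'' x - complex_of_real \<kappa> * b' x - (S + \<alpha> * z) * a x + z * b x = F x) \<and>
            (\<forall>x. b'' x + complex_of_real \<kappa> * a' x - z * a x - \<alpha> * z * b x = G x)"
      by blast
  qed
  thus ?thesis using bd by (intro exI[of _ "2 * Q"] conjI allI impI) blast+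
qed

section \<open>The linearization in the moving frame\<close>

lemma vector3_axis: "(vector [a, b, c] :: real^3) = a *\<^sub>R axis 1 1 + b *\<^sub>R axis 2 1 + c *\<^sub>R axis 3 1"
  by (simp add: vec_eq_iff forall_3 axis_def)

lemma vector3_eqI: "a $ 1 = b $ 1 \<Longrightarrow> a $ 2 = b $ 2 \<Longrightarrow> a $ 3 = b $ 3 \<Longrightarrow> a = (b :: 'a^3)"
  by (simp add: vec_eq_iff forall_3)

lemma has_vector_derivative_vector3:
  assumes "(f has_real_derivative f') (at x)" "(g has_real_derivative g') (at x)" "(h has_real_derivative h') (at x)"
  shows "((\<lambda>x. vector [f x, g x, h x] :: real^3) has_vector_derivative vector [f', g', h']) (at x)"
  unfolding vector3_axis
  using assms unfolding has_real_derivative_iff_has_vector_derivative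
  by (auto intro!: derivative_eq_intros simp: algebra_simps has_real_derivative_iff_has_vector_derivative)

lemma cross3_vector:
  "cross3 (vector [a, b, c]) (vector [d, e, f]) = vector [b * f - c * e, c * d - a * f, a * e - b * d]"
  by (simp add: cross3_def)

lemma inner_vector3: "(u :: real^3) \<bullet> v = u $ 1 * v $ 1 + u $ 2 * v $ 2 + u $ 3 * v $ 3"
  by (simp add: inner_vec_def sum_3)

text \<open>\<open>fr_th\<close> and \<open>fr_ph\<close> are the unit tangent vectors in the
  directions of \<theta> and \<phi>, orthonormal together with \<open>sph\<close>. The horizontal
  vector \<open>fr_rho\<close> lies in the plane of \<open>sph\<close> and \<open>fr_th\<close>; it
  appears because the \<phi>-derivative of \<open>fr_ph\<close> is its negative.\<close>

definition fr_th :: "real \<Rightarrow> real \<Rightarrow> real^3" where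
  "fr_th \<phi> \<theta> = vector [cos \<phi> * cos \<theta>, sin \<phi> * cos \<theta>, - sin \<theta>]"

definition fr_ph :: "real \<Rightarrow> real^3" where
  "fr_ph \<phi> = vector [- sin \<phi>, cos \<phi>, 0]"

definition fr_rho :: "real \<Rightarrow> real^3" where
  "fr_rho \<phi> = vector [cos \<phi>, sin \<phi>, 0]"

lemmas fr_defs = fr_th_def fr_ph_def fr_rho_def sph_def

lemma cos_sq: "cos x * cos x = 1 - sin x * sin (x :: real)"
  using sin_cos_squared_add3[of x] by linarith

lemma frame_inner:
  "fr_th \<phi> \<theta> \<bullet> fr_th \<phi> \<theta> = 1" "fr_ph \<phi> \<bullet> fr_ph \<phi> = 1" "sph \<phi> \<theta> \<bullet> sph \<phi> \<theta> = 1"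
  "fr_th \<phi> \<theta> \<bullet> fr_ph \<phi> = 0" "fr_th \<phi> \<theta> \<bullet> sph \<phi> \<theta> = 0" "fr_ph \<phi> \<bullet> sph \<phi> \<theta> = 0"
  "fr_ph \<phi> \<bullet> fr_th \<phi> \<theta> = 0" "sph \<phi> \<theta> \<bullet> fr_th \<phi> \<theta> = 0" "sph \<phi> \<theta> \<bullet> fr_ph \<phi> = 0"
proof -
  have "cos \<phi> * cos \<theta> * (cos \<phi> * cos \<theta>) + sin \<phi> * cos \<theta> * (sin \<phi> * cos \<theta>) + sin \<theta> * sin \<theta> = 1"
    "cos \<phi> * sin \<theta> * (cos \<phi> * sin \<theta>) + sin \<phi> * sin \<theta> * (sin \<phi> * sin \<theta>) + cos \<theta> * cos \<theta> = 1"
    "cos \<phi> * cos \<theta> * (cos \<phi> * sin \<theta>) + sin \<phi> * cos \<theta> * (sin \<phi> * sin \<theta>) = sin \<theta> * cos \<theta>"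
    using sin_cos_squared_add3[of \<phi>] sin_cos_squared_add3[of \<theta>] by algebra+
  thus "fr_th \<phi> \<theta> \<bullet> fr_th \<phi> \<theta> = 1" "fr_ph \<phi> \<bullet> fr_ph \<phi> = 1" "sph \<phi> \<theta> \<bullet> sph \<phi> \<theta> = 1"
  "fr_th \<phi> \<theta> \<bullet> fr_ph \<phi> = 0" "fr_th \<phi> \<theta> \<bullet> sph \<phi> \<theta> = 0" "fr_ph \<phi> \<bullet> sph \<phi> \<theta> = 0"
  "fr_ph \<phi> \<bullet> fr_th \<phi> \<theta> = 0" "sph \<phi> \<theta> \<bullet> fr_th \<phi> \<theta> = 0" "sph \<phi> \<theta> \<bullet> fr_ph \<phi> = 0"
    using sin_cos_squared_add3[of \<phi>] by (auto simp: inner_vector3 fr_defs algebra_simps)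
qed

lemma norm_sph: "norm (sph \<phi> \<theta>) = 1"
  by (simp add: norm_eq_1 frame_inner)

lemma frame_cross:
  "cross3 (sph \<phi> \<theta>) (fr_th \<phi> \<theta>) = fr_ph \<phi>" "cross3 (sph \<phi> \<theta>) (fr_ph \<phi>) = - fr_th \<phi> \<theta>"
  "cross3 (fr_th \<phi> \<theta>) (sph \<phi> \<theta>) = - fr_ph \<phi>" "cross3 (fr_ph \<phi>) (sph \<phi> \<theta>) = fr_th \<phi> \<theta>"
  by (auto intro!: vector3_eqI simp: cross3_vector fr_defs) (use sin_cos_squared_add3[of \<phi>] sin_cos_squared_add3[of \<theta>] in algebra)+

lemma e3_frame: "e3 = cos \<theta> *\<^sub>R sph \<phi> \<theta> - sin \<theta> *\<^sub>R fr_th \<phi> \<theta>"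
  using sin_cos_squared_add3[of \<theta>] by (auto intro!: vector3_eqI simp: fr_defs axis_def)

lemma rho_frame: "fr_rho \<phi> = cos \<theta> *\<^sub>R fr_th \<phi> \<theta> + sin \<theta> *\<^sub>R sph \<phi> \<theta>"
  by (auto intro!: vector3_eqI simp: fr_defs) (use sin_cos_squared_add3[of \<phi>] sin_cos_squared_add3[of \<theta>] in algebra)+

lemma frame_expansion:
  "v = (fr_th \<phi> \<theta> \<bullet> v) *\<^sub>R fr_th \<phi> \<theta> + (fr_ph \<phi> \<bullet> v) *\<^sub>R fr_ph \<phi> + (sph \<phi> \<theta> \<bullet> v) *\<^sub>R sph \<phi> \<theta>"
  by (auto intro!: vector3_eqI simp: inner_vector3 fr_defs) (use sin_cos_squared_add3[of \<phi>] sin_cos_squared_add3[of \<theta>] in algebra)+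

lemma bounded_bilinear_cross3: "bounded_bilinear cross3"
  using bilinear_cross bilinear_conv_bounded_bilinear by blast

section \<open>The linearization at a wavetrain\<close>

lemma frechet_derivative_rot_residual:
  "frechet_derivative (rot_residual \<alpha> \<beta> h \<mu> \<omega>) (at (n, 0, nxx)) (v, p, w) =
     p - \<omega> *\<^sub>R cross3 e3 v
     - (cross3 v (\<alpha> *\<^sub>R (- \<omega> *\<^sub>R cross3 e3 n) - nxx + (\<mu> * n $ 3 - h) *\<^sub>R e3 + \<beta> *\<^sub>R cross3 n e3)
        + cross3 n (\<alpha> *\<^sub>R (p - \<omega> *\<^sub>R cross3 e3 v) - w + (\<mu> * v $ 3) *\<^sub>R e3 + \<beta> *\<^sub>R cross3 v e3))"
proof -
  note [derivative_intros] = bounded_bilinear.FDERIV[OF bounded_bilinear_cross3]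
    bounded_linear.has_derivative[OF bounded_linear_vec_nth]
  have "(rot_residual \<alpha> \<beta> h \<mu> \<omega> has_derivative (\<lambda>(v, p, w).
     p - \<omega> *\<^sub>R cross3 e3 v
     - (cross3 v (\<alpha> *\<^sub>R (- \<omega> *\<^sub>R cross3 e3 n) - nxx + (\<mu> * n $ 3 - h) *\<^sub>R e3 + \<beta> *\<^sub>R cross3 n e3)
        + cross3 n (\<alpha> *\<^sub>R (p - \<omega> *\<^sub>R cross3 e3 v) - w + (\<mu> * v $ 3) *\<^sub>R e3 + \<beta> *\<^sub>R cross3 v e3)))) (at (n, 0, nxx))"
    unfolding rot_residual_def llgs_rhs_def Let_def case_prod_beta
    by (auto intro!: derivative_eq_intros simp: fun_eq_iff)
  from frechet_derivative_at[OF this] show ?thesis by (metis (no_types, lifting) case_prod_conv)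
qed

lemma sph_deriv_x:
  assumes "(\<phi> has_real_derivative q) (at x)" "(\<theta> has_real_derivative p) (at x)"
  shows "((\<lambda>x. sph (\<phi> x) (\<theta> x)) has_vector_derivative p *\<^sub>R fr_th (\<phi> x) (\<theta> x) + (q * sin (\<theta> x)) *\<^sub>R fr_ph (\<phi> x)) (at x)"
proof -
  have "((\<lambda>x. sph (\<phi> x) (\<theta> x)) has_vector_derivative
     vector [- sin (\<phi> x) * q * sin (\<theta> x) + cos (\<phi> x) * (cos (\<theta> x) * p), 
       cos (\<phi> x) * q * sin (\<theta> x) + sin (\<phi> x) * (cos (\<theta> x) * p), - sin (\<theta> x) * p]) (at x)"
    unfolding sph_def
    by (rule has_vector_derivative_vector3) (auto intro!: derivative_eq_intros assms)
  thus ?thesis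
    by (rule back_subst[where P="\<lambda>d. (_ has_vector_derivative d) _"]) (auto intro!: vector3_eqI simp: fr_defs)
qed

lemma fr_th_deriv_x:
  assumes "(\<phi> has_real_derivative q) (at x)" "(\<theta> has_real_derivative p) (at x)"
  shows "((\<lambda>x. fr_th (\<phi> x) (\<theta> x)) has_vector_derivative (- p) *\<^sub>R sph (\<phi> x) (\<theta> x) + (q * cos (\<theta> x)) *\<^sub>R fr_ph (\<phi> x)) (at x)"
proof -
  have "((\<lambda>x. fr_th (\<phi> x) (\<theta> x)) has_vector_derivative
     vector [- sin (\<phi> x) * q * cos (\<theta> x) + cos (\<phi> x) * (- sin (\<theta> x) * p), 
       cos (\<phi> x) * q * cos (\<theta> x) + sin (\<phi> x) * (- sin (\<theta> x) * p), - cos (\<theta> x) * p]) (at x)"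
    unfolding fr_th_def
    by (rule has_vector_derivative_vector3) (auto intro!: derivative_eq_intros assms)
  thus ?thesis
    by (rule back_subst[where P="\<lambda>d. (_ has_vector_derivative d) _"]) (auto intro!: vector3_eqI simp: fr_defs)
qed

lemma fr_ph_deriv_x:
  assumes "(\<phi> has_real_derivative q) (at x)"
  shows "((\<lambda>x. fr_ph (\<phi> x)) has_vector_derivative (- q) *\<^sub>R fr_rho (\<phi> x)) (at x)"
proof -
  have "((\<lambda>x. fr_ph (\<phi> x)) has_vector_derivative vector [- (cos (\<phi> x) * q), - sin (\<phi> x) * q, 0]) (at x)"
    unfolding fr_ph_def
    by (rule has_vector_derivative_vector3) (auto intro!: derivative_eq_intros assms)
  thus ?thesis
    by (rule back_subst[where P="\<lambda>d. (_ has_vector_derivative d) _"]) (auto intro!: vector3_eqI simp: fr_defs)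
qed

lemma fr_rho_deriv_x:
  assumes "(\<phi> has_real_derivative q) (at x)"
  shows "((\<lambda>x. fr_rho (\<phi> x)) has_vector_derivative q *\<^sub>R fr_ph (\<phi> x)) (at x)"
proof -
  have "((\<lambda>x. fr_rho (\<phi> x)) has_vector_derivative vector [- sin (\<phi> x) * q, cos (\<phi> x) * q, 0]) (at x)"
    unfolding fr_rho_def
    by (rule has_vector_derivative_vector3) (auto intro!: derivative_eq_intros assms)
  thus ?thesis
    by (rule back_subst[where P="\<lambda>d. (_ has_vector_derivative d) _"]) (auto intro!: vector3_eqI simp: fr_defs)
qed

lemma wavetrain_second_derivative:
  "vector_derivative (\<lambda>y. vector_derivative (\<lambda>x. sph (k * x) \<theta>) (at y)) (at x) = (- (k\<^sup>2 * sin \<theta>)) *\<^sub>R fr_rho (k * x)"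
proof -
  have d: "((\<lambda>x. k * x) has_real_derivative k) (at y)" for y :: real
    by (auto intro!: derivative_eq_intros)
  have "((\<lambda>x. sph (k * x) \<theta>) has_vector_derivative (k * sin \<theta>) *\<^sub>R fr_ph (k * y)) (at y)" for y
    using sph_deriv_x[OF d, of "\<lambda>x. \<theta>" 0] by simp
  hence "(\<lambda>y. vector_derivative (\<lambda>x. sph (k * x) \<theta>) (at y)) = (\<lambda>y. (k * sin \<theta>) *\<^sub>R fr_ph (k * y))"
    by (auto simp: fun_eq_iff intro: vector_derivative_at)
  moreover have "((\<lambda>y. (k * sin \<theta>) *\<^sub>R fr_ph (k * y)) has_vector_derivative (k * sin \<theta>) *\<^sub>R (- k) *\<^sub>R fr_rho (k * x)) (at x)"
    by (intro bounded_linear.has_vector_derivative[OF bounded_linear_scaleR_right] fr_ph_deriv_x d)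
  ultimately show ?thesis
    by (auto simp: vector_derivative_at power2_eq_square mult_ac)
qed

text \<open>Because \<alpha> \<omega> = - \<beta>, the damping caused by the rotation of the frame
  cancels the \<beta> term, both at the wavetrain and in its variation. The bracket at the wavetrain
  reduces to k^2 n + \<omega> e3, and its \<omega> part cancels the rotation term of the frame. What
  remains is tangential, hence two scalar equations.\<close>

lemma lin_residual_wavetrain:
  assumes al: "\<alpha> > 0" and eq: "(\<mu> - k\<^sup>2) * cos \<theta> = h - \<beta> / \<alpha>" and \<omega>: "\<omega> = - \<beta> / \<alpha>"
    and tv: "sph (k * x) \<theta> \<bullet> v = 0" and tp: "sph (k * x) \<theta> \<bullet> p = 0"
  shows "lin_residual \<alpha> \<beta> h \<mu> \<omega> (\<lambda>x. wavetrain k \<omega> \<theta> x 0) x v p w = 0 \<longleftrightarrow>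
    fr_th (k * x) \<theta> \<bullet> p + \<alpha> * (fr_ph (k * x) \<bullet> p) = fr_ph (k * x) \<bullet> w + k\<^sup>2 * (fr_ph (k * x) \<bullet> v) \<and>
    fr_ph (k * x) \<bullet> p - \<alpha> * (fr_th (k * x) \<theta> \<bullet> p) =
      - (fr_th (k * x) \<theta> \<bullet> w) + (\<mu> * (sin \<theta>)\<^sup>2 - k\<^sup>2) * (fr_th (k * x) \<theta> \<bullet> v)"
proof -
  define n where "n = sph (k * x) \<theta>"
  define e where "e = fr_th (k * x) \<theta>"
  define f where "f = fr_ph (k * x)"
  have n3: "n $ 3 = cos \<theta>" by (simp add: n_def sph_def)
  have vf: "v = (e \<bullet> v) *\<^sub>R e + (f \<bullet> v) *\<^sub>R f" and pf: "p = (e \<bullet> p) *\<^sub>R e + (f \<bullet> p) *\<^sub>R f"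
    using frame_expansion[of v "k*x" \<theta>] frame_expansion[of p "k*x" \<theta>] tv tp by (simp_all add: e_def f_def)
  have v3: "v $ 3 = - sin \<theta> * (e \<bullet> v)"
    by (subst vf) (simp add: e_def f_def fr_defs)
  have cr: "cross3 n e = f" "cross3 n f = - e" "cross3 e n = - f" "cross3 f n = e" "cross3 n n = 0"
    unfolding n_def e_def f_def by (rule frame_cross cross_refl)+
  have e3: "e3 = cos \<theta> *\<^sub>R n - sin \<theta> *\<^sub>R e" unfolding n_def e_def by (rule e3_frame)
  have \<alpha>\<omega>: "\<alpha> * \<omega> = - \<beta>" using al \<omega> by simp
  have skew: "cross3 e3 y = - cross3 y e3" for y by (rule cross_skew)
  have X: "\<alpha> *\<^sub>R (- \<omega> *\<^sub>R cross3 e3 n) - (- (k\<^sup>2 * sin \<theta>)) *\<^sub>R fr_rho (k * x) + (\<mu> * n $ 3 - h) *\<^sub>R e3 + \<beta> *\<^sub>R cross3 n e3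
     = k\<^sup>2 *\<^sub>R n + \<omega> *\<^sub>R e3"
  proof -
    have 1: "\<alpha> *\<^sub>R (- \<omega> *\<^sub>R cross3 e3 n) + \<beta> *\<^sub>R cross3 n e3 = 0"
      using \<alpha>\<omega> by (simp add: skew[of n] scaleR_left_distrib[symmetric])
    \<comment> \<open>The equilibrium condition, which trades \<mu> and h for k and
      \<omega>.\<close>
    have 2: "\<mu> * cos \<theta> - h = k\<^sup>2 * cos \<theta> + \<omega>" using eq \<omega> by (simp add: algebra_simps)
    have 3: "fr_rho (k * x) = cos \<theta> *\<^sub>R e + sin \<theta> *\<^sub>R n" unfolding n_def e_def by (rule rho_frame)
    have "(k\<^sup>2 * sin \<theta>) *\<^sub>R fr_rho (k * x) + (k\<^sup>2 * cos \<theta>) *\<^sub>R e3 = (k\<^sup>2 * (cos \<theta> * cos \<theta> + sin \<theta> * sin \<theta>)) *\<^sub>R n"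
      unfolding 3 e3 by (simp add: algebra_simps del: sin_cos_squared_add3)
    hence "(k\<^sup>2 * sin \<theta>) *\<^sub>R fr_rho (k * x) + (k\<^sup>2 * cos \<theta>) *\<^sub>R e3 = k\<^sup>2 *\<^sub>R n"
      by (simp only: sin_cos_squared_add3 mult_1_right)
    thus ?thesis using 1 unfolding n3 2 by (simp add: algebra_simps)
  qed
  have Y: "\<alpha> *\<^sub>R (p - \<omega> *\<^sub>R cross3 e3 v) - w + (\<mu> * v $ 3) *\<^sub>R e3 + \<beta> *\<^sub>R cross3 v e3
     = \<alpha> *\<^sub>R p - w + (\<mu> * v $ 3) *\<^sub>R e3"
  proof -
    have "\<alpha> *\<^sub>R (\<omega> *\<^sub>R cross3 e3 v) = \<beta> *\<^sub>R cross3 v e3"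
      using \<alpha>\<omega> by (simp add: skew[of v])
    thus ?thesis by (simp add: algebra_simps)
  qed
  define r where "r = lin_residual \<alpha> \<beta> h \<mu> \<omega> (\<lambda>x. wavetrain k \<omega> \<theta> x 0) x v p w"
  have "r = p - \<omega> *\<^sub>R cross3 e3 v - (cross3 v (k\<^sup>2 *\<^sub>R n + \<omega> *\<^sub>R e3) + cross3 n (\<alpha> *\<^sub>R p - w + (\<mu> * v $ 3) *\<^sub>R e3))"
    unfolding r_def lin_residual_def wavetrain_def mult_zero_right diff_zero wavetrain_second_derivative
      frechet_derivative_rot_residual n_def[symmetric] X Y ..
  hence r1: "r = p - k\<^sup>2 *\<^sub>R cross3 v n - cross3 n (\<alpha> *\<^sub>R p - w + (\<mu> * v $ 3) *\<^sub>R e3)"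
    by (simp add: cross_add_right cross_mult_right skew[of v])
  define a b p1 p2 w1 w2 where "a = e \<bullet> v" "b = f \<bullet> v" "p1 = e \<bullet> p" "p2 = f \<bullet> p" "w1 = e \<bullet> w" "w2 = f \<bullet> w"
  have wf: "w = w1 *\<^sub>R e + w2 *\<^sub>R f + (n \<bullet> w) *\<^sub>R n"
    using frame_expansion[of w "k*x" \<theta>] by (simp add: a_b_p1_p2_w1_w2_def e_def f_def n_def)
  have c1: "cross3 v n = b *\<^sub>R e - a *\<^sub>R f"
    by (subst vf) (simp add: cross_add_left cross_mult_left cr a_b_p1_p2_w1_w2_def)
  have c2: "cross3 n p = p1 *\<^sub>R f - p2 *\<^sub>R e"
    by (subst pf) (simp add: cross_add_right cross_mult_right cr a_b_p1_p2_w1_w2_def)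
  have c3: "cross3 n w = w1 *\<^sub>R f - w2 *\<^sub>R e"
    by (subst wf) (simp add: cross_add_right cross_mult_right cr)
  have c4: "cross3 n e3 = - sin \<theta> *\<^sub>R f"
    unfolding e3 by (simp add: Cross3.right_diff_distrib cross_mult_right cr)
  have "r = (p1 + \<alpha> * p2 - w2 - k\<^sup>2 * b) *\<^sub>R e + (p2 - \<alpha> * p1 + w1 - (\<mu> * (sin \<theta>)\<^sup>2 - k\<^sup>2) * a) *\<^sub>R f"
    unfolding r1 cross_add_right Cross3.right_diff_distrib cross_mult_right c1 c2 c3 c4 v3
    by (subst pf) (simp add: algebra_simps power2_eq_square a_b_p1_p2_w1_w2_def)
  moreover have "x *\<^sub>R e + y *\<^sub>R f = 0 \<longleftrightarrow> x = 0 \<and> y = 0" for x y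
  proof
    assume 0: "x *\<^sub>R e + y *\<^sub>R f = 0"
    hence "e \<bullet> (x *\<^sub>R e + y *\<^sub>R f) = 0" "f \<bullet> (x *\<^sub>R e + y *\<^sub>R f) = 0" by simp_all
    thus "x = 0 \<and> y = 0" unfolding e_def f_def by (simp add: inner_add_right frame_inner)
  qed simp
  ultimately have "r = 0 \<longleftrightarrow> p1 + \<alpha> * p2 - w2 - k\<^sup>2 * b = 0 \<and> p2 - \<alpha> * p1 + w1 - (\<mu> * (sin \<theta>)\<^sup>2 - k\<^sup>2) * a = 0"
    by (simp only:)
  hence "r = 0 \<longleftrightarrow> p1 + \<alpha> * p2 = w2 + k\<^sup>2 * b \<and> p2 - \<alpha> * p1 = - w1 + (\<mu> * (sin \<theta>)\<^sup>2 - k\<^sup>2) * a"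
    by (auto simp: algebra_simps)
  thus ?thesis unfolding r_def a_b_p1_p2_w1_w2_def e_def f_def .
qed

section \<open>Complex vector fields and their frame coordinates\<close>

text \<open>No conjugate occurs: the frame vectors are real, and the real and imaginary parts of a
  field are projected separately, just as they enter the linearized operator.\<close>

definition cdot :: "real^3 \<Rightarrow> complex^3 \<Rightarrow> complex" where
  "cdot e z = (\<Sum>i\<in>UNIV. of_real (e $ i) * z $ i)"

definition cscale :: "real^3 \<Rightarrow> complex \<Rightarrow> complex^3" where
  "cscale e a = (\<chi> i. of_real (e $ i) * a)"

lemma Re_cdot: "Re (cdot e z) = e \<bullet> Re_vec z" and Im_cdot: "Im (cdot e z) = e \<bullet> Im_vec z"
  by (simp_all add: cdot_def inner_vec_def Re_vec_def Im_vec_def)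

lemma cdot_eq_0_iff: "cdot e z = 0 \<longleftrightarrow> e \<bullet> Re_vec z = 0 \<and> e \<bullet> Im_vec z = 0"
  by (simp add: complex_eq_iff Re_cdot Im_cdot)

lemma cdot_cscale: "cdot e (cscale f a) = of_real (e \<bullet> f) * a"
  by (simp add: cdot_def cscale_def inner_vec_def sum_distrib_right mult.assoc)

lemma cdot_add: "cdot e (z + w) = cdot e z + cdot e w"
  and cdot_diff: "cdot e (z - w) = cdot e z - cdot e w"
  and cdot_smult: "cdot e (c *s z) = c * cdot e z"
  and cdot_add_left: "cdot (e + f) z = cdot e z + cdot f z"
  and cdot_scaleR_left: "cdot (r *\<^sub>R e) z = of_real r * cdot e z"
  and cdot_minus_left: "cdot (- e) z = - cdot e z"
  by (simp_all add: cdot_def sum_3 algebra_simps)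

lemma norm_vec3_sq: "(norm (z :: complex^3))\<^sup>2 = (\<Sum>i\<in>UNIV. (cmod (z $ i))\<^sup>2)"
  by (simp add: norm_vec_def L2_set_def sum_nonneg)

lemma norm_sq_frame:
  "(norm z)\<^sup>2 = (cmod (cdot (fr_th \<phi> \<theta>) z))\<^sup>2 + (cmod (cdot (fr_ph \<phi>) z))\<^sup>2 + (cmod (cdot (sph \<phi> \<theta>) z))\<^sup>2"
proof -
  have r: "v \<bullet> v = (fr_th \<phi> \<theta> \<bullet> v)\<^sup>2 + (fr_ph \<phi> \<bullet> v)\<^sup>2 + (sph \<phi> \<theta> \<bullet> v)\<^sup>2" for v
    by (subst (2) frame_expansion[of v \<phi> \<theta>])
       (simp add: inner_add_right power2_eq_square inner_commute)
  have "(norm z)\<^sup>2 = Re_vec z \<bullet> Re_vec z + Im_vec z \<bullet> Im_vec z"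
    unfolding norm_vec3_sq cmod_power2 by (simp add: inner_vec_def Re_vec_def Im_vec_def sum.distrib power2_eq_square)
  thus ?thesis
    unfolding cmod_power2 Re_cdot Im_cdot r[of "Re_vec z"] r[of "Im_vec z"] by simp
qed

lemma bounded_linear_axis: "bounded_linear (axis i :: complex \<Rightarrow> complex^3)"
  by (rule bounded_linear_intro[where K=1])
     (auto simp: vec_eq_iff axis_def norm_vec_def L2_set_def sum_3 if_distrib[where f="\<lambda>z. (cmod z)\<^sup>2"])

lemma L2_fun_iff: "f \<in> L2_fun \<longleftrightarrow> (\<forall>i. sL2 (\<lambda>x. f x $ i))"
proof
  assume f: "f \<in> L2_fun"
  have [measurable]: "f \<in> borel_measurable borel" using f by (simp add: L2_fun_def)
  have m: "(\<lambda>x. f x $ i) \<in> borel_measurable borel" for i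
    by (rule measurable_compose[of f _ borel]) (auto intro!: borel_measurable_continuous_onI continuous_intros)
  show "\<forall>i. sL2 (\<lambda>x. f x $ i)"
  proof
    fix i
    have "integrable lborel (\<lambda>x. (norm (f x))\<^sup>2)" using f by (simp add: L2_fun_def)
    hence "integrable lborel (\<lambda>x. (cmod (f x $ i))\<^sup>2)"
      by (rule Bochner_Integration.integrable_bound) (use m[of i] in \<open>auto intro!: AE_I2 power_mono Finite_Cartesian_Product.norm_nth_le\<close>)
    thus "sL2 (\<lambda>x. f x $ i)" using m by (simp add: sL2_def)
  qed
next
  assume f: "\<forall>i. sL2 (\<lambda>x. f x $ i)"
  have "f = (\<lambda>x. \<Sum>i\<in>UNIV. axis i (f x $ i))"
    by (auto simp: fun_eq_iff vec_eq_iff axis_def if_distrib[where f="\<lambda>v. v $ _"] sum_3 forall_3)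
  moreover have "(\<lambda>x. axis i (f x $ i)) \<in> borel_measurable lborel" for i
  proof (rule measurable_compose[of "\<lambda>x. f x $ i" _ borel])
    show "(axis i :: complex \<Rightarrow> complex^3) \<in> borel_measurable borel"
      by (rule borel_measurable_continuous_onI[OF linear_continuous_on[OF bounded_linear_axis]])
  qed (use f in \<open>auto simp: sL2_def\<close>)
  hence "(\<lambda>x. \<Sum>i\<in>UNIV. axis i (f x $ i)) \<in> borel_measurable lborel"
    by (intro borel_measurable_sum)
  ultimately have "f \<in> borel_measurable lborel" by (simp only:)
  moreover have "integrable lborel (\<lambda>x. (norm (f x))\<^sup>2)"
    unfolding norm_vec3_sq using f by (intro Bochner_Integration.integrable_sum) (auto simp: sL2_def)
  ultimately show "f \<in> L2_fun" by (simp add: L2_fun_def)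
qed

lemma H1_deriv_iff: "H1_deriv v w \<longleftrightarrow> (\<forall>i. sH1 (\<lambda>x. v x $ i) (\<lambda>x. w x $ i))"
proof -
  have "(w has_integral (v b - v a)) {a..b} \<longleftrightarrow> (\<forall>i. ((\<lambda>x. w x $ i) has_integral (v b $ i - v a $ i)) {a..b})" for a b
  proof
    assume "(w has_integral (v b - v a)) {a..b}"
    from has_integral_linear[OF this bounded_linear_vec_nth]
    show "\<forall>i. ((\<lambda>x. w x $ i) has_integral (v b $ i - v a $ i)) {a..b}" by (simp add: o_def)
  next
    assume h: "\<forall>i. ((\<lambda>x. w x $ i) has_integral (v b $ i - v a $ i)) {a..b}"
    have "((\<lambda>x. \<Sum>i\<in>UNIV. axis i (w x $ i)) has_integral (\<Sum>i\<in>UNIV. axis i (v b $ i - v a $ i))) {a..b}"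
      using has_integral_linear[OF spec[OF h] bounded_linear_axis] by (intro has_integral_sum) (auto simp: o_def)
    moreover have "(\<Sum>i\<in>UNIV. axis i (z $ i)) = z" for z :: "complex^3"
      by (auto simp: vec_eq_iff axis_def sum_3 forall_3)
    ultimately show "(w has_integral (v b - v a)) {a..b}" by (metis (no_types, lifting) has_integral_cong vector_minus_component sum.cong)
  qed
  thus ?thesis by (auto simp: H1_deriv_def sH1_iff_has_integral L2_fun_iff)
qed

lemma sH1_real_mult:
  fixes c c' :: "real \<Rightarrow> real"
  assumes u: "sH1 u g" and d: "\<And>x. (c has_real_derivative c' x) (at x)" and c': "continuous_on UNIV c'"
    and b: "\<And>x. \<bar>c x\<bar> \<le> K" and b': "\<And>x. \<bar>c' x\<bar> \<le> K'"
  shows "sH1 (\<lambda>x. of_real (c x) * u x) (\<lambda>x. of_real (c' x) * u x + of_real (c x) * g x)"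
proof (rule sH1_mult_C1[OF u])
  show "((\<lambda>x. complex_of_real (c x)) has_vector_derivative complex_of_real (c' x)) (at x)" for x
    using d[of x] by (intro has_vector_derivative_of_real) (simp add: has_real_derivative_iff_has_vector_derivative)
qed (use b b' c' in \<open>auto intro!: continuous_intros\<close>)

lemma has_vector_derivative_nth:
  "(e has_vector_derivative e') (at x) \<Longrightarrow> ((\<lambda>x. e x $ i) has_real_derivative e' $ i) (at x)"
  using bounded_linear.has_vector_derivative[OF bounded_linear_vec_nth]
  by (simp add: has_real_derivative_iff_has_vector_derivative)

lemma sH1_cdot:
  assumes v: "H1_deriv v w" and d: "\<And>x. (e has_vector_derivative e' x) (at x)" and c': "continuous_on UNIV e'"
    and b: "\<And>x. norm (e x) \<le> K" and b': "\<And>x. norm (e' x) \<le> K'"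
  shows "sH1 (\<lambda>x. cdot (e x) (v x)) (\<lambda>x. cdot (e' x) (v x) + cdot (e x) (w x))"
proof -
  have "sH1 (\<lambda>x. of_real (e x $ i) * v x $ i) (\<lambda>x. of_real (e' x $ i) * v x $ i + of_real (e x $ i) * w x $ i)" for i
  proof (rule sH1_real_mult)
    show "\<bar>e x $ i\<bar> \<le> K" "\<bar>e' x $ i\<bar> \<le> K'" for x
      using component_le_norm_cart[of "e x" i] component_le_norm_cart[of "e' x" i] b[of x] b'[of x] by auto
  qed (use v d c' in \<open>auto simp: H1_deriv_iff intro!: has_vector_derivative_nth continuous_intros\<close>)
  note s = this
  show ?thesis
    using sH1_add[OF sH1_add[OF s[of 1] s[of 2]] s[of 3]] by (simp add: cdot_def sum_3 add_ac)
qed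

lemma H1_deriv_cscale:
  assumes v: "sH1 a a'" and d: "\<And>x. (e has_vector_derivative e' x) (at x)" and c': "continuous_on UNIV e'"
    and b: "\<And>x. norm (e x) \<le> K" and b': "\<And>x. norm (e' x) \<le> K'"
  shows "H1_deriv (\<lambda>x. cscale (e x) (a x)) (\<lambda>x. cscale (e' x) (a x) + cscale (e x) (a' x))"
  unfolding H1_deriv_iff cscale_def vector_add_component vec_lambda_beta
proof
  fix i
  show "sH1 (\<lambda>x. of_real (e x $ i) * a x) (\<lambda>x. of_real (e' x $ i) * a x + of_real (e x $ i) * a' x)"
  proof (rule sH1_real_mult)
    show "\<bar>e x $ i\<bar> \<le> K" "\<bar>e' x $ i\<bar> \<le> K'" for x
      using component_le_norm_cart[of "e x" i] component_le_norm_cart[of "e' x" i] b[of x] b'[of x] by auto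
  qed (use v d c' in \<open>auto intro!: has_vector_derivative_nth continuous_intros\<close>)
qed

lemma H1_deriv_add: "H1_deriv u u' \<Longrightarrow> H1_deriv v v' \<Longrightarrow> H1_deriv (\<lambda>x. u x + v x) (\<lambda>x. u' x + v' x)"
  by (simp add: H1_deriv_iff sH1_add)

text \<open>The set where \<open>r\<close> does not vanish is open and null, hence empty.\<close>

lemma continuous_AE_zero:
  fixes r :: "real \<Rightarrow> complex"
  assumes c: "continuous_on UNIV r" and ae: "AE x in lborel. r x = 0"
  shows "r x = 0"
proof -
  obtain N where N: "N \<in> null_sets lborel" "{x. r x \<noteq> 0} \<subseteq> N"
    using ae by (auto simp: eventually_ae_filter)
  have "negligible N" unfolding negligible_iff_null_sets by (rule null_sets_completionI[OF N(1)])
  hence "negligible {x. r x \<noteq> 0}" using N(2) negligible_subset by blast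
  moreover have "open {x. r x \<noteq> 0}" by (intro open_Collect_neq c continuous_on_const)
  ultimately have "{x. r x \<noteq> 0} = {}" using open_not_negligible by blast
  thus ?thesis by blast
qed

text \<open>Lets the tangency condition, which is given only almost everywhere, be differentiated: a
  continuous representative that vanishes almost everywhere vanishes identically, and then all
  integrals of its continuous derivative are zero.\<close>

lemma ac_deriv_zero:
  assumes r: "sH1 r g" and g: "continuous_on UNIV g" and ae: "AE x in lborel. r x = 0"
  shows "g x = 0"
proof (rule ccontr)
  have r0: "r y = 0" for y
    using continuous_AE_zero[OF ac_deriv_continuous ae] r by (auto simp: sH1_def)
  assume "g x \<noteq> 0"
  have d: "((\<lambda>u. integral {x..u} g) has_vector_derivative g x) (at x within {x..x+1})"
    by (rule integral_has_vector_derivative) (auto intro: continuous_on_subset[OF g])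
  have "integral {x..u} g = 0" if "u \<in> {x..x+1}" for u
    using r that by (auto simp: sH1_iff_has_integral r0 intro!: integral_unique)
  hence "((\<lambda>u. 0) has_vector_derivative g x) (at x within {x..x+1})"
    by (intro has_vector_derivative_transform[OF _ _ d]) auto
  moreover have "((\<lambda>u. 0 :: complex) has_vector_derivative 0) (at x within {x..x+1})" by simp
  ultimately have "g x = 0"
    using vector_derivative_unique_within_closed_interval[of x "x+1" x] by (metis atLeastAtMost_iff box_real(2) less_add_one less_eq_real_def order_refl)
  thus False using \<open>g x \<noteq> 0\<close> by blast
qed

lemma norm_fr: "norm (fr_th \<phi> \<theta>) = 1" "norm (fr_ph \<phi>) = 1" "norm (fr_rho \<phi>) = 1"
proof -
  show "norm (fr_th \<phi> \<theta>) = 1" "norm (fr_ph \<phi>) = 1" by (simp_all add: norm_eq_1 frame_inner)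
  show "norm (fr_rho \<phi>) = 1" unfolding norm_eq_1
    using sin_cos_squared_add3[of \<phi>] by (simp add: inner_vector3 fr_rho_def)
qed

lemma wavetrain_profile: "wavetrain k \<omega> \<theta> x 0 = sph (k * x) \<theta>"
  by (simp add: wavetrain_def)

lemma frame_derivs:
  "((\<lambda>x. sph (k * x) \<theta>) has_vector_derivative (k * sin \<theta>) *\<^sub>R fr_ph (k * x)) (at x)"
  "((\<lambda>x. fr_th (k * x) \<theta>) has_vector_derivative (k * cos \<theta>) *\<^sub>R fr_ph (k * x)) (at x)"
  "((\<lambda>x. fr_ph (k * x)) has_vector_derivative (- k) *\<^sub>R fr_rho (k * x)) (at x)"
  "((\<lambda>x. fr_rho (k * x)) has_vector_derivative k *\<^sub>R fr_ph (k * x)) (at x)"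
proof -
  have d: "((\<lambda>x. k * x) has_real_derivative k) (at x)" by (auto intro!: derivative_eq_intros)
  show "((\<lambda>x. sph (k * x) \<theta>) has_vector_derivative (k * sin \<theta>) *\<^sub>R fr_ph (k * x)) (at x)"
    using sph_deriv_x[OF d, of "\<lambda>x. \<theta>" 0] by simp
  show "((\<lambda>x. fr_th (k * x) \<theta>) has_vector_derivative (k * cos \<theta>) *\<^sub>R fr_ph (k * x)) (at x)"
    using fr_th_deriv_x[OF d, of "\<lambda>x. \<theta>" 0] by simp
  show "((\<lambda>x. fr_ph (k * x)) has_vector_derivative (- k) *\<^sub>R fr_rho (k * x)) (at x)"
    "((\<lambda>x. fr_rho (k * x)) has_vector_derivative k *\<^sub>R fr_ph (k * x)) (at x)"
    by (intro fr_ph_deriv_x fr_rho_deriv_x d)+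
qed

lemma continuous_fr: "continuous_on UNIV (\<lambda>x. fr_ph (k * x))" "continuous_on UNIV (\<lambda>x. fr_rho (k * x))"
  using frame_derivs(3,4)[of k]
  by (meson continuous_at_imp_continuous_on has_vector_derivative_continuous)+

lemma frame_sH1:
  assumes v: "H1_deriv v w"
  shows "sH1 (\<lambda>x. cdot (sph (k * x) \<theta>) (v x)) (\<lambda>x. of_real (k * sin \<theta>) * cdot (fr_ph (k * x)) (v x) + cdot (sph (k * x) \<theta>) (w x))"
    "sH1 (\<lambda>x. cdot (fr_th (k * x) \<theta>) (v x)) (\<lambda>x. of_real (k * cos \<theta>) * cdot (fr_ph (k * x)) (v x) + cdot (fr_th (k * x) \<theta>) (w x))"
    "sH1 (\<lambda>x. cdot (fr_ph (k * x)) (v x)) (\<lambda>x. - of_real k * cdot (fr_rho (k * x)) (v x) + cdot (fr_ph (k * x)) (w x))"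
    "sH1 (\<lambda>x. cdot (fr_rho (k * x)) (v x)) (\<lambda>x. of_real k * cdot (fr_ph (k * x)) (v x) + cdot (fr_rho (k * x)) (w x))"
proof -
  note c = continuous_on_scaleR[OF continuous_on_const continuous_fr(1)] continuous_on_scaleR[OF continuous_on_const continuous_fr(2)]
  show "sH1 (\<lambda>x. cdot (sph (k * x) \<theta>) (v x)) (\<lambda>x. of_real (k * sin \<theta>) * cdot (fr_ph (k * x)) (v x) + cdot (sph (k * x) \<theta>) (w x))"
    using sH1_cdot[OF v frame_derivs(1)[of k \<theta>] c(1), of 1 "\<bar>k * sin \<theta>\<bar>"] by (simp add: norm_fr norm_sph cdot_scaleR_left cdot_minus_left abs_mult)
  show "sH1 (\<lambda>x. cdot (fr_th (k * x) \<theta>) (v x)) (\<lambda>x. of_real (k * cos \<theta>) * cdot (fr_ph (k * x)) (v x) + cdot (fr_th (k * x) \<theta>) (w x))"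
    using sH1_cdot[OF v frame_derivs(2)[of k \<theta>] c(1), of 1 "\<bar>k * cos \<theta>\<bar>"] by (simp add: norm_fr norm_sph cdot_scaleR_left cdot_minus_left abs_mult)
  show "sH1 (\<lambda>x. cdot (fr_ph (k * x)) (v x)) (\<lambda>x. - of_real k * cdot (fr_rho (k * x)) (v x) + cdot (fr_ph (k * x)) (w x))"
    using sH1_cdot[OF v frame_derivs(3)[of k] c(2), of 1 "\<bar>k\<bar>"] by (simp add: norm_fr norm_sph cdot_scaleR_left cdot_minus_left abs_mult)
  show "sH1 (\<lambda>x. cdot (fr_rho (k * x)) (v x)) (\<lambda>x. of_real k * cdot (fr_ph (k * x)) (v x) + cdot (fr_rho (k * x)) (w x))"
    using sH1_cdot[OF v frame_derivs(4)[of k] c(1), of 1 "\<bar>k\<bar>"] by (simp add: norm_fr norm_sph cdot_scaleR_left cdot_minus_left abs_mult)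
qed

lemma L2_tangent_iff:
  "f \<in> L2_tangent (\<lambda>x. wavetrain k \<omega> \<theta> x 0) \<longleftrightarrow> f \<in> L2_fun \<and> (AE x in lborel. cdot (sph (k * x) \<theta>) (f x) = 0)"
  by (simp add: L2_tangent_def wavetrain_profile cdot_eq_0_iff)

lemma sL2_cdot:
  assumes f: "f \<in> L2_fun" and e: "continuous_on UNIV e" "\<And>x. norm (e x) \<le> 1"
  shows "sL2 (\<lambda>x. cdot (e x) (f x))"
proof -
  have [measurable]: "(\<lambda>x. e x $ i) \<in> borel_measurable borel" for i
    by (intro borel_measurable_continuous_onI continuous_intros e)
  have "sL2 (\<lambda>x. of_real (e x $ i) * f x $ i)" for i
  proof (rule sL2_bound(1)[of "\<lambda>x. f x $ i" _ 1])
    show s: "sL2 (\<lambda>x. f x $ i)" using f by (simp add: L2_fun_iff)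
    note [measurable] = s
    show "(\<lambda>x. complex_of_real (e x $ i) * f x $ i) \<in> borel_measurable borel" by measurable
    show "AE x in lborel. cmod (complex_of_real (e x $ i) * f x $ i) \<le> 1 * cmod (f x $ i)"
      using component_le_norm_cart[of "e _" i] e(2) order_trans
      by (intro AE_I2) (auto simp: norm_mult intro!: mult_left_le_one_le intro: order_trans)
  qed
  thus ?thesis unfolding cdot_def sum_3 by (intro sL2_add)
qed

lemma continuous_frame:
  "continuous_on UNIV (\<lambda>x. fr_th (k * x) \<theta>)" "continuous_on UNIV (\<lambda>x. sph (k * x) \<theta>)"
  using frame_derivs(1,2)[of k \<theta>]
  by (meson continuous_at_imp_continuous_on has_vector_derivative_continuous)+

text \<open>Orthonormality of the frame, the normal component being zero almost everywhere.
  Resolvent bounds thereby become bounds for two scalar coordinates.\<close>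

lemma L2_nrm_tangent:
  assumes "f \<in> L2_tangent (\<lambda>x. wavetrain k \<omega> \<theta> x 0)"
  shows "(L2_nrm f)\<^sup>2 = nsq (\<lambda>x. cdot (fr_th (k * x) \<theta>) (f x)) + nsq (\<lambda>x. cdot (fr_ph (k * x)) (f x))"
proof -
  have f: "f \<in> L2_fun" and t: "AE x in lborel. cdot (sph (k * x) \<theta>) (f x) = 0"
    using assms by (auto simp: L2_tangent_iff)
  have s: "sL2 (\<lambda>x. cdot (fr_th (k * x) \<theta>) (f x))" "sL2 (\<lambda>x. cdot (fr_ph (k * x)) (f x))"
    by (intro sL2_cdot f continuous_frame continuous_fr, simp add: norm_fr)+
  have [measurable]: "f \<in> borel_measurable borel" using f by (simp add: L2_fun_def)
  note [measurable] = s
  have "(L2_nrm f)\<^sup>2 = (\<integral>x. (norm (f x))\<^sup>2 \<partial>lborel)" by (simp add: L2_nrm_def)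
  also have "\<dots> = (\<integral>x. (cmod (cdot (fr_th (k * x) \<theta>) (f x)))\<^sup>2 + (cmod (cdot (fr_ph (k * x)) (f x)))\<^sup>2 \<partial>lborel)"
  proof (rule integral_cong_AE)
    show "AE x in lborel. (norm (f x))\<^sup>2 = (cmod (cdot (fr_th (k * x) \<theta>) (f x)))\<^sup>2 + (cmod (cdot (fr_ph (k * x)) (f x)))\<^sup>2"
      using t
    proof eventually_elim
      case (elim x)
      thus ?case using norm_sq_frame[of "f x" "k * x" \<theta>] by simp
    qed
  qed measurable
  also have "\<dots> = nsq (\<lambda>x. cdot (fr_th (k * x) \<theta>) (f x)) + nsq (\<lambda>x. cdot (fr_ph (k * x)) (f x))"
    unfolding nsq_def using s by (intro Bochner_Integration.integral_add) (auto simp: sL2_def)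
  finally show ?thesis .
qed

section \<open>Spectral stability and instability of wavetrains\<close>

lemma lin_residual_complex:
  assumes al: "\<alpha> > 0" and eq: "(\<mu> - k\<^sup>2) * cos \<theta> = h - \<beta> / \<alpha>" and \<omega>: "\<omega> = - \<beta> / \<alpha>"
    and tv: "cdot (sph (k * x) \<theta>) v = 0" and tp: "cdot (sph (k * x) \<theta>) p = 0"
  shows "lin_residual \<alpha> \<beta> h \<mu> \<omega> (\<lambda>x. wavetrain k \<omega> \<theta> x 0) x (Re_vec v) (Re_vec p) (Re_vec w) = 0 \<and>
      lin_residual \<alpha> \<beta> h \<mu> \<omega> (\<lambda>x. wavetrain k \<omega> \<theta> x 0) x (Im_vec v) (Im_vec p) (Im_vec w) = 0 \<longleftrightarrow>
    cdot (fr_th (k * x) \<theta>) p + of_real \<alpha> * cdot (fr_ph (k * x)) p = cdot (fr_ph (k * x)) w + of_real (k\<^sup>2) * cdot (fr_ph (k * x)) v \<and>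
    cdot (fr_ph (k * x)) p - of_real \<alpha> * cdot (fr_th (k * x) \<theta>) p =
      - cdot (fr_th (k * x) \<theta>) w + of_real (\<mu> * (sin \<theta>)\<^sup>2 - k\<^sup>2) * cdot (fr_th (k * x) \<theta>) v"
proof -
  have t: "sph (k * x) \<theta> \<bullet> Re_vec v = 0" "sph (k * x) \<theta> \<bullet> Im_vec v = 0"
    "sph (k * x) \<theta> \<bullet> Re_vec p = 0" "sph (k * x) \<theta> \<bullet> Im_vec p = 0"
    using tv tp by (auto simp: cdot_eq_0_iff)
  show ?thesis
    unfolding lin_residual_wavetrain[OF al eq \<omega> t(1,3)] lin_residual_wavetrain[OF al eq \<omega> t(2,4)] complex_eq_iff
    by (simp add: Re_cdot Im_cdot del: of_real_power of_real_diff of_real_mult of_real_add) blast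
qed

text \<open>Differentiating the coordinates also differentiates the frame, which turns as x varies.
  This produces the first-order coupling \<kappa> = 2 k cos \<theta>, changes \<mu> sin^2 \<theta> -
  k^2 into (\<mu> - k^2) sin^2 \<theta>, and cancels the term k^2 b.\<close>

lemma lin_graph_elim:
  fixes v p :: "real \<Rightarrow> complex^3" and \<alpha> \<beta> h \<mu> k \<theta> \<omega> :: real
  defines "a \<equiv> \<lambda>x. cdot (fr_th (k * x) \<theta>) (v x)" and "b \<equiv> \<lambda>x. cdot (fr_ph (k * x)) (v x)"
    and "p1 \<equiv> \<lambda>x. cdot (fr_th (k * x) \<theta>) (p x)" and "p2 \<equiv> \<lambda>x. cdot (fr_ph (k * x)) (p x)"
    and "\<kappa> \<equiv> 2 * k * cos \<theta>" and "S \<equiv> (\<mu> - k\<^sup>2) * (sin \<theta>)\<^sup>2"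
  assumes al: "\<alpha> > 0" and eq: "(\<mu> - k\<^sup>2) * cos \<theta> = h - \<beta> / \<alpha>" and \<omega>: "\<omega> = - \<beta> / \<alpha>"
    and G: "(v, p) \<in> lin_graph \<alpha> \<beta> h \<mu> \<omega> (\<lambda>x. wavetrain k \<omega> \<theta> x 0)"
  shows "\<exists>a' a'' b' b''. sH1 a a' \<and> sH1 a' a'' \<and> sH1 b b' \<and> sH1 b' b'' \<and>
     (AE x in lborel. p1 x + of_real \<alpha> * p2 x = b'' x + of_real \<kappa> * a' x \<and>
        p2 x - of_real \<alpha> * p1 x = - a'' x + of_real \<kappa> * b' x + of_real S * a x)"
proof -
  obtain v' v'' where v: "H1_deriv v v'" "H1_deriv v' v''" and
    tv: "AE x in lborel. cdot (sph (k * x) \<theta>) (v x) = 0" and tp: "AE x in lborel. cdot (sph (k * x) \<theta>) (p x) = 0" and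
    ae: "AE x in lborel. lin_residual \<alpha> \<beta> h \<mu> \<omega> (\<lambda>x. wavetrain k \<omega> \<theta> x 0) x (Re_vec (v x)) (Re_vec (p x)) (Re_vec (v'' x)) = 0 \<and>
      lin_residual \<alpha> \<beta> h \<mu> \<omega> (\<lambda>x. wavetrain k \<omega> \<theta> x 0) x (Im_vec (v x)) (Im_vec (p x)) (Im_vec (v'' x)) = 0"
    using G unfolding lin_graph_def by (auto simp: L2_tangent_iff)
  define K where "K = complex_of_real (k * cos \<theta>)"
  define k' where "k' = complex_of_real k"
  let ?n = "\<lambda>x. cdot (sph (k * x) \<theta>)" and ?e = "\<lambda>x. cdot (fr_th (k * x) \<theta>)" and ?f = "\<lambda>x. cdot (fr_ph (k * x))"
    and ?\<rho> = "\<lambda>x. cdot (fr_rho (k * x))"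
  define b' where "b' x = - k' * ?\<rho> x (v x) + ?f x (v' x)" for x
  define a' where "a' x = K * b x + ?e x (v' x)" for x
  define a'' where "a'' x = K * b' x + (K * ?f x (v' x) + ?e x (v'' x))" for x
  define b'' where "b'' x = - k' * (k' * b x + ?\<rho> x (v' x)) + (- k' * ?\<rho> x (v' x) + ?f x (v'' x))" for x
  have 1: "sH1 a a'" unfolding a_def a'_def K_def b_def by (rule frame_sH1(2)[OF v(1)])
  have 2: "sH1 b b'" using frame_sH1(3)[OF v(1), of k] unfolding b_def b'_def k'_def .
  have 3: "sH1 a' a''" unfolding a'_def a''_def
    by (intro sH1_add sH1_cmult 2) (unfold K_def, rule frame_sH1(2)[OF v(2)])
  have 4: "sH1 b' b''" unfolding b'_def b''_def b_def k'_def
    using frame_sH1(3)[OF v(2), of k] frame_sH1(4)[OF v(1), of k] by (intro sH1_add sH1_cmult)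
  \<comment> \<open>Tangency differentiated once: n . v = 0 gives n . v' = - k sin \<theta> b. The
    expression is continuous because it is again in H^1.\<close>
  have 5: "of_real (k * sin \<theta>) * b x + ?n x (v' x) = 0" for x
  proof (rule ac_deriv_zero)
    show "sH1 (\<lambda>x. ?n x (v x)) (\<lambda>x. of_real (k * sin \<theta>) * b x + ?n x (v' x))"
      unfolding b_def by (rule frame_sH1(1)[OF v(1)])
    have "sH1 (\<lambda>x. of_real (k * sin \<theta>) * b x + ?n x (v' x)) (\<lambda>x. of_real (k * sin \<theta>) * b' x + (of_real (k * sin \<theta>) * ?f x (v' x) + ?n x (v'' x)))"
      by (intro sH1_add sH1_cmult 2 frame_sH1(1)[OF v(2)])
    thus "continuous_on UNIV (\<lambda>x. of_real (k * sin \<theta>) * b x + ?n x (v' x))"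
      by (auto simp: sH1_def dest: ac_deriv_continuous)
  qed (rule tv)
  have "AE x in lborel. p1 x + of_real \<alpha> * p2 x = b'' x + of_real \<kappa> * a' x \<and>
        p2 x - of_real \<alpha> * p1 x = - a'' x + of_real \<kappa> * b' x + of_real S * a x"
    using tv tp ae
  proof eventually_elim
    case (elim x)
    have \<rho>: "?\<rho> x y = of_real (cos \<theta>) * ?e x y + of_real (sin \<theta>) * ?n x y" for y
      by (subst rho_frame[of _ \<theta>]) (simp add: cdot_add_left cdot_scaleR_left)
    have \<rho>v: "?\<rho> x (v x) = of_real (cos \<theta>) * a x" using elim \<rho>[of "v x"] by (simp add: a_def)
    have n': "?n x (v' x) = - of_real (k * sin \<theta>) * b x" using 5[of x] by (simp add: eq_neg_iff_add_eq_0 add.commute)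
    have e': "?e x (v' x) = a' x - K * b x" by (simp add: a'_def)
    have f': "?f x (v' x) = b' x + k' * of_real (cos \<theta>) * a x" by (simp add: b'_def \<rho>v)
    have w1: "?e x (v'' x) = a'' x - 2 * K * b' x - K * k' * of_real (cos \<theta>) * a x"
      by (simp add: a''_def f' algebra_simps)
    have sc: "of_real (cos \<theta>) * of_real (cos \<theta>) = 1 - of_real (sin \<theta>) * (of_real (sin \<theta>) :: complex)"
      by (simp only: cos_sq of_real_mult[symmetric] of_real_diff of_real_1)
    have "?\<rho> x (v' x) = of_real (cos \<theta>) * a' x - k' * b x * (of_real (cos \<theta>) * of_real (cos \<theta>) + of_real (sin \<theta>) * of_real (sin \<theta>))"
      unfolding \<rho> n' e' by (simp add: K_def k'_def algebra_simps)
    hence \<rho>v': "?\<rho> x (v' x) = of_real (cos \<theta>) * a' x - k' * b x" unfolding sc by simp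
    have w2: "?f x (v'' x) = b'' x + k'\<^sup>2 * b x + 2 * k' * (of_real (cos \<theta>) * a' x - k' * b x)"
      by (simp add: b''_def \<rho>v' algebra_simps power2_eq_square)
    have s2: "(\<mu> * (sin \<theta>)\<^sup>2 - k\<^sup>2) + k * cos \<theta> * k * cos \<theta> = (\<mu> - k\<^sup>2) * (sin \<theta>)\<^sup>2"
      using cos_sq[of \<theta>] by algebra
    have "p1 x + of_real \<alpha> * p2 x = ?f x (v'' x) + of_real (k\<^sup>2) * b x"
      and p: "p2 x - of_real \<alpha> * p1 x = - ?e x (v'' x) + of_real (\<mu> * (sin \<theta>)\<^sup>2 - k\<^sup>2) * a x"
      using elim(3) unfolding lin_residual_complex[OF al eq \<omega> elim(1,2)] p1_def p2_def a_def b_def by blast+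
    hence "p1 x + of_real \<alpha> * p2 x = b'' x + of_real \<kappa> * a' x"
      unfolding w2 by (simp add: \<kappa>_def k'_def algebra_simps power2_eq_square)
    moreover have "p2 x - of_real \<alpha> * p1 x = - a'' x + of_real \<kappa> * b' x + of_real ((\<mu> * (sin \<theta>)\<^sup>2 - k\<^sup>2) + k * cos \<theta> * k * cos \<theta>) * a x"
      unfolding p w1 by (simp add: \<kappa>_def K_def k'_def algebra_simps)
    ultimately show ?case unfolding s2 S_def by blast
  qed
  thus ?thesis using 1 2 3 4 by blast
qed

lemma inner_rho: "fr_th \<phi> \<theta> \<bullet> fr_rho \<phi> = cos \<theta>" "fr_ph \<phi> \<bullet> fr_rho \<phi> = 0"
  by (simp_all add: rho_frame[of _ \<theta>] inner_add_right frame_inner)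

text \<open>The converse passage. The normal component of the second derivative does not enter the
  residual, so the two tangential projections decide.\<close>

lemma lin_graph_intro:
  fixes a a' a'' b b' b'' :: "real \<Rightarrow> complex" and p :: "real \<Rightarrow> complex^3" and \<alpha> \<beta> h \<mu> k \<theta> \<omega> :: real
  defines "p1 \<equiv> \<lambda>x. cdot (fr_th (k * x) \<theta>) (p x)" and "p2 \<equiv> \<lambda>x. cdot (fr_ph (k * x)) (p x)"
    and "\<kappa> \<equiv> 2 * k * cos \<theta>" and "S \<equiv> (\<mu> - k\<^sup>2) * (sin \<theta>)\<^sup>2"
  assumes al: "\<alpha> > 0" and eq: "(\<mu> - k\<^sup>2) * cos \<theta> = h - \<beta> / \<alpha>" and \<omega>: "\<omega> = - \<beta> / \<alpha>"
    and p: "p \<in> L2_tangent (\<lambda>x. wavetrain k \<omega> \<theta> x 0)"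
    and h: "sH1 a a'" "sH1 a' a''" "sH1 b b'" "sH1 b' b''"
    and e: "AE x in lborel. p1 x + of_real \<alpha> * p2 x = b'' x + of_real \<kappa> * a' x \<and>
        p2 x - of_real \<alpha> * p1 x = - a'' x + of_real \<kappa> * b' x + of_real S * a x"
  shows "(\<lambda>x. cscale (fr_th (k * x) \<theta>) (a x) + cscale (fr_ph (k * x)) (b x), p) \<in> lin_graph \<alpha> \<beta> h \<mu> \<omega> (\<lambda>x. wavetrain k \<omega> \<theta> x 0)"
proof -
  define c where "c = k * cos \<theta>"
  let ?e = "\<lambda>x. fr_th (k * x) \<theta>" and ?f = "\<lambda>x. fr_ph (k * x)" and ?\<rho> = "\<lambda>x. fr_rho (k * x)"
  define v where "v x = cscale (?e x) (a x) + cscale (?f x) (b x)" for x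
  define v' where "v' x = (cscale (c *\<^sub>R ?f x) (a x) + cscale (?e x) (a' x)) + (cscale ((-k) *\<^sub>R ?\<rho> x) (b x) + cscale (?f x) (b' x))" for x
  define v'' where "v'' x = ((cscale (c *\<^sub>R (-k) *\<^sub>R ?\<rho> x) (a x) + cscale (c *\<^sub>R ?f x) (a' x)) + (cscale (c *\<^sub>R ?f x) (a' x) + cscale (?e x) (a'' x)))
     + ((cscale ((-k) *\<^sub>R k *\<^sub>R ?f x) (b x) + cscale ((-k) *\<^sub>R ?\<rho> x) (b' x)) + (cscale ((-k) *\<^sub>R ?\<rho> x) (b' x) + cscale (?f x) (b'' x)))" for x
  note sc = bounded_linear.has_vector_derivative[OF bounded_linear_scaleR_right]
  note cn = continuous_on_scaleR[OF continuous_on_const]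
  have n: "norm (r *\<^sub>R ?f x) \<le> \<bar>r\<bar>" "norm (r *\<^sub>R ?\<rho> x) \<le> \<bar>r\<bar>" "norm (r *\<^sub>R s *\<^sub>R ?f x) \<le> \<bar>r * s\<bar>"  "norm (r *\<^sub>R s *\<^sub>R ?\<rho> x) \<le> \<bar>r * s\<bar>" "norm (?e x) \<le> 1" "norm (?f x) \<le> 1"
    for r s x by (simp_all add: norm_fr abs_mult)
  have E: "H1_deriv (\<lambda>x. cscale (?e x) (u x)) (\<lambda>x. cscale (c *\<^sub>R ?f x) (u x) + cscale (?e x) (u' x))" if "sH1 u u'" for u u'
    unfolding c_def by (rule H1_deriv_cscale[OF that frame_derivs(2) cn[OF continuous_fr(1)] n(5) n(1)])
  have F: "H1_deriv (\<lambda>x. cscale (?f x) (u x)) (\<lambda>x. cscale ((-k) *\<^sub>R ?\<rho> x) (u x) + cscale (?f x) (u' x))" if "sH1 u u'" for u u'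
    by (rule H1_deriv_cscale[OF that frame_derivs(3) cn[OF continuous_fr(2)] n(6) n(2)])
  have cF: "H1_deriv (\<lambda>x. cscale (c *\<^sub>R ?f x) (u x)) (\<lambda>x. cscale (c *\<^sub>R (-k) *\<^sub>R ?\<rho> x) (u x) + cscale (c *\<^sub>R ?f x) (u' x))" if "sH1 u u'" for u u'
    by (rule H1_deriv_cscale[OF that sc[OF frame_derivs(3)] cn[OF cn[OF continuous_fr(2)]] n(1) n(4)])
  have cR: "H1_deriv (\<lambda>x. cscale ((-k) *\<^sub>R ?\<rho> x) (u x)) (\<lambda>x. cscale ((-k) *\<^sub>R k *\<^sub>R ?f x) (u x) + cscale ((-k) *\<^sub>R ?\<rho> x) (u' x))" if "sH1 u u'" for u u'
    by (rule H1_deriv_cscale[OF that sc[OF frame_derivs(4)] cn[OF cn[OF continuous_fr(1)]] n(2) n(3)])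
  have 1: "H1_deriv v v'" unfolding v_def[abs_def] v'_def[abs_def] by (intro H1_deriv_add E F h)
  have 2: "H1_deriv v' v''" unfolding v'_def[abs_def] v''_def[abs_def] by (intro H1_deriv_add E F cF cR h)
  have va: "cdot (?e x) (v x) = a x" "cdot (?f x) (v x) = b x" "cdot (sph (k * x) \<theta>) (v x) = 0" for x
    by (simp_all add: v_def cdot_add cdot_cscale frame_inner)
  have w1: "cdot (?e x) (v'' x) = a'' x - of_real \<kappa> * b' x - of_real (c * k * cos \<theta>) * a x" for x
    unfolding v''_def cdot_add cdot_cscale inner_scaleR_right frame_inner inner_rho
    by (simp add: c_def \<kappa>_def algebra_simps)
  have w2: "cdot (?f x) (v'' x) = b'' x + of_real \<kappa> * a' x - of_real (k\<^sup>2) * b x" for x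
    unfolding v''_def cdot_add cdot_cscale inner_scaleR_right frame_inner inner_rho
    by (simp add: c_def \<kappa>_def algebra_simps power2_eq_square)
  have s2: "\<mu> * (sin \<theta>)\<^sup>2 - k\<^sup>2 = S - c * k * cos \<theta>"
    using cos_sq[of \<theta>] unfolding S_def c_def by algebra
  have vt: "v \<in> L2_tangent (\<lambda>x. wavetrain k \<omega> \<theta> x 0)"
    using 1 va by (auto simp: L2_tangent_iff H1_deriv_def)
  have "AE x in lborel. cdot (sph (k * x) \<theta>) (p x) = 0" using p by (simp add: L2_tangent_iff)
  with e have ae: "AE x in lborel. lin_residual \<alpha> \<beta> h \<mu> \<omega> (\<lambda>x. wavetrain k \<omega> \<theta> x 0) x (Re_vec (v x)) (Re_vec (p x)) (Re_vec (v'' x)) = 0 \<and>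
      lin_residual \<alpha> \<beta> h \<mu> \<omega> (\<lambda>x. wavetrain k \<omega> \<theta> x 0) x (Im_vec (v x)) (Im_vec (p x)) (Im_vec (v'' x)) = 0"
  proof eventually_elim
    case (elim x)
    show ?case
      unfolding lin_residual_complex[OF al eq \<omega> va(3) elim(2)] va w1 w2 s2
      using elim(1) by (simp add: p1_def p2_def algebra_simps)
  qed
  show ?thesis
    unfolding lin_graph_def v_def[abs_def, symmetric] using vt p 1 2 ae by blast
qed

lemma wavetrain_spectrum_stable:
  assumes al: "\<alpha> > 0" and eq: "(\<mu> - k\<^sup>2) * cos \<theta> = h - \<beta> / \<alpha>" and \<omega>: "\<omega> = - \<beta> / \<alpha>"
    and S: "(\<mu> - k\<^sup>2) * (sin \<theta>)\<^sup>2 \<ge> (2 * k * cos \<theta>)\<^sup>2" and z: "z \<in> wavetrain_spectrum \<alpha> \<beta> h \<mu> k \<omega> \<theta>"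
  shows "\<not> Re z > 0"
proof
  assume rz: "Re z > 0"
  define n where "n = (\<lambda>x. wavetrain k \<omega> \<theta> x 0)"
  define \<kappa> where "\<kappa> = 2 * k * cos \<theta>"
  define s where "s = (\<mu> - k\<^sup>2) * (sin \<theta>)\<^sup>2"
  obtain K where
    ex: "\<forall>F G. sL2 F \<and> sL2 G \<longrightarrow> (\<exists>a a' a'' b b' b''. sH1 a a' \<and> sH1 a' a'' \<and> sH1 b b' \<and> sH1 b' b'' \<and>
            (\<forall>x. a'' x - complex_of_real \<kappa> * b' x - (s + \<alpha> * z) * a x + z * b x = F x) \<and>
            (\<forall>x. b'' x + complex_of_real \<kappa> * a' x - z * a x - \<alpha> * z * b x = G x))" and
    est: "\<forall>F G a a' a'' b b' b''. sL2 F \<and> sL2 G \<and> sH1 a a' \<and> sH1 a' a'' \<and> sH1 b b' \<and> sH1 b' b'' \<and>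
            (AE x in lborel. a'' x - complex_of_real \<kappa> * b' x - (s + \<alpha> * z) * a x + z * b x = F x) \<and>
            (AE x in lborel. b'' x + complex_of_real \<kappa> * a' x - z * a x - \<alpha> * z * b x = G x) \<longrightarrow>
             nsq a + nsq b \<le> K * (nsq F + nsq G)"
    using second_order_system_invertible[OF al S rz] unfolding \<kappa>_def[symmetric] s_def[symmetric] by (elim exE conjE) (rule that)
  \<comment> \<open>The squared norms of f2 - \<alpha> f1 and f1 + \<alpha> f2 add up to at most 2
    (1 + \<alpha>^2) times those of f1 and f2; the absolute value of \<open>K\<close> keeps the
    radicand nonnegative.\<close>
  define B where "B = sqrt (\<bar>K\<bar> * (2 * (1 + \<alpha>\<^sup>2)))"
  have "z \<in> resolvent_set (L2_tangent n) (lin_graph \<alpha> \<beta> h \<mu> \<omega> n)"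
    unfolding resolvent_set_def
  proof (intro CollectI exI[of _ B] ballI conjI allI impI)
    fix f assume f: "f \<in> L2_tangent n"
    define f1 where "f1 x = cdot (fr_th (k * x) \<theta>) (f x)" for x
    define f2 where "f2 x = cdot (fr_ph (k * x)) (f x)" for x
    have f': "f \<in> L2_fun" using f by (simp add: n_def L2_tangent_iff)
    have s12: "sL2 f1" "sL2 f2" unfolding f1_def f2_def
      by (intro sL2_cdot f' continuous_frame continuous_fr, simp add: norm_fr)+
    \<comment> \<open>The inhomogeneities left after solving the two equations for the second
      derivatives of \<open>a\<close> and \<open>b\<close>.\<close>
    define F where "F x = f2 x + of_real (- \<alpha>) * f1 x" for x
    define G where "G x = (-1) * f1 x + of_real (- \<alpha>) * f2 x" for x
    have sFG: "sL2 F" "sL2 G" unfolding F_def G_def by (intro sL2_add sL2_cmult s12)+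
    show "\<exists>v. (v, \<lambda>x. z *s v x - f x) \<in> lin_graph \<alpha> \<beta> h \<mu> \<omega> n"
    proof -
      obtain a a' a'' b b' b'' where h: "sH1 a a'" "sH1 a' a''" "sH1 b b'" "sH1 b' b''" and
        e: "\<And>x. a'' x - complex_of_real \<kappa> * b' x - (s + \<alpha> * z) * a x + z * b x = F x"
           "\<And>x. b'' x + complex_of_real \<kappa> * a' x - z * a x - \<alpha> * z * b x = G x"
        using ex[rule_format, OF conjI[OF sFG]] by blast
      define v where "v x = cscale (fr_th (k * x) \<theta>) (a x) + cscale (fr_ph (k * x)) (b x)" for x
      have va: "cdot (fr_th (k * x) \<theta>) (v x) = a x" "cdot (fr_ph (k * x)) (v x) = b x" "cdot (sph (k * x) \<theta>) (v x) = 0" for x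
        by (simp_all add: v_def cdot_add cdot_cscale frame_inner)
      have vL: "sL2 (\<lambda>x. v x $ i)" for i
      proof -
        have "H1_deriv v (\<lambda>x. (cscale ((k * cos \<theta>) *\<^sub>R fr_ph (k * x)) (a x) + cscale (fr_th (k * x) \<theta>) (a' x)) + (cscale ((-k) *\<^sub>R fr_rho (k * x)) (b x) + cscale (fr_ph (k * x)) (b' x)))"
          unfolding v_def[abs_def]
          by (intro H1_deriv_add H1_deriv_cscale[where K=1 and K'="\<bar>k * cos \<theta>\<bar>"] H1_deriv_cscale[where K=1 and K'="\<bar>k\<bar>"] h frame_derivs
              continuous_on_scaleR continuous_on_const continuous_fr) (simp_all add: norm_fr)
        thus ?thesis by (simp add: H1_deriv_iff sH1_def)
      qed
      have "(\<lambda>x. cscale (fr_th (k * x) \<theta>) (a x) + cscale (fr_ph (k * x)) (b x), \<lambda>x. z *s v x - f x)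
          \<in> lin_graph \<alpha> \<beta> h \<mu> \<omega> (\<lambda>x. wavetrain k \<omega> \<theta> x 0)"
      proof (rule lin_graph_intro[OF al eq \<omega> _ h])
        have "(\<lambda>x. z *s v x - f x) \<in> L2_fun"
          using f' vL by (auto simp: L2_fun_iff intro!: sL2_diff sL2_cmult)
        moreover have "AE x in lborel. cdot (sph (k * x) \<theta>) (z *s v x - f x) = 0"
          using f by (simp add: n_def L2_tangent_iff cdot_diff cdot_smult va)
        ultimately show "(\<lambda>x. z *s v x - f x) \<in> L2_tangent (\<lambda>x. wavetrain k \<omega> \<theta> x 0)"
          by (simp add: L2_tangent_iff)
        show "AE x in lborel. cdot (fr_th (k * x) \<theta>) (z *s v x - f x) + of_real \<alpha> * cdot (fr_ph (k * x)) (z *s v x - f x) =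
              b'' x + of_real (2 * k * cos \<theta>) * a' x \<and>
            cdot (fr_ph (k * x)) (z *s v x - f x) - of_real \<alpha> * cdot (fr_th (k * x) \<theta>) (z *s v x - f x) =
              - a'' x + of_real (2 * k * cos \<theta>) * b' x + of_real ((\<mu> - k\<^sup>2) * (sin \<theta>)\<^sup>2) * a x"
          unfolding \<kappa>_def[symmetric] s_def[symmetric] cdot_diff cdot_smult va f1_def[symmetric] f2_def[symmetric]
        proof (intro AE_I2 conjI)
          fix x
          show "z * a x - f1 x + of_real \<alpha> * (z * b x - f2 x) = b'' x + of_real \<kappa> * a' x"
            using e(2)[of x] unfolding G_def by (simp add: algebra_simps)
          show "z * b x - f2 x - of_real \<alpha> * (z * a x - f1 x) = - a'' x + of_real \<kappa> * b' x + of_real s * a x"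
            using e(1)[of x] unfolding F_def by (simp add: algebra_simps)
        qed
      qed
      hence "(v, \<lambda>x. z *s v x - f x) \<in> lin_graph \<alpha> \<beta> h \<mu> \<omega> n"
        unfolding n_def by (simp only: v_def[abs_def])
      thus ?thesis by blast
    qed
    fix v assume vG: "(v, \<lambda>x. z *s v x - f x) \<in> lin_graph \<alpha> \<beta> h \<mu> \<omega> n"
    define a where "a x = cdot (fr_th (k * x) \<theta>) (v x)" for x
    define b where "b x = cdot (fr_ph (k * x)) (v x)" for x
    obtain a' a'' b' b'' where h: "sH1 a a'" "sH1 a' a''" "sH1 b b'" "sH1 b' b''" and
     ae: "AE x in lborel. (z * a x - f1 x) + of_real \<alpha> * (z * b x - f2 x) = b'' x + of_real \<kappa> * a' x \<and>
        (z * b x - f2 x) - of_real \<alpha> * (z * a x - f1 x) = - a'' x + of_real \<kappa> * b' x + of_real s * a x"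
      using lin_graph_elim[OF al eq \<omega> vG[unfolded n_def]]
      unfolding \<kappa>_def[symmetric] s_def[symmetric] cdot_diff cdot_smult f1_def[symmetric] f2_def[symmetric]
        a_def[symmetric, abs_def] b_def[symmetric, abs_def] by (elim exE conjE) (rule that)
    have "nsq a + nsq b \<le> K * (nsq F + nsq G)"
    proof (rule est[rule_format, of F G a a' a'' b b' b''], intro conjI sFG h)
      show "AE x in lborel. a'' x - of_real \<kappa> * b' x - (s + \<alpha> * z) * a x + z * b x = F x"
        using ae by eventually_elim (unfold F_def of_real_minus, algebra)
      show "AE x in lborel. b'' x + of_real \<kappa> * a' x - z * a x - \<alpha> * z * b x = G x"
        using ae by eventually_elim (unfold G_def of_real_minus, algebra)
    qed
    also have "\<dots> \<le> \<bar>K\<bar> * (2 * (1 + \<alpha>\<^sup>2) * (nsq f1 + nsq f2))"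
    proof (intro mult_mono)
      have "nsq F \<le> 2 * nsq f2 + 2 * (\<alpha>\<^sup>2 * nsq f1)"
        unfolding F_def using sL2_add(2)[OF s12(2) sL2_cmult[OF s12(1)], of "of_real (- \<alpha>)"] by (simp add: nsq_cmult del: of_real_minus)
      moreover have "nsq G \<le> 2 * nsq f1 + 2 * (\<alpha>\<^sup>2 * nsq f2)"
        unfolding G_def using sL2_add(2)[OF sL2_cmult[OF s12(1)] sL2_cmult[OF s12(2)], of "-1" "of_real (- \<alpha>)"]
        unfolding nsq_cmult by (simp del: of_real_minus)
      ultimately show "nsq F + nsq G \<le> 2 * (1 + \<alpha>\<^sup>2) * (nsq f1 + nsq f2)" by (simp add: algebra_simps)
    qed (auto simp: nsq_nonneg)
    finally have "nsq a + nsq b \<le> B\<^sup>2 * (nsq f1 + nsq f2)" by (simp add: B_def mult.assoc)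
    moreover have "v \<in> L2_tangent n" using vG by (auto simp: lin_graph_def)
    hence "(L2_nrm v)\<^sup>2 = nsq a + nsq b" unfolding n_def a_def[abs_def] b_def[abs_def] by (rule L2_nrm_tangent)
    moreover have "(L2_nrm f)\<^sup>2 = nsq f1 + nsq f2"
      using L2_nrm_tangent[OF f[unfolded n_def]] by (simp add: f1_def[abs_def] f2_def[abs_def])
    ultimately have "(L2_nrm v)\<^sup>2 \<le> (B * L2_nrm f)\<^sup>2" by (simp add: power_mult_distrib)
    moreover have "0 \<le> B * L2_nrm f" by (auto simp: B_def L2_nrm_def intro!: mult_nonneg_nonneg integral_nonneg_AE)
    ultimately show "L2_nrm v \<le> B * L2_nrm f" by (rule power2_le_imp_le)
  qed
  thus False using z by (simp add: wavetrain_spectrum_def Let_def n_def)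
qed

section \<open>Instability by approximate eigenfunctions\<close>

text \<open>The product of the roots is d / P < 0, so one root is a negative multiple of the
  conjugate of the other and their real parts have opposite signs. If neither were positive, both
  would vanish, but the sum of the roots has real part - \<tau> / P.\<close>

lemma quadratic_unstable_root:
  fixes P d \<tau> \<sigma> :: real
  assumes P: "P > 0" and d: "d < 0" and \<tau>: "\<tau> \<noteq> 0"
  shows "\<exists>z::complex. P * z\<^sup>2 + (\<tau> - \<i> * \<sigma>) * z + d = 0 \<and> Re z > 0"
proof -
  define B where "B = complex_of_real \<tau> - \<i> * \<sigma>"
  define w where "w = csqrt (B\<^sup>2 - 4 * P * d)"
  define z1 where "z1 = (- B + w) / (2 * P)"
  define z2 where "z2 = (- B - w) / (2 * P)"
  have w2: "w\<^sup>2 = B\<^sup>2 - 4 * P * d" by (simp add: w_def)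
  have P0: "complex_of_real P \<noteq> 0" using P by simp
  have sum: "z1 + z2 = - B / P" using P0 by (simp add: z1_def z2_def field_simps)
  have prod: "P * (z1 * z2) = d"
  proof -
    have "z1 * z2 = (B\<^sup>2 - w\<^sup>2) / (4 * P * P)"
      using P0 by (simp add: z1_def z2_def field_simps power2_eq_square)
    thus ?thesis unfolding w2 using P0 by simp
  qed
  have root: "P * z\<^sup>2 + B * z + d = 0" if "z = z1 \<or> z = z2" for z :: complex
  proof -
    have "P * (z - z1) * (z - z2) = 0" using that by auto
    moreover have "P * (z - z1) * (z - z2) = P * z\<^sup>2 - P * (z1 + z2) * z + P * (z1 * z2)"
      by (simp add: algebra_simps power2_eq_square)
    ultimately show ?thesis unfolding sum prod using P0 by simp
  qed
  have "Re z1 > 0 \<or> Re z2 > 0"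
  proof (rule ccontr)
    assume "\<not> ?thesis"
    hence le: "Re z1 \<le> 0" "Re z2 \<le> 0" by auto
    have z1: "z1 \<noteq> 0" using prod d P0 by auto
    have "P * (cmod z1)\<^sup>2 * z2 = cnj z1 * (P * (z1 * z2))"
      using complex_norm_square[of z1] by (simp add: algebra_simps)
    also have "\<dots> = d * cnj z1" by (simp add: prod)
    finally have "Re (P * (cmod z1)\<^sup>2 * z2) = Re (d * cnj z1)" by simp
    hence "P * (cmod z1)\<^sup>2 * Re z2 = d * Re z1" by simp
    moreover have "P * (cmod z1)\<^sup>2 * Re z2 \<le> 0" "d * Re z1 \<ge> 0"
      using le P d by (auto intro: mult_nonneg_nonpos mult_nonpos_nonpos)
    ultimately have "d * Re z1 = 0" "P * (cmod z1)\<^sup>2 * Re z2 = 0" by auto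
    hence "Re z1 = 0" "Re z2 = 0" using d P z1 by auto
    moreover have "Re (P * (z1 + z2)) = Re (- B)" unfolding sum using P0 by simp
    ultimately show False using \<tau> by (simp add: B_def)
  qed
  thus ?thesis using root unfolding B_def by blast
qed

text \<open>The envelope of the modulated plane waves is \<open>1 / (1 + \<epsilon>\<^sup>2 x\<^sup>2)\<close>: its derivatives are bounded pointwise
  by a multiple of \<open>\<epsilon>\<close> times itself, so no norms need to be computed.\<close>

lemma lorentz_profile:
  fixes \<epsilon> l :: real
  assumes \<epsilon>: "0 < \<epsilon>" "\<epsilon> \<le> 1"
  shows "\<exists>u d1 d2. sH1 u (\<lambda>x. \<i> * l * u x + d1 x) \<and>
     sH1 (\<lambda>x. \<i> * l * u x + d1 x) (\<lambda>x. (\<i> * l)\<^sup>2 * u x + 2 * \<i> * l * d1 x + d2 x) \<and>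
     sL2 d1 \<and> sL2 d2 \<and> nsq u > 0 \<and>
     (\<forall>x. cmod (d1 x) \<le> 6 * \<epsilon> * cmod (u x)) \<and> (\<forall>x. cmod (d2 x) \<le> 6 * \<epsilon> * cmod (u x))"
proof -
  define D where "D x = 1 + \<epsilon>\<^sup>2 * x\<^sup>2" for x :: real
  have D: "D x > 0" "D x \<ge> 1" for x by (auto simp: D_def add_pos_nonneg)
  hence D0: "D x \<noteq> 0" for x by (metis less_irrefl)
  have dD: "(D has_real_derivative 2 * \<epsilon>\<^sup>2 * x) (at x)" for x
    unfolding D_def[abs_def] by (auto intro!: derivative_eq_intros)
  define f0 where "f0 x = 1 / D x" for x
  define f1 where "f1 x = - (2 * \<epsilon>\<^sup>2 * x) / (D x)\<^sup>2" for x
  define f2 where "f2 x = (6 * \<epsilon> ^ 4 * x\<^sup>2 - 2 * \<epsilon>\<^sup>2) / (D x) ^ 3" for x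
  have d0: "(f0 has_real_derivative f1 x) (at x)" for x
    unfolding f0_def[abs_def] f1_def
    by (rule DERIV_cong[OF DERIV_divide[OF DERIV_const dD]]) (use D0 in \<open>auto simp: power2_eq_square\<close>)
  have d1: "(f1 has_real_derivative f2 x) (at x)" for x
  proof -
    have "((\<lambda>x. - (2 * \<epsilon>\<^sup>2 * x)) has_real_derivative - (2 * \<epsilon>\<^sup>2)) (at x)" by (auto intro!: derivative_eq_intros)
    moreover have "((\<lambda>x. (D x)\<^sup>2) has_real_derivative 2 * D x * (2 * \<epsilon>\<^sup>2 * x)) (at x)"
      using dD[of x] by (auto intro!: derivative_eq_intros)
    ultimately have "(f1 has_real_derivative (- (2 * \<epsilon>\<^sup>2) * (D x)\<^sup>2 - - (2 * \<epsilon>\<^sup>2 * x) * (2 * D x * (2 * \<epsilon>\<^sup>2 * x))) / ((D x)\<^sup>2 * (D x)\<^sup>2)) (at x)"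
      unfolding f1_def[abs_def] by (rule DERIV_divide) (use D0 in auto)
    moreover have "(- (2 * \<epsilon>\<^sup>2) * (D x)\<^sup>2 - - (2 * \<epsilon>\<^sup>2 * x) * (2 * D x * (2 * \<epsilon>\<^sup>2 * x))) / ((D x)\<^sup>2 * (D x)\<^sup>2) = f2 x"
    proof -
      have "- (2 * \<epsilon>\<^sup>2) * (D x)\<^sup>2 - - (2 * \<epsilon>\<^sup>2 * x) * (2 * D x * (2 * \<epsilon>\<^sup>2 * x)) = D x * (6 * \<epsilon> ^ 4 * x\<^sup>2 - 2 * \<epsilon>\<^sup>2)"
        by (simp add: D_def algebra_simps power2_eq_square power4_eq_xxxx)
      thus ?thesis using D0[of x] by (simp add: f2_def power2_eq_square power3_eq_cube)
    qed
    ultimately show ?thesis by simp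
  qed
  have b1: "\<bar>f1 x\<bar> \<le> \<epsilon> * f0 x" for x
  proof -
    have "2 * (\<epsilon> * \<bar>x\<bar>) \<le> D x"
      using zero_le_power2[of "\<epsilon> * \<bar>x\<bar> - 1"] by (simp add: D_def power2_eq_square algebra_simps)
    hence "\<epsilon> * (2 * (\<epsilon> * \<bar>x\<bar>)) \<le> \<epsilon> * D x" using \<epsilon> by (intro mult_left_mono) auto
    thus ?thesis using \<epsilon> D[of x] by (simp add: f1_def f0_def abs_mult divide_simps power2_eq_square mult_ac)
  qed
  have b2: "\<bar>f2 x\<bar> \<le> 6 * \<epsilon> * f0 x" for x
  proof -
    have "\<bar>6 * \<epsilon> ^ 4 * x\<^sup>2 - 2 * \<epsilon>\<^sup>2\<bar> \<le> 6 * \<epsilon>\<^sup>2 * D x"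
    proof -
      have "6 * \<epsilon> ^ 4 * x\<^sup>2 = 6 * (\<epsilon>\<^sup>2 * (\<epsilon>\<^sup>2 * x\<^sup>2))" "6 * \<epsilon>\<^sup>2 * D x = 6 * \<epsilon>\<^sup>2 + 6 * (\<epsilon>\<^sup>2 * (\<epsilon>\<^sup>2 * x\<^sup>2))"
        by (simp_all add: D_def algebra_simps power4_eq_xxxx power2_eq_square)
      moreover have "0 \<le> \<epsilon>\<^sup>2 * (\<epsilon>\<^sup>2 * x\<^sup>2)" "0 \<le> \<epsilon>\<^sup>2" by auto
      ultimately show ?thesis by linarith
    qed
    also have "\<dots> \<le> 6 * \<epsilon> * D x * D x"
    proof -
      have "\<epsilon> * \<epsilon> \<le> \<epsilon> * D x" using \<epsilon> D(2)[of x] by (intro mult_left_mono) auto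
      hence "\<epsilon> * \<epsilon> * D x \<le> \<epsilon> * D x * D x" using D(1)[of x] by (intro mult_right_mono) auto
      thus ?thesis by (simp add: power2_eq_square)
    qed
    finally have le: "\<bar>6 * \<epsilon> ^ 4 * x\<^sup>2 - 2 * \<epsilon>\<^sup>2\<bar> \<le> 6 * \<epsilon> * D x * D x" .
    have "\<bar>f2 x\<bar> = \<bar>6 * \<epsilon> ^ 4 * x\<^sup>2 - 2 * \<epsilon>\<^sup>2\<bar> / (D x) ^ 3"
      using D[of x] by (simp add: f2_def)
    also have "\<dots> \<le> (6 * \<epsilon> * D x * D x) / (D x) ^ 3"
      using D[of x] by (intro divide_right_mono le) auto
    also have "\<dots> = 6 * \<epsilon> * f0 x" using D0[of x] by (simp add: f0_def power3_eq_cube)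
    finally show ?thesis .
  qed
  have f0: "0 < f0 x" "f0 x \<le> 1" for x using D[of x] by (auto simp: f0_def)
  have c0: "continuous_on UNIV f0" using d0 by (meson DERIV_isCont continuous_at_imp_continuous_on)
  have c1: "continuous_on UNIV f1" using d1 by (meson DERIV_isCont continuous_at_imp_continuous_on)
  have c2: "continuous_on UNIV f2" unfolding f2_def[abs_def] D_def[abs_def]
    by (intro continuous_intros) (use D0 in \<open>auto simp: D_def\<close>)
  have [measurable]: "f0 \<in> borel_measurable borel" "f1 \<in> borel_measurable borel" "f2 \<in> borel_measurable borel"
    using c0 c1 c2 by (auto intro: borel_measurable_continuous_onI)
  have "integrable lborel f0"
  proof (rule integrable_of_bounded_truncations(1))
    fix n :: nat
    show "set_integrable lborel {-real n..real n} f0"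
      by (intro borel_integrable_atLeastAtMost' continuous_on_subset[OF c0]) auto
    have "((\<lambda>x. f0 x) has_integral (arctan (\<epsilon> * n) / \<epsilon> - arctan (\<epsilon> * (- real n)) / \<epsilon>)) {-real n..real n}"
    proof (rule fundamental_theorem_of_calculus)
      fix x
      show "((\<lambda>x. arctan (\<epsilon> * x) / \<epsilon>) has_vector_derivative f0 x) (at x within {-real n..real n})"
      proof -
        have "((\<lambda>x. arctan (\<epsilon> * x) / \<epsilon>) has_real_derivative (inverse (1 + (\<epsilon> * x)\<^sup>2) * \<epsilon>) / \<epsilon>) (at x)"
          by (intro DERIV_cdivide DERIV_chain2[OF DERIV_arctan] DERIV_cmult_Id)
        moreover have "(inverse (1 + (\<epsilon> * x)\<^sup>2) * \<epsilon>) / \<epsilon> = f0 x"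
          using \<epsilon> by (simp add: f0_def D_def power_mult_distrib inverse_eq_divide)
        ultimately show ?thesis
          by (simp add: has_vector_derivative_at_within has_real_derivative_iff_has_vector_derivative)
      qed
    qed simp
    hence "integral {-real n..real n} f0 = arctan (\<epsilon> * n) / \<epsilon> - arctan (\<epsilon> * (- real n)) / \<epsilon>" by (rule integral_unique)
    also have "\<dots> = 2 * arctan (\<epsilon> * n) / \<epsilon>" by (simp add: arctan_minus)
    also have "\<dots> \<le> pi / \<epsilon>" using arctan_ubound[of "\<epsilon> * n"] \<epsilon> by (intro divide_right_mono) auto
    finally have "integral {-real n..real n} f0 \<le> pi / \<epsilon>" .
    moreover have "set_integrable lborel {-real n..real n} f0"
      by (intro borel_integrable_atLeastAtMost' continuous_on_subset[OF c0]) auto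
    ultimately show "(LINT x:{-real n..real n}|lborel. f0 x) \<le> pi / \<epsilon>"
      by (simp add: set_borel_integral_eq_integral)
  qed (use f0 in \<open>auto intro: less_imp_le\<close>)
  hence i2: "integrable lborel (\<lambda>x. (f0 x)\<^sup>2)"
  proof (rule Bochner_Integration.integrable_bound)
    show "AE x in lborel. norm ((f0 x)\<^sup>2) \<le> norm (f0 x)"
      using f0 by (intro AE_I2) (simp add: power2_eq_square abs_mult less_imp_le mult_left_le_one_le)
  qed measurable
  define E where "E x = exp (\<i> * of_real (l * x))" for x :: real
  have nE: "cmod (E x) = 1" for x unfolding E_def by (rule norm_exp_i_times)
  have dE: "(E has_vector_derivative \<i> * l * E x) (at x)" for x
  proof -
    have "((\<lambda>z. exp (\<i> * l * z)) has_field_derivative \<i> * l * E x) (at (of_real x))"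
      by (auto intro!: derivative_eq_intros simp: E_def algebra_simps)
    from has_vector_derivative_real_field[OF this] show ?thesis by (simp add: E_def[abs_def] mult.assoc)
  qed
  have cE: "continuous_on UNIV E" using dE by (meson continuous_at_imp_continuous_on has_vector_derivative_continuous)
  hence [measurable]: "E \<in> borel_measurable borel" by (rule borel_measurable_continuous_onI)
  define u where "u x = of_real (f0 x) * E x" for x
  define g1 where "g1 x = of_real (f1 x) * E x" for x
  define g2 where "g2 x = of_real (f2 x) * E x" for x
  have cu: "cmod (u x) = f0 x" for x using f0[of x] by (simp add: u_def norm_mult nE)
  have e1: "cmod (g1 x) \<le> 6 * \<epsilon> * cmod (u x)" for x
    using b1[of x] f0[of x] \<epsilon> unfolding cu by (simp add: g1_def norm_mult nE)
  have e2: "cmod (g2 x) \<le> 6 * \<epsilon> * cmod (u x)" for x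
    using b2[of x] unfolding cu by (simp add: g2_def norm_mult nE)
  have su: "sL2 u"
    unfolding sL2_def cu using i2 by (simp add: u_def[abs_def])
  have s1: "sL2 g1" "sL2 g2"
    by (rule sL2_bound(1)[OF su _ AE_I2[OF e1]] sL2_bound(1)[OF su _ AE_I2[OF e2]], simp add: g1_def[abs_def] g2_def[abs_def])+
  have a1: "ac_deriv u (\<lambda>x. \<i> * l * u x + g1 x)"
  proof (rule ac_deriv_C1)
    show "(u has_vector_derivative \<i> * l * u x + g1 x) (at x)" for x
      unfolding u_def[abs_def] g1_def
      using has_vector_derivative_mult[OF has_vector_derivative_of_real[OF d0[of x]] dE[of x]] by (simp add: algebra_simps)
    show "continuous_on UNIV (\<lambda>x. \<i> * l * u x + g1 x)"
      unfolding u_def[abs_def] g1_def[abs_def] by (intro continuous_intros c0 c1 cE)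
  qed
  have "ac_deriv g1 (\<lambda>x. \<i> * l * g1 x + g2 x)"
  proof (rule ac_deriv_C1)
    show "(g1 has_vector_derivative \<i> * l * g1 x + g2 x) (at x)" for x
      unfolding g1_def[abs_def] g2_def
      using has_vector_derivative_mult[OF has_vector_derivative_of_real[OF d1[of x]] dE[of x]] by (simp add: algebra_simps)
    show "continuous_on UNIV (\<lambda>x. \<i> * l * g1 x + g2 x)"
      unfolding g1_def[abs_def] g2_def[abs_def] by (intro continuous_intros c1 c2 cE)
  qed
  hence h1: "sH1 g1 (\<lambda>x. \<i> * l * g1 x + g2 x)" by (simp add: sH1_def s1 sL2_add sL2_cmult)
  have h0: "sH1 u (\<lambda>x. \<i> * l * u x + g1 x)" using a1 by (simp add: sH1_def su s1 sL2_add sL2_cmult)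
  have "sH1 (\<lambda>x. \<i> * l * u x + g1 x) (\<lambda>x. (\<i> * l)\<^sup>2 * u x + 2 * \<i> * l * g1 x + g2 x)"
    using sH1_add[OF sH1_cmult[OF h0, of "\<i> * l"] h1] by (simp add: algebra_simps power2_eq_square)
  moreover have "nsq u > 0"
  proof -
    have "nsq u \<noteq> 0"
    proof
      assume "nsq u = 0"
      hence "AE x in lborel. (cmod (u x))\<^sup>2 = 0"
        unfolding nsq_def using su by (subst (asm) integral_nonneg_eq_0_iff_AE) (auto simp: sL2_def)
      hence "AE x in lborel. u x = 0" by simp
      from continuous_AE_zero[OF ac_deriv_continuous[OF a1] this, of 0] show False
        using cu[of 0] f0[of 0] by simp
    qed
    thus ?thesis using nsq_nonneg[of u] by simp
  qed
  ultimately show ?thesis using h0 s1 e1 e2 by blast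
qed

text \<open>A vector in the kernel of the symbol at wave number l, times a slowly varying envelope,
  is an eigenfunction up to a relative error of order \<epsilon>. Hence no resolvent bound can hold
  at the corresponding \<open>z\<close>.\<close>

lemma wavetrain_spectrum_unstable:
  assumes al: "\<alpha> > 0" and eq: "(\<mu> - k\<^sup>2) * cos \<theta> = h - \<beta> / \<alpha>" and \<omega>: "\<omega> = - \<beta> / \<alpha>"
    and S: "(\<mu> - k\<^sup>2) * (sin \<theta>)\<^sup>2 < (2 * k * cos \<theta>)\<^sup>2"
  shows "\<exists>z \<in> wavetrain_spectrum \<alpha> \<beta> h \<mu> k \<omega> \<theta>. Re z > 0"
proof -
  define \<kappa> where "\<kappa> = 2 * k * cos \<theta>"
  define s where "s = (\<mu> - k\<^sup>2) * (sin \<theta>)\<^sup>2"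
  define m where "m = \<kappa>\<^sup>2 - s"
  have g: "m > 0" using S by (simp add: m_def \<kappa>_def s_def)
  \<comment> \<open>Here t stands for l^2. It must lie below \<kappa>^2 - s, so that the constant
    term is negative, and avoid the one value where \<tau> vanishes. The choice m / 2 does so unless
    m + s = 0, and then m / 3 does.\<close>
  obtain t where t: "0 < t" "t < m" "2 * t + s \<noteq> 0"
  proof (cases "m + s = 0")
    case True
    thus thesis using g by (intro that[of "m / 3"]) auto
  next
    case False
    thus thesis using g by (intro that[of "m / 2"]) auto
  qed
  define l where "l = sqrt t"
  have l2: "l\<^sup>2 = t" using t by (simp add: l_def)
  define d where "d = l\<^sup>2 * (l\<^sup>2 + s - \<kappa>\<^sup>2)"
  define \<tau> where "\<tau> = \<alpha> * (2 * l\<^sup>2 + s)"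
  define \<sigma> where "\<sigma> = 2 * \<kappa> * l"
  have "d < 0" unfolding d_def l2 using t by (intro mult_pos_neg) (auto simp: m_def)
  moreover have "\<tau> \<noteq> 0" unfolding \<tau>_def l2 using t al by auto
  ultimately obtain z :: complex where z: "(1 + \<alpha>\<^sup>2) * z\<^sup>2 + (\<tau> - \<i> * \<sigma>) * z + d = 0" and rz: "Re z > 0"
    using quadratic_unstable_root[of "1 + \<alpha>\<^sup>2" d \<tau> \<sigma>] by (auto simp: add_pos_nonneg)
  define n where "n = (\<lambda>x. wavetrain k \<omega> \<theta> x 0)"
  \<comment> \<open>The first row of the symbol annihilates (A, B) for every \<open>z\<close>; for
    the second row this is the dispersion relation.\<close>
  define A where "A = z - \<i> * \<kappa> * l"
  define B where "B = l\<^sup>2 + s + \<alpha> * z"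
  have A0: "A \<noteq> 0"
  proof
    assume "A = 0"
    hence "z = \<i> * \<kappa> * l" by (simp add: A_def)
    thus False using rz by simp
  qed
  have det: "A * A + (l\<^sup>2 + \<alpha> * z) * B = 0"
    using z unfolding A_def B_def d_def \<tau>_def \<sigma>_def by (simp add: algebra_simps power2_eq_square)
  have "z \<notin> resolvent_set (L2_tangent n) (lin_graph \<alpha> \<beta> h \<mu> \<omega> n)"
  proof
    assume "z \<in> resolvent_set (L2_tangent n) (lin_graph \<alpha> \<beta> h \<mu> \<omega> n)"
    then obtain R where R: "\<And>f v. f \<in> L2_tangent n \<Longrightarrow> (v, \<lambda>x. z *s v x - f x) \<in> lin_graph \<alpha> \<beta> h \<mu> \<omega> n \<Longrightarrow> L2_nrm v \<le> R * L2_nrm f"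
      unfolding resolvent_set_def by blast
    define a1 where "a1 = 1 + \<alpha>\<^sup>2"
    have a1: "a1 > 0" by (simp add: a1_def add_pos_nonneg)
    define M0 where "M0 = cmod A * (1 + 2 * \<bar>l\<bar>) + \<bar>\<kappa>\<bar> * cmod B + cmod B * (1 + 2 * \<bar>l\<bar>) + \<bar>\<kappa>\<bar> * cmod A"
    define M where "M = M0 * (1 + \<bar>\<alpha>\<bar>) * 6"
    have main: "(cmod A)\<^sup>2 \<le> R\<^sup>2 * (2 * (M * \<epsilon>)\<^sup>2)" if \<epsilon>: "0 < \<epsilon>" "\<epsilon> \<le> 1" for \<epsilon>
    proof -
      obtain u d1 d2 where u: "sH1 u (\<lambda>x. \<i> * l * u x + d1 x)"
         "sH1 (\<lambda>x. \<i> * l * u x + d1 x) (\<lambda>x. (\<i> * l)\<^sup>2 * u x + 2 * \<i> * l * d1 x + d2 x)"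
         "sL2 d1" "sL2 d2" "nsq u > 0" and b: "\<And>x. cmod (d1 x) \<le> 6 * \<epsilon> * cmod (u x)" "\<And>x. cmod (d2 x) \<le> 6 * \<epsilon> * cmod (u x)"
        using lorentz_profile[OF \<epsilon>, of l] by blast
      define u1 where "u1 x = \<i> * l * u x + d1 x" for x
      define u2 where "u2 x = (\<i> * l)\<^sup>2 * u x + 2 * \<i> * l * d1 x + d2 x" for x
      have h: "sH1 u u1" "sH1 u1 u2" using u(1,2) unfolding u1_def[abs_def] u2_def[abs_def] by simp_all
      \<comment> \<open>Since the symbol annihilates (A, B), only terms with derivatives of the
        envelope remain.\<close>
      define F where "F x = A * (d2 x + 2 * \<i> * l * d1 x) - \<kappa> * B * d1 x" for x
      define G where "G x = B * (d2 x + 2 * \<i> * l * d1 x) + \<kappa> * A * d1 x" for x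
      have eF: "A * u2 x - \<kappa> * (B * u1 x) - (s + \<alpha> * z) * (A * u x) + z * (B * u x) = F x" for x
        unfolding u1_def u2_def F_def A_def B_def by (simp add: algebra_simps power2_eq_square)
      have eG: "B * u2 x + \<kappa> * (A * u1 x) - z * (A * u x) - \<alpha> * z * (B * u x) = G x" for x
      proof -
        have "B * u2 x + \<kappa> * (A * u1 x) - z * (A * u x) - \<alpha> * z * (B * u x) = G x - (A * A + (l\<^sup>2 + \<alpha> * z) * B) * u x"
          unfolding u1_def u2_def G_def A_def by (simp add: algebra_simps power2_eq_square)
        thus ?thesis unfolding det by simp
      qed
      \<comment> \<open>The inverse of the system \<open>F = f2 - \<alpha> * f1\<close>,
        \<open>G = - (f1 + \<alpha> * f2)\<close>, whose determinant is 1 + \<alpha>^2.\<close>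
      define f1 where "f1 x = - (\<alpha> * F x + G x) / a1" for x
      define f2 where "f2 x = (F x - \<alpha> * G x) / a1" for x
      have a1c: "complex_of_real a1 \<noteq> 0" "complex_of_real a1 = 1 + \<alpha> * \<alpha>" using a1 by (simp, simp add: a1_def power2_eq_square)
      have fF: "f2 x - \<alpha> * f1 x = F x" for x
      proof -
        have "f2 x - \<alpha> * f1 x = ((1 + \<alpha> * \<alpha>) * F x) / a1"
          using a1c(1) by (simp add: f1_def f2_def field_simps)
        thus ?thesis using a1c by simp
      qed
      have fG: "- (f1 x + \<alpha> * f2 x) = G x" for x
      proof -
        have "- (f1 x + \<alpha> * f2 x) = ((1 + \<alpha> * \<alpha>) * G x) / a1"
          using a1c(1) by (simp add: f1_def f2_def field_simps)
        thus ?thesis using a1c by simp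
      qed
      have sd: "sL2 F" "sL2 G" unfolding F_def[abs_def] G_def[abs_def]
        by (intro sL2_diff sL2_add sL2_cmult u(3,4))+
      have sf: "sL2 f1" "sL2 f2"
      proof -
        have "f1 = (\<lambda>x. (-1 / a1) * (\<alpha> * F x + G x))" "f2 = (\<lambda>x. (1 / a1) * (F x - \<alpha> * G x))"
          by (auto simp: fun_eq_iff f1_def f2_def divide_inverse algebra_simps)
        thus "sL2 f1" "sL2 f2" by (auto simp only: intro!: sL2_cmult sL2_add sL2_diff sd)
      qed
      have bF: "cmod (F x) \<le> (cmod A * (1 + 2 * \<bar>l\<bar>) + \<bar>\<kappa>\<bar> * cmod B) * (6 * \<epsilon> * cmod (u x))"
        and bG: "cmod (G x) \<le> (cmod B * (1 + 2 * \<bar>l\<bar>) + \<bar>\<kappa>\<bar> * cmod A) * (6 * \<epsilon> * cmod (u x))" for x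
      proof -
        define q where "q = 6 * \<epsilon> * cmod (u x)"
        have "cmod (d2 x + 2 * \<i> * l * d1 x) \<le> cmod (d2 x) + cmod (2 * \<i> * l * d1 x)" by (rule norm_triangle_ineq)
        also have "\<dots> = cmod (d2 x) + 2 * \<bar>l\<bar> * cmod (d1 x)" by (simp add: norm_mult)
        also have "\<dots> \<le> q + 2 * \<bar>l\<bar> * q" using b unfolding q_def by (intro add_mono mult_left_mono) auto
        finally have 1: "cmod (d2 x + 2 * \<i> * l * d1 x) \<le> (1 + 2 * \<bar>l\<bar>) * q" by (simp add: algebra_simps)
        have 2: "cmod (d1 x) \<le> q" using b by (simp add: q_def)
        have "cmod (F x) \<le> cmod (A * (d2 x + 2 * \<i> * l * d1 x)) + cmod (\<kappa> * B * d1 x)" unfolding F_def by (rule norm_triangle_ineq4)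
        also have "\<dots> = cmod A * cmod (d2 x + 2 * \<i> * l * d1 x) + \<bar>\<kappa>\<bar> * cmod B * cmod (d1 x)" by (simp add: norm_mult)
        also have "\<dots> \<le> cmod A * ((1 + 2 * \<bar>l\<bar>) * q) + \<bar>\<kappa>\<bar> * cmod B * q" using 1 2 by (intro add_mono mult_left_mono) auto
        finally show "cmod (F x) \<le> (cmod A * (1 + 2 * \<bar>l\<bar>) + \<bar>\<kappa>\<bar> * cmod B) * (6 * \<epsilon> * cmod (u x))"
          unfolding q_def[symmetric] by (simp add: algebra_simps)
        have "cmod (G x) \<le> cmod (B * (d2 x + 2 * \<i> * l * d1 x)) + cmod (\<kappa> * A * d1 x)" unfolding G_def by (rule norm_triangle_ineq)
        also have "\<dots> = cmod B * cmod (d2 x + 2 * \<i> * l * d1 x) + \<bar>\<kappa>\<bar> * cmod A * cmod (d1 x)" by (simp add: norm_mult)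
        also have "\<dots> \<le> cmod B * ((1 + 2 * \<bar>l\<bar>) * q) + \<bar>\<kappa>\<bar> * cmod A * q" using 1 2 by (intro add_mono mult_left_mono) auto
        finally show "cmod (G x) \<le> (cmod B * (1 + 2 * \<bar>l\<bar>) + \<bar>\<kappa>\<bar> * cmod A) * (6 * \<epsilon> * cmod (u x))"
          unfolding q_def[symmetric] by (simp add: algebra_simps)
      qed
      have FG: "cmod (F x) + cmod (G x) \<le> M0 * (6 * \<epsilon> * cmod (u x))" for x
        using bF[of x] bG[of x] unfolding M0_def by (simp add: algebra_simps)
      have comb: "cmod w \<le> M * \<epsilon> * cmod (u x)" if "cmod (a1 * w) \<le> (1 + \<bar>\<alpha>\<bar>) * (cmod (F x) + cmod (G x))" for w :: complex and x
      proof -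
        have "cmod w \<le> a1 * cmod w" by (simp add: a1_def mult_le_cancel_right1)
        also have "\<dots> = cmod (a1 * w)" using a1 by (simp add: norm_mult)
        also have "\<dots> \<le> (1 + \<bar>\<alpha>\<bar>) * (M0 * (6 * \<epsilon> * cmod (u x)))"
          by (rule order_trans[OF that]) (intro mult_left_mono FG, simp)
        finally show ?thesis by (simp add: M_def mult_ac)
      qed
      have w: "\<bar>\<alpha>\<bar> * cmod y \<le> (1 + \<bar>\<alpha>\<bar>) * cmod y \<and> cmod y \<le> (1 + \<bar>\<alpha>\<bar>) * cmod y" for y
        by (simp add: distrib_right)
      have bf1: "cmod (f1 x) \<le> M * \<epsilon> * cmod (u x)" for x
      proof (rule comb)
        have "a1 * f1 x = - (\<alpha> * F x + G x)" using a1c(1) by (simp add: f1_def)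
        hence "cmod (a1 * f1 x) = cmod (\<alpha> * F x + G x)" by (simp only: norm_minus_cancel)
        also have "\<dots> \<le> \<bar>\<alpha>\<bar> * cmod (F x) + cmod (G x)" using norm_triangle_ineq[of "\<alpha> * F x" "G x"] by (simp add: norm_mult)
        finally show "cmod (a1 * f1 x) \<le> (1 + \<bar>\<alpha>\<bar>) * (cmod (F x) + cmod (G x))"
          using w[of "F x"] w[of "G x"] unfolding distrib_left by linarith
      qed
      have bf2: "cmod (f2 x) \<le> M * \<epsilon> * cmod (u x)" for x
      proof (rule comb)
        have "cmod (a1 * f2 x) = cmod (F x - \<alpha> * G x)" using a1c(1) by (simp add: f2_def)
        also have "\<dots> \<le> cmod (F x) + \<bar>\<alpha>\<bar> * cmod (G x)" using norm_triangle_ineq4[of "F x" "\<alpha> * G x"] by (simp add: norm_mult)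
        finally show "cmod (a1 * f2 x) \<le> (1 + \<bar>\<alpha>\<bar>) * (cmod (F x) + cmod (G x))"
          using w[of "F x"] w[of "G x"] unfolding distrib_left by linarith
      qed
      have su: "sL2 u" using h by (simp add: sH1_def)
      have nf: "nsq f1 \<le> (M * \<epsilon>)\<^sup>2 * nsq u" "nsq f2 \<le> (M * \<epsilon>)\<^sup>2 * nsq u"
        using sL2_bound(2)[OF su sL2_measurable[OF sf(1)] AE_I2[OF bf1]] sL2_bound(2)[OF su sL2_measurable[OF sf(2)] AE_I2[OF bf2]] by auto
      define v where "v x = cscale (fr_th (k * x) \<theta>) (A * u x) + cscale (fr_ph (k * x)) (B * u x)" for x
      define f where "f x = cscale (fr_th (k * x) \<theta>) (f1 x) + cscale (fr_ph (k * x)) (f2 x)" for x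
      have va: "cdot (fr_th (k * x) \<theta>) (v x) = A * u x" "cdot (fr_ph (k * x)) (v x) = B * u x" "cdot (sph (k * x) \<theta>) (v x) = 0" for x
        by (simp_all add: v_def cdot_add cdot_cscale frame_inner)
      have fa: "cdot (fr_th (k * x) \<theta>) (f x) = f1 x" "cdot (fr_ph (k * x)) (f x) = f2 x" "cdot (sph (k * x) \<theta>) (f x) = 0" for x
        by (simp_all add: f_def cdot_add cdot_cscale frame_inner)
      have L: "(\<lambda>x. cscale (fr_th (k * x) \<theta>) (p x) + cscale (fr_ph (k * x)) (q x)) \<in> L2_fun" if p: "sL2 p" and q: "sL2 q" for p q
      proof -
        have ce: "continuous_on UNIV (\<lambda>x. e x $ i)" if "continuous_on UNIV e" for e :: "real \<Rightarrow> real^3" and i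
          using that by (intro continuous_intros)
        have c: "sL2 (\<lambda>x. of_real (e x $ i) * w x)" if w: "sL2 w" and e: "continuous_on UNIV e" "\<And>x. norm (e x) = 1" for w i and e :: "real \<Rightarrow> real^3"
        proof (rule sL2_bound(1)[OF w, of _ 1])
          have [measurable]: "(\<lambda>x. e x $ i) \<in> borel_measurable borel" by (intro borel_measurable_continuous_onI ce e)
          note [measurable] = w
          show "(\<lambda>x. complex_of_real (e x $ i) * w x) \<in> borel_measurable borel" by measurable
          have "\<bar>e x $ i\<bar> \<le> 1" for x using component_le_norm_cart[of "e x" i] e(2)[of x] by simp
          thus "AE x in lborel. cmod (complex_of_real (e x $ i) * w x) \<le> 1 * cmod (w x)"
            by (intro AE_I2) (simp add: norm_mult mult_left_le_one_le)
        qed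
        show ?thesis
          unfolding L2_fun_iff cscale_def vector_add_component vec_lambda_beta
          by (intro allI sL2_add c p q continuous_frame continuous_fr) (simp_all add: norm_fr)
      qed
      have fL: "f \<in> L2_tangent n" unfolding n_def L2_tangent_iff f_def[abs_def]
        using L[OF sf] fa(3) by (simp add: f_def)
      have sAB: "sL2 (\<lambda>x. A * u x)" "sL2 (\<lambda>x. B * u x)" by (intro sL2_cmult su)+
      have vL: "v \<in> L2_tangent n" unfolding n_def L2_tangent_iff v_def[abs_def]
        using L[OF sAB] va(3) by (simp add: v_def)
      have "(\<lambda>x. cscale (fr_th (k * x) \<theta>) (A * u x) + cscale (fr_ph (k * x)) (B * u x), \<lambda>x. z *s v x - f x)
          \<in> lin_graph \<alpha> \<beta> h \<mu> \<omega> (\<lambda>x. wavetrain k \<omega> \<theta> x 0)"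
      proof (rule lin_graph_intro[OF al eq \<omega> _ sH1_cmult[OF h(1), of A] sH1_cmult[OF h(2), of A] sH1_cmult[OF h(1), of B] sH1_cmult[OF h(2), of B]])
        have "(\<lambda>x. z *s v x - f x) \<in> L2_fun"
          using vL fL by (auto simp: L2_tangent_def L2_fun_iff intro!: sL2_diff sL2_cmult)
        thus "(\<lambda>x. z *s v x - f x) \<in> L2_tangent (\<lambda>x. wavetrain k \<omega> \<theta> x 0)"
          by (simp add: L2_tangent_iff cdot_diff cdot_smult va fa)
        show "AE x in lborel. cdot (fr_th (k * x) \<theta>) (z *s v x - f x) + of_real \<alpha> * cdot (fr_ph (k * x)) (z *s v x - f x) =
              B * u2 x + of_real (2 * k * cos \<theta>) * (A * u1 x) \<and>
            cdot (fr_ph (k * x)) (z *s v x - f x) - of_real \<alpha> * cdot (fr_th (k * x) \<theta>) (z *s v x - f x) =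
              - (A * u2 x) + of_real (2 * k * cos \<theta>) * (B * u1 x) + of_real ((\<mu> - k\<^sup>2) * (sin \<theta>)\<^sup>2) * (A * u x)"
          unfolding \<kappa>_def[symmetric] s_def[symmetric] cdot_diff cdot_smult va fa
        proof (intro AE_I2 conjI)
          fix x
          show "z * (A * u x) - f1 x + of_real \<alpha> * (z * (B * u x) - f2 x) = B * u2 x + of_real \<kappa> * (A * u1 x)"
            using eG[of x] unfolding fG[of x, symmetric] by (simp add: algebra_simps)
          show "z * (B * u x) - f2 x - of_real \<alpha> * (z * (A * u x) - f1 x) = - (A * u2 x) + of_real \<kappa> * (B * u1 x) + of_real s * (A * u x)"
            using eF[of x] unfolding fF[of x, symmetric] by (simp add: algebra_simps)
        qed
      qed
      hence "(v, \<lambda>x. z *s v x - f x) \<in> lin_graph \<alpha> \<beta> h \<mu> \<omega> n"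
        unfolding n_def by (simp only: v_def[abs_def])
      from R[OF fL this] have le: "L2_nrm v \<le> R * L2_nrm f" .
      have "0 \<le> L2_nrm v" by (auto simp: L2_nrm_def intro!: integral_nonneg_AE)
      hence "(L2_nrm v)\<^sup>2 \<le> R\<^sup>2 * (L2_nrm f)\<^sup>2" using power_mono[OF le, of 2] by (simp add: power_mult_distrib)
      moreover have "(L2_nrm v)\<^sup>2 = nsq (\<lambda>x. A * u x) + nsq (\<lambda>x. B * u x)"
        using L2_nrm_tangent[OF vL[unfolded n_def]] by (simp add: va)
      moreover have "(L2_nrm f)\<^sup>2 = nsq f1 + nsq f2"
        using L2_nrm_tangent[OF fL[unfolded n_def]] by (simp add: fa)
      ultimately have "(cmod A)\<^sup>2 * nsq u + (cmod B)\<^sup>2 * nsq u \<le> R\<^sup>2 * (nsq f1 + nsq f2)" by (simp add: nsq_cmult)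
      also have "\<dots> \<le> R\<^sup>2 * ((M * \<epsilon>)\<^sup>2 * nsq u + (M * \<epsilon>)\<^sup>2 * nsq u)" by (intro mult_left_mono add_mono nf) auto
      finally have "(cmod A)\<^sup>2 * nsq u + (cmod B)\<^sup>2 * nsq u \<le> R\<^sup>2 * (2 * (M * \<epsilon>)\<^sup>2) * nsq u" by (simp add: algebra_simps)
      moreover have "(cmod B)\<^sup>2 * nsq u \<ge> 0" using u(5) by auto
      ultimately have "(cmod A)\<^sup>2 * nsq u \<le> R\<^sup>2 * (2 * (M * \<epsilon>)\<^sup>2) * nsq u" by linarith
      thus ?thesis using u(5) by simp
    qed
    define Q where "Q = 2 * R\<^sup>2 * M\<^sup>2"
    have Q: "(cmod A)\<^sup>2 \<le> Q * \<epsilon>" if "0 < \<epsilon>" "\<epsilon> \<le> 1" for \<epsilon>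
    proof -
      have "(cmod A)\<^sup>2 \<le> Q * \<epsilon>\<^sup>2" using main[OF that] by (simp add: Q_def power_mult_distrib algebra_simps)
      also have "\<dots> \<le> Q * \<epsilon>" using that by (intro mult_left_mono) (auto simp: Q_def power2_eq_square mult_left_le_one_le)
      finally show ?thesis .
    qed
    have Apos: "(cmod A)\<^sup>2 > 0" using A0 by simp
    have "(cmod A)\<^sup>2 \<le> Q" using Q[of 1] by simp
    hence Qpos: "Q > 0" using Apos by linarith
    \<comment> \<open>Chosen so that the upper bound for |A|^2 becomes at most half of
      |A|^2.\<close>
    define \<epsilon> where "\<epsilon> = min 1 ((cmod A)\<^sup>2 / (2 * Q))"
    have "Q * \<epsilon> \<le> (cmod A)\<^sup>2 / 2"
    proof -
      have "Q * \<epsilon> \<le> Q * ((cmod A)\<^sup>2 / (2 * Q))" using Qpos by (intro mult_left_mono) (auto simp: \<epsilon>_def)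
      thus ?thesis using Qpos by simp
    qed
    moreover have "0 < \<epsilon>" "\<epsilon> \<le> 1" using Apos Qpos by (auto simp: \<epsilon>_def)
    ultimately show False using Q[of \<epsilon>] Apos by linarith
  qed
  thus ?thesis using rz by (auto simp: wavetrain_spectrum_def Let_def n_def)
qed

section \<open>The reduced equation for the height\<close>

text \<open>Along an orbit with energy \<open>E\<close>, first integral \<open>C\<close> and \<open>H = h - \<Omega>\<close> the height \<open>u = cos \<theta>\<close> satisfies
  \<open>u'\<^sup>2 = pot u\<close>, hence \<open>u'' = pot' u / 2\<close>, and \<open>hpot'\<close> is this half derivative.\<close>

definition pot :: "real \<Rightarrow> real \<Rightarrow> real \<Rightarrow> real \<Rightarrow> real \<Rightarrow> real" where
  "pot H \<mu> E C u = (1 - u\<^sup>2) * (2 * E - 2 * H * u + \<mu> * u\<^sup>2) - C\<^sup>2"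

definition hpot' :: "real \<Rightarrow> real \<Rightarrow> real \<Rightarrow> real \<Rightarrow> real" where
  "hpot' H \<mu> E u = - 2 * \<mu> * u ^ 3 + 3 * H * u\<^sup>2 + (\<mu> - 2 * E) * u - H"

text \<open>The second-order equation is kept next to the energy relation. The latter alone would
  allow a solution to rest at a simple root for a while and then leave, and initial values would not
  determine the profile.\<close>

definition profile :: "real \<Rightarrow> real \<Rightarrow> real \<Rightarrow> real \<Rightarrow> (real \<Rightarrow> real) \<Rightarrow> (real \<Rightarrow> real) \<Rightarrow> bool" where
  "profile H \<mu> E C u w \<longleftrightarrow> (\<forall>\<xi>. - 1 < u \<xi> \<and> u \<xi> < 1 \<and> (u has_real_derivative w \<xi>) (at \<xi>) \<and>
     (w has_real_derivative hpot' H \<mu> E (u \<xi>)) (at \<xi>) \<and> (w \<xi>)\<^sup>2 = pot H \<mu> E C (u \<xi>))"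

lemma profileD:
  assumes "profile H \<mu> E C u w"
  shows "- 1 < u \<xi>" "u \<xi> < 1" "(u has_real_derivative w \<xi>) (at \<xi>)"
    "(w has_real_derivative hpot' H \<mu> E (u \<xi>)) (at \<xi>)" "(w \<xi>)\<^sup>2 = pot H \<mu> E C (u \<xi>)"
  using assms by (auto simp: profile_def)

lemma profile_shift:
  assumes "profile H \<mu> E C u w"
  shows "profile H \<mu> E C (\<lambda>\<xi>. u (\<xi> + d)) (\<lambda>\<xi>. w (\<xi> + d))"
  unfolding profile_def using profileD[OF assms] by (auto intro: DERIV_shift[THEN iffD1])

lemma profile_reflect:
  assumes "profile H \<mu> E C u w"
  shows "profile H \<mu> E C (\<lambda>\<xi>. u (c - \<xi>)) (\<lambda>\<xi>. - w (c - \<xi>))"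
proof -
  have i: "((\<lambda>\<xi>. c - \<xi>) has_real_derivative - 1) (at \<xi>)" for \<xi>
    by (auto intro!: derivative_eq_intros)
  have "((\<lambda>\<xi>. u (c - \<xi>)) has_real_derivative - w (c - \<xi>)) (at \<xi>)"
    "((\<lambda>\<xi>. - w (c - \<xi>)) has_real_derivative hpot' H \<mu> E (u (c - \<xi>))) (at \<xi>)" for \<xi>
    using DERIV_chain2[OF profileD(3)[OF assms] i, of \<xi>] DERIV_minus[OF DERIV_chain2[OF profileD(4)[OF assms] i, of \<xi>]]
    by simp_all
  thus ?thesis using profileD[OF assms] by (auto simp: profile_def)
qed

lemma profile_neg:
  assumes "profile H \<mu> E C u w"
  shows "profile (- H) \<mu> E C (\<lambda>\<xi>. - u \<xi>) (\<lambda>\<xi>. - w \<xi>)"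
proof -
  have "((\<lambda>\<xi>. - u \<xi>) has_real_derivative - w \<xi>) (at \<xi>)"
    "((\<lambda>\<xi>. - w \<xi>) has_real_derivative - hpot' H \<mu> E (u \<xi>)) (at \<xi>)" for \<xi>
    using profileD(3,4)[OF assms] by (auto intro!: derivative_eq_intros)
  moreover have "- hpot' H \<mu> E x = hpot' (- H) \<mu> E (- x)" "pot H \<mu> E C x = pot (- H) \<mu> E C (- x)" for x
    by (simp_all add: hpot'_def pot_def)
  ultimately show ?thesis using profileD[OF assms] by (simp add: profile_def)
qed

section \<open>Uniqueness and symmetry of profiles\<close>

text \<open>To the right of \<open>a\<close> the product of \<open>g\<close> with exp (- M x) is
  nonincreasing, to the left the product with exp (M x) is nondecreasing; either way the value 0 at
  \<open>a\<close> is an upper bound.\<close>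

lemma gronwall_zero:
  fixes g g' :: "real \<Rightarrow> real"
  assumes d: "\<And>x. (g has_real_derivative g' x) (at x)" and nn: "\<And>x. 0 \<le> g x"
    and b: "\<And>x. \<bar>g' x\<bar> \<le> M * g x" and 0: "g a = 0"
  shows "g x = 0"
proof (cases "a \<le> x")
  case True
  have "g x * exp (- M * x) \<le> g a * exp (- M * a)"
  proof (rule DERIV_nonpos_imp_nonincreasing[of a x "\<lambda>x. g x * exp (- M * x)", OF True])
    fix y
    have "((\<lambda>x. g x * exp (- M * x)) has_real_derivative (g' y - M * g y) * exp (- M * y)) (at y)"
      by (auto intro!: derivative_eq_intros d simp: algebra_simps)
    moreover have "(g' y - M * g y) * exp (- M * y) \<le> 0" using b[of y] by (intro mult_nonpos_nonneg) auto
    ultimately show "\<exists>z. ((\<lambda>x. g x * exp (- M * x)) has_real_derivative z) (at y) \<and> z \<le> 0" by blast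
  qed
  thus ?thesis using nn[of x] 0 by (simp add: mult_le_0_iff)
next
  case False
  have "g x * exp (M * x) \<le> g a * exp (M * a)"
  proof (rule DERIV_nonneg_imp_nondecreasing[of x a "\<lambda>x. g x * exp (M * x)"])
    show "x \<le> a" using False by simp
    fix y
    have "((\<lambda>x. g x * exp (M * x)) has_real_derivative (g' y + M * g y) * exp (M * y)) (at y)"
      by (auto intro!: derivative_eq_intros d simp: algebra_simps)
    moreover have "(g' y + M * g y) * exp (M * y) \<ge> 0" using b[of y] by (intro mult_nonneg_nonneg) auto
    ultimately show "\<exists>z. ((\<lambda>x. g x * exp (M * x)) has_real_derivative z) (at y) \<and> z \<ge> 0" by blast
  qed
  thus ?thesis using nn[of x] 0 by (simp add: mult_le_0_iff)
qed

text \<open>Profiles stay in (-1, 1), where the cubic right-hand side is Lipschitz. The squared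
  distance is used because it is differentiable.\<close>

lemma profile_unique:
  assumes u: "profile H \<mu> E C u w" and v: "profile H \<mu> E C v y" and e: "u a = v a" "w a = y a"
  shows "u = v \<and> w = y"
proof -
  \<comment> \<open>On [-1, 1] one has |r^2 + r s + s^2| <= 3 and |r + s| <= 2, which bounds the
    difference quotients of \<open>hpot'\<close>.\<close>
  define L where "L = 6 * \<bar>\<mu>\<bar> + 6 * \<bar>H\<bar> + \<bar>\<mu> - 2 * E\<bar>"
  define g where "g x = (u x - v x)\<^sup>2 + (w x - y x)\<^sup>2" for x
  define g' where "g' x = 2 * (u x - v x) * (w x - y x) + 2 * (w x - y x) * (hpot' H \<mu> E (u x) - hpot' H \<mu> E (v x))" for x
  have lip: "\<bar>hpot' H \<mu> E r - hpot' H \<mu> E s\<bar> \<le> L * \<bar>r - s\<bar>" if "\<bar>r\<bar> \<le> 1" "\<bar>s\<bar> \<le> 1" for r s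
  proof -
    define K where "K = - 2 * \<mu> * (r * r + r * s + s * s) + 3 * H * (r + s) + (\<mu> - 2 * E)"
    have "hpot' H \<mu> E r - hpot' H \<mu> E s = K * (r - s)"
      by (simp add: hpot'_def K_def power3_eq_cube power2_eq_square algebra_simps)
    moreover have "\<bar>K\<bar> \<le> L"
    proof -
      have 1: "\<bar>x * z\<bar> \<le> 1" if "\<bar>x\<bar> \<le> 1" "\<bar>z\<bar> \<le> 1" for x z :: real
        using that by (simp add: abs_mult mult_le_one)
      have "\<bar>r * r + r * s + s * s\<bar> \<le> 3" using 1[of r r] 1[of r s] 1[of s s] that by linarith
      hence "\<bar>- 2 * \<mu> * (r * r + r * s + s * s)\<bar> \<le> 2 * \<bar>\<mu>\<bar> * 3"
        unfolding abs_mult by (intro mult_mono) auto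
      moreover have "\<bar>3 * H * (r + s)\<bar> \<le> 3 * \<bar>H\<bar> * 2"
        unfolding abs_mult using that by (intro mult_mono) auto
      ultimately show ?thesis unfolding K_def L_def by linarith
    qed
    ultimately show ?thesis by (simp add: abs_mult mult_right_mono)
  qed
  have "g x = 0" for x
  proof (rule gronwall_zero[where M="1 + L" and g=g and g'=g' and a=a])
    show "(g has_real_derivative g' x) (at x)" for x
      unfolding g_def[abs_def] g'_def using profileD(3,4)[OF u, of x] profileD(3,4)[OF v, of x]
      by (auto intro!: derivative_eq_intros simp: algebra_simps)
    show "\<bar>g' x\<bar> \<le> (1 + L) * g x" for x
    proof -
      define p q where "p = \<bar>u x - v x\<bar>" and "q = \<bar>w x - y x\<bar>"
      have pq: "p \<ge> 0" "q \<ge> 0" "L \<ge> 0" by (auto simp: p_def q_def L_def)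
      have l: "\<bar>hpot' H \<mu> E (u x) - hpot' H \<mu> E (v x)\<bar> \<le> L * p"
        unfolding p_def using profileD(1,2)[OF u, of x] profileD(1,2)[OF v, of x] by (intro lip) auto
      have "\<bar>g' x\<bar> \<le> 2 * p * q + 2 * q * \<bar>hpot' H \<mu> E (u x) - hpot' H \<mu> E (v x)\<bar>"
        unfolding g'_def p_def q_def by (rule order_trans[OF abs_triangle_ineq]) (simp only: abs_mult abs_numeral order_refl)
      also have "\<dots> \<le> 2 * p * q + 2 * q * (L * p)" using l pq by (intro add_left_mono mult_left_mono) auto
      also have "\<dots> = (1 + L) * (2 * p * q)" by (simp add: algebra_simps)
      also have "\<dots> \<le> (1 + L) * (p\<^sup>2 + q\<^sup>2)"
        using pq zero_le_power2[of "p - q"] by (intro mult_left_mono) (auto simp: power2_diff)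
      finally show ?thesis by (simp add: g_def p_def q_def)
    qed
  qed (auto simp: g_def e)
  hence "u x = v x \<and> w x = y x" for x
    by (simp add: g_def sum_power2_eq_zero_iff)
  thus ?thesis by auto
qed

lemma profile_two_turning_points:
  assumes u: "profile H \<mu> E C u w" and a: "w a = 0" and b: "w b = 0" and ab: "a \<noteq> b"
  shows "\<exists>T>0. \<forall>\<xi>. u (\<xi> + T) = u \<xi> \<and> w (\<xi> + T) = w \<xi>"
proof -
  have ex: "\<exists>T>0. \<forall>\<xi>. u (\<xi> + T) = u \<xi> \<and> w (\<xi> + T) = w \<xi>" if w: "w a = 0" "w b = 0" and ab: "a < b" for a b
  proof -
    \<comment> \<open>Reflection about c changes the sign of the derivative, so at a turning point
      the reflected profile has the same initial data.\<close>
    have r: "u (2 * c - \<xi>) = u \<xi> \<and> - w (2 * c - \<xi>) = w \<xi>" if "w c = 0" for c \<xi>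
      using profile_unique[OF profile_reflect[OF u, of "2 * c"] u, of c] that by (simp add: fun_eq_iff)
    have "u (\<xi> + 2 * (b - a)) = u \<xi> \<and> w (\<xi> + 2 * (b - a)) = w \<xi>" for \<xi>
      using r[OF w(1), of \<xi>] r[OF w(2), of "2 * a - \<xi>"] by (simp add: algebra_simps)
    thus ?thesis using ab by (intro exI[of _ "2 * (b - a)"]) auto
  qed
  show ?thesis using ex[OF a b] ex[OF b a] ab by (cases "a < b") auto
qed

section \<open>Asymptotics of monotone profiles\<close>

text \<open>The increments over unit intervals tend to zero, and by the mean value theorem they are
  values of the derivative at points that tend to infinity.\<close>

lemma deriv_limit_zero:
  fixes f f' :: "real \<Rightarrow> real"
  assumes d: "\<And>x. (f has_real_derivative f' x) (at x)" and f: "(f \<longlongrightarrow> l) at_top" and f': "(f' \<longlongrightarrow> c) at_top"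
  shows "c = 0"
proof -
  have "\<exists>z. x < z \<and> f (x + 1) - f x = f' z" for x
    using MVT2[of x "x + 1" f f'] d by auto
  then obtain z where z: "\<And>x. x < z x" "\<And>x. f (x + 1) - f x = f' (z x)" by metis
  have "filterlim z at_top at_top"
    by (rule filterlim_at_top_mono[OF filterlim_ident]) (auto intro!: eventually_mono[OF eventually_True] less_imp_le z)
  hence "((\<lambda>x. f' (z x)) \<longlongrightarrow> c) at_top" by (rule filterlim_compose[OF f'])
  moreover have "((\<lambda>x. f (x + 1) - f x) \<longlongrightarrow> l - l) at_top"
  proof (intro tendsto_diff f filterlim_compose[OF f])
    show "filterlim (\<lambda>x::real. x + 1) at_top at_top"
      by (rule filterlim_at_top_mono[OF filterlim_ident]) simp
  qed
  ultimately have "c = l - l" unfolding z(2) by (rule tendsto_unique[OF trivial_limit_at_top_linorder])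
  thus ?thesis by simp
qed

lemma continuous_pot: "isCont (pot H \<mu> E C) x" and continuous_hpot': "isCont (hpot' H \<mu> E) x"
  unfolding pot_def[abs_def] hpot'_def[abs_def] by (intro continuous_intros)+

text \<open>Being monotone and bounded, \<open>u\<close> converges, and so do its first and second
  derivatives, which are functions of \<open>u\<close>. Their limits must be zero, so
  \<open>L\<close> is a double root. It is interior because \<open>pot\<close> equals - C^2 at 1 and
  -1.\<close>

lemma profile_limit_increasing:
  assumes u: "profile H \<mu> E C u w" and w: "\<And>\<xi>. a < \<xi> \<Longrightarrow> 0 < w \<xi>" and C: "C \<noteq> 0"
  shows "\<exists>L. - 1 < L \<and> L < 1 \<and> (u \<longlongrightarrow> L) at_top \<and> (w \<longlongrightarrow> 0) at_top \<and> pot H \<mu> E C L = 0 \<and> hpot' H \<mu> E L = 0 \<and> (\<forall>\<xi>>a. u \<xi> < L)"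
proof -
  have mono: "u x < u y" if "a < x" "x < y" for x y
    by (rule DERIV_pos_imp_increasing[OF that(2)]) (use profileD(3)[OF u] w that in \<open>force intro: less_le_trans\<close>)
  define L where "L = (SUP x\<in>{a<..}. u x)"
  have bdd: "bdd_above (u ` {a<..})" using profileD(2)[OF u] by (intro bdd_aboveI[of _ 1]) (auto intro: less_imp_le)
  have le: "u x \<le> L" if "x > a" for x unfolding L_def using that bdd by (intro cSUP_upper) auto
  have lt: "u x < L" if "x > a" for x using mono[of x "x+1"] le[of "x+1"] that by simp
  have lim: "(u \<longlongrightarrow> L) at_top"
  proof (rule order_tendstoI)
    fix y assume "y < L"
    then obtain x where x: "x > a" "y < u x" unfolding L_def using less_cSUP_iff[OF _ bdd] by auto
    show "eventually (\<lambda>\<xi>. y < u \<xi>) at_top"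
      using eventually_gt_at_top[of x] by eventually_elim (use mono[of x] x in \<open>force intro: less_trans\<close>)
  next
    fix y assume "L < y"
    show "eventually (\<lambda>\<xi>. u \<xi> < y) at_top"
      using eventually_gt_at_top[of a] by eventually_elim (use le \<open>L < y\<close> in \<open>force intro: le_less_trans\<close>)
  qed
  have limP: "((\<lambda>\<xi>. pot H \<mu> E C (u \<xi>)) \<longlongrightarrow> pot H \<mu> E C L) at_top"
    by (rule isCont_tendsto_compose[OF continuous_pot lim])
  have "((\<lambda>\<xi>. sqrt (pot H \<mu> E C (u \<xi>))) \<longlongrightarrow> sqrt (pot H \<mu> E C L)) at_top" by (intro tendsto_real_sqrt limP)
  moreover have "eventually (\<lambda>\<xi>. sqrt (pot H \<mu> E C (u \<xi>)) = w \<xi>) at_top"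
    using eventually_gt_at_top[of a] by eventually_elim (use w in \<open>auto simp flip: profileD(5)[OF u] simp: less_imp_le\<close>)
  ultimately have lw: "(w \<longlongrightarrow> sqrt (pot H \<mu> E C L)) at_top" by (rule Lim_transform_eventually)
  hence s0: "sqrt (pot H \<mu> E C L) = 0" by (rule deriv_limit_zero[OF profileD(3)[OF u] lim])
  hence P0: "pot H \<mu> E C L = 0" by simp
  have w0: "(w \<longlongrightarrow> 0) at_top" using lw unfolding s0 .
  have Q0: "hpot' H \<mu> E L = 0"
    by (rule deriv_limit_zero[OF profileD(4)[OF u] w0 isCont_tendsto_compose[OF continuous_hpot' lim]])
  have "L \<le> 1" by (rule tendsto_upperbound[OF lim]) (auto intro!: eventually_mono[OF eventually_True] less_imp_le profileD(2)[OF u])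
  moreover have "L \<ge> -1" by (rule tendsto_lowerbound[OF lim]) (auto intro!: eventually_mono[OF eventually_True] less_imp_le profileD(1)[OF u])
  moreover have "L\<^sup>2 \<noteq> 1" using P0 C by (auto simp: pot_def)
  ultimately have "-1 < L" "L < 1" by (auto simp: less_le power2_eq_1_iff)
  thus ?thesis using lim w0 P0 Q0 lt by blast
qed

lemma continuous_nonzero_sign:
  fixes w :: "real \<Rightarrow> real"
  assumes "\<And>x. isCont w x" and nz: "\<And>x. a < x \<Longrightarrow> w x \<noteq> 0"
  shows "(\<forall>x>a. 0 < w x) \<or> (\<forall>x>a. w x < 0)"
proof (rule ccontr)
  assume "\<not> ?thesis"
  then obtain x y where xy: "x > a" "y > a" "w x < 0" "w y > 0" using nz by (metis linorder_neqE_linordered_idom)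
  have c: "connected (w ` {a<..})"
    by (intro connected_continuous_image) (auto intro: continuous_at_imp_continuous_on assms)
  have "0 \<in> w ` {a<..}"
    by (rule connectedD_interval[OF c, of "w x" "w y"]) (use xy in auto)
  thus False using nz by auto
qed

text \<open>Without turning points beyond \<open>a\<close> the profile is monotone there; the
  decreasing case is the increasing one for -u and -H.\<close>

lemma profile_limit:
  assumes u: "profile H \<mu> E C u w" and w: "\<And>\<xi>. a < \<xi> \<Longrightarrow> w \<xi> \<noteq> 0" and C: "C \<noteq> 0"
  shows "\<exists>L. - 1 < L \<and> L < 1 \<and> (u \<longlongrightarrow> L) at_top \<and> (w \<longlongrightarrow> 0) at_top \<and> pot H \<mu> E C L = 0 \<and> hpot' H \<mu> E L = 0 \<and>
    ((\<forall>\<xi>>a. 0 < w \<xi>) \<and> (\<forall>\<xi>>a. u \<xi> < L) \<or> (\<forall>\<xi>>a. w \<xi> < 0) \<and> (\<forall>\<xi>>a. L < u \<xi>))"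
proof -
  have "isCont w x" for x using profileD(4)[OF u, of x] by (rule DERIV_isCont)
  from continuous_nonzero_sign[OF this w] show ?thesis
  proof
    assume "\<forall>x>a. 0 < w x"
    thus ?thesis using profile_limit_increasing[OF u _ C, of a] by blast
  next
    assume n: "\<forall>x>a. w x < 0"
    then obtain L where L: "- 1 < L" "L < 1" "((\<lambda>\<xi>. - u \<xi>) \<longlongrightarrow> L) at_top" "((\<lambda>\<xi>. - w \<xi>) \<longlongrightarrow> 0) at_top"
      "pot (- H) \<mu> E C L = 0" "hpot' (- H) \<mu> E L = 0" "\<forall>\<xi>>a. - u \<xi> < L"
      using profile_limit_increasing[OF profile_neg[OF u] _ C, of a] by auto
    have "(u \<longlongrightarrow> - L) at_top" "(w \<longlongrightarrow> 0) at_top"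
      using tendsto_minus[OF L(3)] tendsto_minus[OF L(4)] by auto
    moreover have "pot H \<mu> E C (- L) = pot (- H) \<mu> E C L" "hpot' H \<mu> E (- L) = - hpot' (- H) \<mu> E L"
      by (simp_all add: hpot'_def pot_def)
    ultimately show ?thesis using L n by (intro exI[of _ "- L"]) (auto simp: minus_less_iff)
  qed
qed

text \<open>The Taylor expansion about \<open>L\<close>. The quadratic coefficient, half the second
  derivative of \<open>pot\<close>, decides by its sign whether \<open>pot\<close> is positive next
  to a double root.\<close>

lemma pot_taylor:
  "pot H \<mu> E C u = pot H \<mu> E C L + 2 * hpot' H \<mu> E L * (u - L) +
     (u - L)\<^sup>2 * ((- 6 * \<mu> * L\<^sup>2 + 6 * H * L + \<mu> - 2 * E) + (2 * H - 4 * \<mu> * L) * (u - L) - \<mu> * (u - L)\<^sup>2)"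
  by (simp add: pot_def hpot'_def algebra_simps power2_eq_square power3_eq_cube)

lemma pot_two_double_roots:
  assumes L: "pot H \<mu> E C L = 0" "hpot' H \<mu> E L = 0" and M: "pot H \<mu> E C M = 0" "hpot' H \<mu> E M = 0"
    and LM: "L \<noteq> M" and C: "C \<noteq> 0"
  shows "pot H \<mu> E C u \<le> 0"
proof -
  define d where "d = M - L"
  define r0 where "r0 = - 6 * \<mu> * L\<^sup>2 + 6 * H * L + \<mu> - 2 * E"
  define r1 where "r1 = 2 * H - 4 * \<mu> * L"
  have d0: "d \<noteq> 0" using LM by (simp add: d_def)
  have f: "pot H \<mu> E C u = (u - L)\<^sup>2 * (r0 + r1 * (u - L) - \<mu> * (u - L)\<^sup>2)" for u
    using pot_taylor[of H \<mu> E C u L] L by (simp add: r0_def r1_def)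
  have 1: "r0 + r1 * d - \<mu> * d\<^sup>2 = 0" using f[of M] M d0 by (simp add: d_def)
  have "hpot' H \<mu> E M = hpot' H \<mu> E L + r0 * d + 3 / 2 * r1 * d\<^sup>2 - 2 * \<mu> * d ^ 3"
    by (simp add: hpot'_def r0_def r1_def d_def algebra_simps power2_eq_square power3_eq_cube)
  hence "d * (r0 + 3 / 2 * r1 * d - 2 * \<mu> * d\<^sup>2) = 0" using L M by (simp add: algebra_simps power2_eq_square power3_eq_cube)
  hence "r0 + 3 / 2 * r1 * d - 2 * \<mu> * d\<^sup>2 = 0" using d0 by simp
  moreover have "d * (r1 - 2 * \<mu> * d) = 2 * ((r0 + 3 / 2 * r1 * d - 2 * \<mu> * d\<^sup>2) - (r0 + r1 * d - \<mu> * d\<^sup>2))"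
    by (simp add: algebra_simps power2_eq_square)
  ultimately have "d * (r1 - 2 * \<mu> * d) = 0" using 1 by simp
  hence r1: "r1 = 2 * \<mu> * d" using d0 by simp
  with 1 have r0: "r0 = - \<mu> * d\<^sup>2" by (simp add: algebra_simps power2_eq_square)
  \<comment> \<open>Two double roots exhaust the quartic with leading coefficient - \<mu>; the
    negative value at 1 then fixes the sign of \<mu>.\<close>
  have g: "pot H \<mu> E C u = - \<mu> * ((u - L) * (u - M))\<^sup>2" for u
    unfolding f r0 r1 d_def by (simp add: algebra_simps power2_eq_square)
  have "pot H \<mu> E C 1 < 0" using C by (simp add: pot_def)
  hence "0 < \<mu>" unfolding g[of 1] by (simp add: zero_less_mult_iff)
  thus ?thesis unfolding g by simp
qed

text \<open>A non-periodic profile has exactly one turning point: two of them give periodicity by composing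
  reflections, none would connect two distinct double roots.\<close>

lemma profile_nonperiodic:
  assumes u: "profile H \<mu> E C u w" and C: "C \<noteq> 0" and nc: "\<not> u constant_on UNIV"
    and np: "\<not> (\<exists>T>0. \<forall>\<xi>. u (\<xi> + T) = u \<xi> \<and> w (\<xi> + T) = w \<xi>)"
  shows "\<exists>a L. w a = 0 \<and> - 1 < L \<and> L < 1 \<and> (u \<longlongrightarrow> L) at_top \<and> (u \<longlongrightarrow> L) at_bot \<and> (w \<longlongrightarrow> 0) at_top \<and> (w \<longlongrightarrow> 0) at_bot \<and>
    pot H \<mu> E C L = 0 \<and> hpot' H \<mu> E L = 0 \<and> - 6 * \<mu> * L\<^sup>2 + 6 * H * L + \<mu> - 2 * E \<ge> 0 \<and> u a \<noteq> L"
proof -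
  have one: "a = b" if "w a = 0" "w b = 0" for a b using profile_two_turning_points[OF u that] np by blast
  obtain x0 where x0: "w x0 \<noteq> 0"
  proof (rule ccontr)
    assume "\<not> thesis"
    hence "\<And>x. w x = 0" using that by blast
    hence "\<And>x. (u has_real_derivative 0) (at x)" using profileD(3)[OF u] by metis
    hence "u x = u y" for x y using DERIV_isconst_all by blast
    thus False using nc unfolding constant_on_def by blast
  qed
  have P0: "pot H \<mu> E C (u x0) > 0" using profileD(5)[OF u, of x0] x0 by (metis zero_less_power2)
  define u' where "u' \<xi> = u (0 - \<xi>)" for \<xi>
  define w' where "w' \<xi> = - w (0 - \<xi>)" for \<xi>
  have u': "profile H \<mu> E C u' w'" unfolding u'_def[abs_def] w'_def[abs_def] by (rule profile_reflect[OF u])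
  have bot: "(f \<longlongrightarrow> l) at_bot" if "((\<lambda>\<xi>. f (0 - \<xi>)) \<longlongrightarrow> l) at_top" for f :: "real \<Rightarrow> real" and l
    using that by (simp add: filterlim_at_bot_mirror)
  \<comment> \<open>Without a turning point \<open>u\<close> is strictly monotone, so its two limits
    lie on different sides of u 0 and are distinct double roots, although \<open>pot\<close> is
    positive at \<open>u x0\<close>.\<close>
  obtain a where a: "w a = 0"
  proof (rule ccontr)
    assume "\<not> thesis"
    hence nz: "w x \<noteq> 0" for x using that by blast
    hence nz': "w' x \<noteq> 0" for x by (simp add: w'_def)
    obtain L where L: "(u \<longlongrightarrow> L) at_top" "pot H \<mu> E C L = 0" "hpot' H \<mu> E L = 0" and
      s: "(\<forall>\<xi>>min x0 0 - 1. 0 < w \<xi>) \<and> (\<forall>\<xi>>min x0 0 - 1. u \<xi> < L) \<or> (\<forall>\<xi>>min x0 0 - 1. w \<xi> < 0) \<and> (\<forall>\<xi>>min x0 0 - 1. L < u \<xi>)"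
      using profile_limit[OF u nz C] by blast
    obtain M where M: "(u' \<longlongrightarrow> M) at_top" "pot H \<mu> E C M = 0" "hpot' H \<mu> E M = 0" and
      s': "(\<forall>\<xi>>-1. 0 < w' \<xi>) \<and> (\<forall>\<xi>>-1. u' \<xi> < M) \<or> (\<forall>\<xi>>-1. w' \<xi> < 0) \<and> (\<forall>\<xi>>-1. M < u' \<xi>)"
      using profile_limit[OF u' nz' C] by blast
    have s0: "0 < w 0 \<and> u 0 < L \<or> w 0 < 0 \<and> L < u 0" using s by auto
    have s0': "0 < w' 0 \<and> u' 0 < M \<or> w' 0 < 0 \<and> M < u' 0" using s' by auto
    have "L \<noteq> M" using s0 s0' by (auto simp: u'_def w'_def)
    from pot_two_double_roots[OF L(2,3) M(2,3) this C, of "u x0"] show False using P0 by simp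
  qed
  have nz: "w x \<noteq> 0" if "x \<noteq> a" for x using one[OF a] that by blast
  obtain L where L: "- 1 < L" "L < 1" "(u \<longlongrightarrow> L) at_top" "(w \<longlongrightarrow> 0) at_top" "pot H \<mu> E C L = 0" "hpot' H \<mu> E L = 0"
    using profile_limit[OF u _ C, of a] nz by (metis less_irrefl)
  have sym: "u (2 * a - \<xi>) = u \<xi> \<and> - w (2 * a - \<xi>) = w \<xi>" for \<xi>
    using profile_unique[OF profile_reflect[OF u, of "2 * a"] u, of a] a by (simp add: fun_eq_iff)
  have ft: "filterlim (\<lambda>\<xi>. 2 * a + \<xi>) at_top at_top" 
    by (intro filterlim_tendsto_add_at_top[OF tendsto_const] filterlim_ident)
  have "u (0 - \<xi>) = u (2 * a + \<xi>)" "w (0 - \<xi>) = - w (2 * a + \<xi>)" for \<xi>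
    using sym[of "- \<xi>"] by (simp_all add: algebra_simps)
  hence b: "(u \<longlongrightarrow> L) at_bot" "(w \<longlongrightarrow> 0) at_bot"
    using filterlim_compose[OF L(3) ft] tendsto_minus[OF filterlim_compose[OF L(4) ft]] by (auto intro!: bot)
  define R where "R v = (- 6 * \<mu> * L\<^sup>2 + 6 * H * L + \<mu> - 2 * E) + (2 * H - 4 * \<mu> * L) * (v - L) - \<mu> * (v - L)\<^sup>2" for v
  have f: "pot H \<mu> E C v = (v - L)\<^sup>2 * R v" for v
    using pot_taylor[of H \<mu> E C v L] L by (simp add: R_def)
  \<comment> \<open>To the right of the turning point (u - L)^2 R(u) = w^2 > 0. In the limit only
    the weak inequality survives, so a degenerate double root is not excluded here.\<close>
  have "((\<lambda>\<xi>. R (u \<xi>)) \<longlongrightarrow> R L) at_top"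
    unfolding R_def[abs_def] by (intro tendsto_intros L)
  moreover have "eventually (\<lambda>\<xi>. 0 \<le> R (u \<xi>)) at_top"
    using eventually_gt_at_top[of a]
  proof eventually_elim
    case (elim \<xi>)
    hence "(w \<xi>)\<^sup>2 > 0" using nz by simp
    thus ?case unfolding profileD(5)[OF u] f by (auto simp: zero_less_mult_iff)
  qed
  ultimately have "R L \<ge> 0" by (intro tendsto_lowerbound) auto
  moreover have "u a \<noteq> L"
  proof
    assume ua: "u a = L"
    have "profile H \<mu> E C (\<lambda>\<xi>. L) (\<lambda>\<xi>. 0)" using L by (auto simp: profile_def)
    from profile_unique[OF u this, of a] have "u = (\<lambda>\<xi>. L)" using ua a by simp
    thus False using nc by (auto simp: constant_on_def)
  qed
  ultimately show ?thesis using L a b by (auto simp: R_def)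
qed

section \<open>Double roots and homoclinic profiles\<close>

text \<open>A double root at \<open>L\<close> means that (arccos L, 0, q) is an equilibrium and that
  \<open>E\<close> is its energy. The second part identifies the quadratic Taylor coefficient of
  \<open>pot\<close> with the quantity that decides spectral stability.\<close>

lemma double_root_iff:
  assumes C: "C \<noteq> 0" and L: "- 1 < L" "L < 1" and q: "q = C / (1 - L\<^sup>2)"
  shows "pot H \<mu> E C L = 0 \<and> hpot' H \<mu> E L = 0 \<longleftrightarrow>
      H = (\<mu> - q\<^sup>2) * L \<and> 2 * E = q\<^sup>2 * (1 - L\<^sup>2) + 2 * H * L - \<mu> * L\<^sup>2"
    and "pot H \<mu> E C L = 0 \<Longrightarrow> hpot' H \<mu> E L = 0 \<Longrightarrow>
      - 6 * \<mu> * L\<^sup>2 + 6 * H * L + \<mu> - 2 * E = (\<mu> - q\<^sup>2) * (1 - L\<^sup>2) - (2 * q * L)\<^sup>2"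
proof -
  define s where "s = 1 - L\<^sup>2"
  have s: "s > 0" using L by (simp add: s_def abs_square_less_1 abs_less_iff)
  have Cq: "C = q * s" using q s by (simp add: s_def)
  have p: "pot H \<mu> E C L = s * (2 * E - 2 * H * L + \<mu> * L\<^sup>2 - q\<^sup>2 * s)"
    unfolding Cq pot_def s_def by (simp add: algebra_simps power2_eq_square)
  have h: "hpot' H \<mu> E L = - L * (2 * E - 2 * H * L + \<mu> * L\<^sup>2) + s * (\<mu> * L - H)"
    unfolding hpot'_def s_def by (simp add: algebra_simps power2_eq_square power3_eq_cube)
  show *: "pot H \<mu> E C L = 0 \<and> hpot' H \<mu> E L = 0 \<longleftrightarrow>
      H = (\<mu> - q\<^sup>2) * L \<and> 2 * E = q\<^sup>2 * (1 - L\<^sup>2) + 2 * H * L - \<mu> * L\<^sup>2" (is "?l \<longleftrightarrow> ?r")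
  proof -
    have "?l \<longleftrightarrow> 2 * E - 2 * H * L + \<mu> * L\<^sup>2 = q\<^sup>2 * s \<and> - L * (q\<^sup>2 * s) + s * (\<mu> * L - H) = 0"
      unfolding p h using s by auto
    moreover have "- L * (q\<^sup>2 * s) + s * (\<mu> * L - H) = s * ((\<mu> - q\<^sup>2) * L - H)" by (simp add: algebra_simps)
    moreover have "s * ((\<mu> - q\<^sup>2) * L - H) = 0 \<longleftrightarrow> H = (\<mu> - q\<^sup>2) * L" using s by auto
    moreover have "2 * E - 2 * H * L + \<mu> * L\<^sup>2 = q\<^sup>2 * s \<longleftrightarrow> 2 * E = q\<^sup>2 * s + 2 * H * L - \<mu> * L\<^sup>2" by auto
    ultimately show ?thesis unfolding s_def[symmetric] by (simp only:) blast
  qed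
  assume "pot H \<mu> E C L = 0" "hpot' H \<mu> E L = 0"
  with * have "H = (\<mu> - q\<^sup>2) * L" "2 * E = q\<^sup>2 * (1 - L\<^sup>2) + 2 * H * L - \<mu> * L\<^sup>2" by blast+
  thus "- 6 * \<mu> * L\<^sup>2 + 6 * H * L + \<mu> - 2 * E = (\<mu> - q\<^sup>2) * (1 - L\<^sup>2) - (2 * q * L)\<^sup>2"
    by algebra
qed

text \<open>Near a double root \<open>L\<close> the substitution \<open>u = L + 1/y\<close> turns the quartic into a quadratic,
  so that \<open>y\<close> solves a linear equation and is a shifted hyperbolic cosine.\<close>

lemma homoclinic_profile:
  fixes \<sigma> :: real
  assumes P: "pot H \<mu> E C L = 0" "hpot' H \<mu> E L = 0" and L: "- 1 < L" "L < 1" and C: "C \<noteq> 0"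
    and r0: "r0 = - 6 * \<mu> * L\<^sup>2 + 6 * H * L + \<mu> - 2 * E" "r0 > 0" and \<mu>: "\<mu> > 0" and \<sigma>: "\<sigma> = 1 \<or> \<sigma> = - 1"
  shows "\<exists>u w. profile H \<mu> E C u w \<and> (u \<longlongrightarrow> L) at_top \<and> (u \<longlongrightarrow> L) at_bot \<and> (w \<longlongrightarrow> 0) at_top \<and> (w \<longlongrightarrow> 0) at_bot \<and>
     w 0 = 0 \<and> (\<forall>\<xi>. 0 < \<sigma> * (u \<xi> - L))"
proof -
  define r1 where "r1 = 2 * H - 4 * \<mu> * L"
  \<comment> \<open>For u = L + 1/y the energy relation reads y'^2 = r0 y^2 + r1 y - \<mu>, which is
    r0 ((y + m)^2 - D) after completing the square. So y + m is sqrt D times cosh (k \<xi>), up to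
    the sign \<sigma>, which selects the side of \<open>L\<close>.\<close>
  define m where "m = r1 / (2 * r0)"
  define D where "D = m\<^sup>2 + \<mu> / r0"
  define k where "k = sqrt r0"
  define A where "A = \<sigma> * sqrt D"
  have D: "D > m\<^sup>2" "D > 0" using r0 \<mu> by (auto simp: D_def add_nonneg_pos)
  have k: "k\<^sup>2 = r0" "k > 0" using r0 by (auto simp: k_def)
  have \<sigma>2: "\<sigma> * \<sigma> = 1" "\<bar>\<sigma>\<bar> = 1" using \<sigma> by auto
  have A2: "A\<^sup>2 = D" using D(2) \<sigma> by (auto simp: A_def power_mult_distrib)
  \<comment> \<open>Positivity of \<mu> enters here: it makes sqrt D larger than |m|, so that y
    never vanishes.\<close>
  have sD: "sqrt D > \<bar>m\<bar>" using D(1) by (metis real_sqrt_abs real_sqrt_less_iff)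
  define y where "y \<xi> = A * cosh (k * \<xi>) - m" for \<xi>
  define y' where "y' \<xi> = A * k * sinh (k * \<xi>)" for \<xi>
  have \<sigma>y: "\<sigma> * y \<xi> > 0" for \<xi>
  proof -
    have "\<sigma> * y \<xi> = sqrt D * cosh (k * \<xi>) - \<sigma> * m" using \<sigma>2 by (simp add: y_def A_def algebra_simps)
    moreover have "sqrt D * cosh (k * \<xi>) \<ge> sqrt D" using D(2) by (simp add: cosh_real_ge_1)
    moreover have "\<sigma> * m \<le> \<bar>m\<bar>" using \<sigma>2 by (metis abs_ge_self abs_mult mult_1)
    ultimately show ?thesis using sD by linarith
  qed
  hence y0: "y \<xi> \<noteq> 0" for \<xi> by (metis less_irrefl mult_zero_right)
  have dy: "(y has_real_derivative y' \<xi>) (at \<xi>)" for \<xi>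
    unfolding y_def[abs_def] y'_def by (auto intro!: derivative_eq_intros)
  have dy': "(y' has_real_derivative r0 * (y \<xi> + m)) (at \<xi>)" for \<xi>
    unfolding y_def y'_def[abs_def] k(1)[symmetric] by (auto intro!: derivative_eq_intros simp: power2_eq_square)
  have r1m: "r1 = 2 * r0 * m" using r0 by (simp add: m_def)
  have T: "(y' \<xi>)\<^sup>2 = r0 * (y \<xi>)\<^sup>2 + r1 * y \<xi> - \<mu>" for \<xi>
  proof -
    have "(y' \<xi>)\<^sup>2 = r0 * D * (sinh (k * \<xi>))\<^sup>2" by (simp add: y'_def power_mult_distrib k A2)
    also have "\<dots> = r0 * (D * (cosh (k * \<xi>))\<^sup>2 - D)" by (simp add: sinh_square_eq algebra_simps)
    also have "D * (cosh (k * \<xi>))\<^sup>2 = (y \<xi> + m)\<^sup>2" by (simp add: y_def power_mult_distrib A2)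
    also have "r0 * ((y \<xi> + m)\<^sup>2 - D) = r0 * (y \<xi>)\<^sup>2 + r1 * y \<xi> - \<mu>"
      using r0 unfolding D_def r1m by (simp add: field_simps power2_eq_square)
    finally show ?thesis .
  qed
  define u where "u \<xi> = L + 1 / y \<xi>" for \<xi>
  define w where "w \<xi> = - y' \<xi> / (y \<xi>)\<^sup>2" for \<xi>
  have du: "(u has_real_derivative w \<xi>) (at \<xi>)" for \<xi>
    unfolding u_def[abs_def] w_def using dy[of \<xi>] y0[of \<xi>]
    by (auto intro!: derivative_eq_intros simp: power2_eq_square)
  have dw: "(w has_real_derivative hpot' H \<mu> E (u \<xi>)) (at \<xi>)" for \<xi>
  proof -
    have "(w has_real_derivative (- (r0 * (y \<xi> + m)) * (y \<xi>)\<^sup>2 - - y' \<xi> * (2 * y \<xi> * y' \<xi>)) / ((y \<xi>)\<^sup>2 * (y \<xi>)\<^sup>2)) (at \<xi>)"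
      unfolding w_def[abs_def] using dy[of \<xi>] dy'[of \<xi>] y0[of \<xi>]
      by (intro DERIV_divide DERIV_minus) (auto intro!: derivative_eq_intros)
    moreover have "(- (r0 * (y \<xi> + m)) * (y \<xi>)\<^sup>2 - - y' \<xi> * (2 * y \<xi> * y' \<xi>)) / ((y \<xi>)\<^sup>2 * (y \<xi>)\<^sup>2) = hpot' H \<mu> E (u \<xi>)"
    proof -
      have h: "hpot' H \<mu> E (L + d) = hpot' H \<mu> E L + r0 * d + 3 * r0 * m * d\<^sup>2 - 2 * \<mu> * d ^ 3" for d
      proof -
        have "hpot' H \<mu> E (L + d) = hpot' H \<mu> E L + r0 * d + 3 / 2 * r1 * d\<^sup>2 - 2 * \<mu> * d ^ 3"
          by (simp add: hpot'_def r0(1) r1_def algebra_simps power2_eq_square power3_eq_cube)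
        thus ?thesis by (simp add: r1m)
      qed
      have n: "- (r0 * (y \<xi> + m)) * (y \<xi>)\<^sup>2 - - y' \<xi> * (2 * y \<xi> * y' \<xi>) = y \<xi> * (r0 * (y \<xi>)\<^sup>2 + 3 * r0 * m * y \<xi> - 2 * \<mu>)"
      proof -
        have "- (r0 * (y \<xi> + m)) * (y \<xi>)\<^sup>2 - - y' \<xi> * (2 * y \<xi> * y' \<xi>) = - (r0 * (y \<xi> + m)) * (y \<xi>)\<^sup>2 + 2 * y \<xi> * (y' \<xi>)\<^sup>2"
          by (simp add: power2_eq_square)
        thus ?thesis unfolding T r1m by (simp add: algebra_simps power2_eq_square)
      qed
      show ?thesis unfolding u_def h P(2) n using y0[of \<xi>]
        by (simp add: field_simps power2_eq_square power3_eq_cube)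
    qed
    ultimately show ?thesis by simp
  qed
  have f: "pot H \<mu> E C v = (v - L)\<^sup>2 * (r0 + r1 * (v - L) - \<mu> * (v - L)\<^sup>2)" for v
    using pot_taylor[of H \<mu> E C v L] P by (simp add: r0(1) r1_def)
  have w2: "(w \<xi>)\<^sup>2 = pot H \<mu> E C (u \<xi>)" for \<xi>
    unfolding w_def u_def f power_divide power2_minus T using y0[of \<xi>]
    by (simp add: field_simps power2_eq_square)
  have cosh_top: "filterlim (\<lambda>\<xi>. cosh (k * \<xi>)) at_top at_top"
    by (rule filterlim_compose[OF cosh_real_at_top filterlim_tendsto_pos_mult_at_top[OF tendsto_const k(2) filterlim_ident]])
  have "filterlim (\<lambda>\<xi>. sqrt D * cosh (k * \<xi>)) at_top at_top"
    using D(2) by (intro filterlim_tendsto_pos_mult_at_top[OF tendsto_const _ cosh_top]) auto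
  hence "filterlim (\<lambda>\<xi>. - (\<sigma> * m) + sqrt D * cosh (k * \<xi>)) at_top at_top"
    by (rule filterlim_tendsto_add_at_top[OF tendsto_const])
  moreover have "(\<lambda>\<xi>. - (\<sigma> * m) + sqrt D * cosh (k * \<xi>)) = (\<lambda>\<xi>. \<sigma> * y \<xi>)"
    using \<sigma>2 by (simp add: y_def A_def algebra_simps fun_eq_iff)
  ultimately have "filterlim (\<lambda>\<xi>. \<sigma> * y \<xi>) at_top at_top" by simp
  hence "((\<lambda>\<xi>. \<sigma> * inverse (\<sigma> * y \<xi>)) \<longlongrightarrow> \<sigma> * 0) at_top"
    by (intro tendsto_mult tendsto_const tendsto_inverse_0_at_top)
  moreover have "\<sigma> * inverse (\<sigma> * y \<xi>) = 1 / y \<xi>" for \<xi> using \<sigma> by (auto simp: field_simps)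
  ultimately have "((\<lambda>\<xi>. L + 1 / y \<xi>) \<longlongrightarrow> L + 0) at_top" by (intro tendsto_intros) auto
  hence ut: "(u \<longlongrightarrow> L) at_top" by (simp add: u_def[abs_def])
  have wt: "(w \<longlongrightarrow> 0) at_top"
  proof -
    have "((\<lambda>\<xi>. sqrt (pot H \<mu> E C (u \<xi>))) \<longlongrightarrow> sqrt (pot H \<mu> E C L)) at_top"
      by (intro tendsto_real_sqrt isCont_tendsto_compose[OF continuous_pot ut])
    hence "((\<lambda>\<xi>. \<bar>w \<xi>\<bar>) \<longlongrightarrow> 0) at_top" using P(1) by (simp flip: w2)
    thus ?thesis by (rule tendsto_rabs_zero_cancel)
  qed
  have sym: "u (- \<xi>) = u \<xi>" "w (- \<xi>) = - w \<xi>" for \<xi> by (simp_all add: u_def w_def y_def y'_def)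
  have ub: "(u \<longlongrightarrow> L) at_bot" "(w \<longlongrightarrow> 0) at_bot"
    using ut tendsto_minus[OF wt] by (simp_all add: filterlim_at_bot_mirror sym)
  \<comment> \<open>Far out \<open>u\<close> is near \<open>L\<close> and hence inside (-1, 1). It
    cannot leave, since \<open>pot\<close> is negative at both endpoints but equals w^2 along the
    profile.\<close>
  have rng: "- 1 < u \<xi> \<and> u \<xi> < 1" for \<xi>
  proof (rule ccontr)
    assume o: "\<not> (- 1 < u \<xi> \<and> u \<xi> < 1)"
    have cu: "connected (range u)"
      by (intro connected_continuous_image) (auto intro: continuous_at_imp_continuous_on DERIV_isCont[OF du])
    have "eventually (\<lambda>\<xi>. - 1 < u \<xi> \<and> u \<xi> < 1) at_top"
      using order_tendstoD[OF ut] L by (intro eventually_conj) auto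
    then obtain \<xi>' where i: "- 1 < u \<xi>'" "u \<xi>' < 1" by (metis (mono_tags, lifting) eventually_at_top_linorder order_refl)
    have "pot H \<mu> E C 1 < 0" "pot H \<mu> E C (- 1) < 0" using C by (simp_all add: pot_def)
    hence ne: "u z \<noteq> 1" "u z \<noteq> - 1" for z using w2[of z] zero_le_power2[of "w z"] by (metis not_less)+
    show False
    proof (cases "u \<xi> \<le> - 1")
      case True
      have "- 1 \<in> range u" by (rule connectedD_interval[OF cu, of "u \<xi>" "u \<xi>'"]) (use True i in auto)
      thus False using ne(2) by (metis rangeE)
    next
      case False
      have "1 \<in> range u" by (rule connectedD_interval[OF cu, of "u \<xi>'" "u \<xi>"]) (use False o i in auto)
      thus False using ne(1) by (metis rangeE)
    qed
  qed
  have "profile H \<mu> E C u w" using rng du dw w2 by (simp add: profile_def)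
  moreover have "w 0 = 0" by (simp add: w_def y'_def)
  moreover have "0 < \<sigma> * (u \<xi> - L)" for \<xi>
    using \<sigma>y[of \<xi>] \<sigma> by (auto simp: u_def)
  ultimately show ?thesis using ut ub wt by blast
qed

text \<open>The remaining quadratic factor has only two roots, which are the turning points of the two
  explicit homoclinic profiles.\<close>

lemma homoclinic_profile_unique:
  assumes P: "pot H \<mu> E C L = 0" "hpot' H \<mu> E L = 0" and \<mu>: "\<mu> > 0"
    and u1: "profile H \<mu> E C u1 w1" "w1 0 = 0" "u1 0 < L" and u2: "profile H \<mu> E C u2 w2" "w2 0 = 0" "L < u2 0"
    and u: "profile H \<mu> E C u w" "w a = 0" "u a \<noteq> L"
  shows "(\<forall>\<xi>. u \<xi> = u1 (\<xi> - a) \<and> w \<xi> = w1 (\<xi> - a)) \<or> (\<forall>\<xi>. u \<xi> = u2 (\<xi> - a) \<and> w \<xi> = w2 (\<xi> - a))"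
proof -
  define r0 where "r0 = - 6 * \<mu> * L\<^sup>2 + 6 * H * L + \<mu> - 2 * E"
  define r1 where "r1 = 2 * H - 4 * \<mu> * L"
  have f: "pot H \<mu> E C v = (v - L)\<^sup>2 * (r0 + r1 * (v - L) - \<mu> * (v - L)\<^sup>2)" for v
    using pot_taylor[of H \<mu> E C v L] P by (simp add: r0_def r1_def)
  have root: "r0 + r1 * (v - L) - \<mu> * (v - L)\<^sup>2 = 0" if "pot H \<mu> E C v = 0" "v \<noteq> L" for v
    using that unfolding f by simp
  define x b1 b2 where "x = u a - L" and "b1 = u1 0 - L" and "b2 = u2 0 - L"
  have e: "r0 + r1 * x - \<mu> * x\<^sup>2 = 0" "r0 + r1 * b1 - \<mu> * b1\<^sup>2 = 0" "r0 + r1 * b2 - \<mu> * b2\<^sup>2 = 0"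
    unfolding x_def b1_def b2_def
    using root[of "u a"] root[of "u1 0"] root[of "u2 0"] profileD(5)[OF u(1), of a] profileD(5)[OF u1(1), of 0] profileD(5)[OF u2(1), of 0]
      u u1 u2 by auto
  have b: "b1 < 0" "b2 > 0" using u1 u2 by (auto simp: b1_def b2_def)
  have "(b2 - b1) * (r1 - \<mu> * (b1 + b2)) = 0" using e(2,3) by algebra
  hence r1: "r1 = \<mu> * (b1 + b2)" using b by simp
  have "\<mu> * ((x - b1) * (x - b2)) = 0" using e(1,2) r1 by algebra
  hence "x = b1 \<or> x = b2" using \<mu> by auto
  hence "u a = u1 0 \<or> u a = u2 0" by (auto simp: x_def b1_def b2_def)
  thus ?thesis
  proof
    assume "u a = u1 0"
    hence "u = (\<lambda>\<xi>. u1 (\<xi> + - a)) \<and> w = (\<lambda>\<xi>. w1 (\<xi> + - a))"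
      using u u1 by (intro profile_unique[OF u(1) profile_shift[OF u1(1)], of a]) auto
    thus ?thesis by auto
  next
    assume "u a = u2 0"
    hence "u = (\<lambda>\<xi>. u2 (\<xi> + - a)) \<and> w = (\<lambda>\<xi>. w2 (\<xi> + - a))"
      using u u2 by (intro profile_unique[OF u(1) profile_shift[OF u2(1)], of a]) auto
    thus ?thesis by auto
  qed
qed

section \<open>Coherent structures and their height profiles\<close>

text \<open>Time dependence is a rotation with angular velocity \<Omega>, and \<alpha> \<Omega> =
  \<beta> makes damping and forcing cancel. The equation then only prescribes the two tangential
  components of the second space derivative.\<close>

lemma llgs_rhs_frame:
  assumes al: "\<alpha> > 0" and \<Omega>: "\<Omega> = \<beta> / \<alpha>"
  shows "(\<Omega> * sin \<theta>) *\<^sub>R fr_ph \<psi> = llgs_rhs \<alpha> \<beta> h \<mu> (sph \<psi> \<theta>) ((\<Omega> * sin \<theta>) *\<^sub>R fr_ph \<psi>) W \<longleftrightarrow>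
    fr_ph \<psi> \<bullet> W = 0 \<and> fr_th \<psi> \<theta> \<bullet> W = sin \<theta> * (h - \<Omega> - \<mu> * cos \<theta>)"
proof -
  define n where "n = sph \<psi> \<theta>"
  define e where "e = fr_th \<psi> \<theta>"
  define f where "f = fr_ph \<psi>"
  have n3: "n $ 3 = cos \<theta>" by (simp add: n_def sph_def)
  have cr: "cross3 n e = f" "cross3 n f = - e" "cross3 n n = 0"
    unfolding n_def e_def f_def by (rule frame_cross cross_refl)+
  have e3: "e3 = cos \<theta> *\<^sub>R n - sin \<theta> *\<^sub>R e" unfolding n_def e_def by (rule e3_frame)
  have c4: "cross3 n e3 = - sin \<theta> *\<^sub>R f"
    unfolding e3 by (simp add: Cross3.right_diff_distrib cross_mult_right cr)
  have W: "W = (e \<bullet> W) *\<^sub>R e + (f \<bullet> W) *\<^sub>R f + (n \<bullet> W) *\<^sub>R n"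
    unfolding n_def e_def f_def by (rule frame_expansion)
  have cW: "cross3 n W = (e \<bullet> W) *\<^sub>R f - (f \<bullet> W) *\<^sub>R e"
    by (subst W) (simp add: cross_add_right cross_mult_right cr)
  have \<alpha>\<Omega>: "\<alpha> * \<Omega> = \<beta>" using al \<Omega> by simp
  have "llgs_rhs \<alpha> \<beta> h \<mu> n ((\<Omega> * sin \<theta>) *\<^sub>R f) W =
      cross3 n ((\<alpha> * \<Omega> * sin \<theta>) *\<^sub>R f - W + (\<mu> * cos \<theta> - h) *\<^sub>R e3 - (\<beta> * sin \<theta>) *\<^sub>R f)"
    unfolding llgs_rhs_def n3 c4 by (simp add: mult.assoc)
  also have "\<dots> = cross3 n ((\<mu> * cos \<theta> - h) *\<^sub>R e3 - W)" unfolding \<alpha>\<Omega> by (simp add: algebra_simps)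
  also have "\<dots> = (f \<bullet> W) *\<^sub>R e + (sin \<theta> * (h - \<mu> * cos \<theta>) - e \<bullet> W) *\<^sub>R f"
    unfolding Cross3.right_diff_distrib cross_mult_right c4 cW by (simp add: algebra_simps)
  finally have R: "llgs_rhs \<alpha> \<beta> h \<mu> n ((\<Omega> * sin \<theta>) *\<^sub>R f) W = (f \<bullet> W) *\<^sub>R e + (sin \<theta> * (h - \<mu> * cos \<theta>) - e \<bullet> W) *\<^sub>R f" .
  have "(f \<bullet> W) *\<^sub>R e + (sin \<theta> * (h - \<Omega> - \<mu> * cos \<theta>) - e \<bullet> W) *\<^sub>R f =
     (f \<bullet> W) *\<^sub>R e + (sin \<theta> * (h - \<mu> * cos \<theta>) - e \<bullet> W) *\<^sub>R f - (\<Omega> * sin \<theta>) *\<^sub>R f"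
    by (simp add: algebra_simps)
  hence "(\<Omega> * sin \<theta>) *\<^sub>R f = llgs_rhs \<alpha> \<beta> h \<mu> n ((\<Omega> * sin \<theta>) *\<^sub>R f) W \<longleftrightarrow>
     (f \<bullet> W) *\<^sub>R e + (sin \<theta> * (h - \<Omega> - \<mu> * cos \<theta>) - e \<bullet> W) *\<^sub>R f = 0"
    unfolding R by (metis eq_iff_diff_eq_0)
  also have "\<dots> \<longleftrightarrow> f \<bullet> W = 0 \<and> sin \<theta> * (h - \<Omega> - \<mu> * cos \<theta>) - e \<bullet> W = 0"
  proof -
    have "x = 0 \<and> y = 0" if "x *\<^sub>R e + y *\<^sub>R f = 0" for x y
    proof -
      have "e \<bullet> (x *\<^sub>R e + y *\<^sub>R f) = 0" "f \<bullet> (x *\<^sub>R e + y *\<^sub>R f) = 0" using that by simp_all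
      thus "x = 0 \<and> y = 0" unfolding e_def f_def by (simp add: inner_add_right frame_inner)
    qed
    thus ?thesis by (metis (no_types, lifting) add_0 scaleR_zero_left)
  qed
  finally show ?thesis unfolding n_def e_def f_def by auto
qed

lemma has_vector_derivative_triple:
  fixes f g h :: "real \<Rightarrow> real"
  shows "((\<lambda>x. (f x, g x, h x)) has_vector_derivative (f', g', h')) (at x) \<longleftrightarrow>
    (f has_real_derivative f') (at x) \<and> (g has_real_derivative g') (at x) \<and> (h has_real_derivative h') (at x)"
proof
  assume d: "((\<lambda>x. (f x, g x, h x)) has_vector_derivative (f', g', h')) (at x)"
  note s = bounded_linear.has_vector_derivative[OF bounded_linear_snd d, simplified]
  show "(f has_real_derivative f') (at x) \<and> (g has_real_derivative g') (at x) \<and> (h has_real_derivative h') (at x)"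
    using bounded_linear.has_vector_derivative[OF bounded_linear_fst d]
      bounded_linear.has_vector_derivative[OF bounded_linear_fst s]
      bounded_linear.has_vector_derivative[OF bounded_linear_snd s]
    by (simp add: has_real_derivative_iff_has_vector_derivative)
next
  assume "(f has_real_derivative f') (at x) \<and> (g has_real_derivative g') (at x) \<and> (h has_real_derivative h') (at x)"
  thus "((\<lambda>x. (f x, g x, h x)) has_vector_derivative (f', g', h')) (at x)"
    by (auto simp: has_real_derivative_iff_has_vector_derivative intro!: has_vector_derivative_Pair)
qed

lemma inner_deriv:
  fixes f g :: "real \<Rightarrow> real^3"
  assumes "(f has_vector_derivative f') (at x)" "(g has_vector_derivative g') (at x)"
  shows "((\<lambda>x. f x \<bullet> g x) has_real_derivative f x \<bullet> g' + f' \<bullet> g x) (at x)"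
  using bounded_bilinear.has_vector_derivative[OF bounded_bilinear_inner assms]
  by (simp add: has_real_derivative_iff_has_vector_derivative)

text \<open>Only first derivatives of \<theta> and \<phi> are given. That p and q are differentiable
  is recovered from the differentiability of m_x, whose frame components are p and q sin
  \<theta>.\<close>

lemma llgs_solution_iff_cs_solution:
  assumes al: "\<alpha> > 0" and \<Omega>: "\<Omega> = \<beta> / \<alpha>"
    and d: "\<And>x. (\<theta> has_real_derivative p x) (at x)" "\<And>x. (\<phi> has_real_derivative q x) (at x)"
    and rng: "\<And>x. 0 < \<theta> x" "\<And>x. \<theta> x < pi" "\<And>x. q x \<noteq> 0"
  shows "llgs_solution \<alpha> \<beta> h \<mu> (\<lambda>x t. sph (\<phi> x + \<Omega> * t) (\<theta> x)) \<longleftrightarrow> cs_solution h \<Omega> \<mu> (\<lambda>x. (\<theta> x, p x, q x))"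
proof -
  define \<psi> where "\<psi> x t = \<phi> x + \<Omega> * t" for x t
  have s0: "sin (\<theta> x) > 0" for x using rng by (intro sin_gt_zero) auto
  have d\<psi>: "((\<lambda>x. \<psi> x t) has_real_derivative q x) (at x)" for x t
    unfolding \<psi>_def by (auto intro!: derivative_eq_intros d)
  have mt: "((\<lambda>\<tau>. sph (\<psi> x \<tau>) (\<theta> x)) has_vector_derivative (\<Omega> * sin (\<theta> x)) *\<^sub>R fr_ph (\<psi> x t)) (at t)" for x t
  proof -
    have "((\<lambda>\<tau>. \<psi> x \<tau>) has_real_derivative \<Omega>) (at t)" unfolding \<psi>_def by (auto intro!: derivative_eq_intros)
    from sph_deriv_x[OF this, of "\<lambda>_. \<theta> x" 0] show ?thesis by simp
  qed
  define X where "X x t = p x *\<^sub>R fr_th (\<psi> x t) (\<theta> x) + (q x * sin (\<theta> x)) *\<^sub>R fr_ph (\<psi> x t)" for x t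
  have mx: "((\<lambda>y. sph (\<psi> y t) (\<theta> y)) has_vector_derivative X x t) (at x)" for x t
    unfolding X_def by (rule sph_deriv_x[OF d\<psi> d(1)])
  have de: "((\<lambda>y. fr_th (\<psi> y t) (\<theta> y)) has_vector_derivative (- p x) *\<^sub>R sph (\<psi> x t) (\<theta> x) + (q x * cos (\<theta> x)) *\<^sub>R fr_ph (\<psi> x t)) (at x)" for x t
    by (rule fr_th_deriv_x[OF d\<psi> d(1)])
  have df: "((\<lambda>y. fr_ph (\<psi> y t)) has_vector_derivative (- q x) *\<^sub>R fr_rho (\<psi> x t)) (at x)" for x t
    by (rule fr_ph_deriv_x[OF d\<psi>])
  have ir: "fr_rho \<phi> \<bullet> fr_th \<phi> \<theta> = cos \<theta>" "fr_rho \<phi> \<bullet> fr_ph \<phi> = 0" for \<phi> \<theta>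
    using inner_rho(1)[of \<phi> \<theta>] inner_rho(2)[of \<phi>] by (simp_all add: inner_commute)
  have field: "cs_field h \<Omega> \<mu> (\<theta> x, p x, q x) = (p x, sin (\<theta> x) * (h - \<Omega> + ((q x)\<^sup>2 - \<mu>) * cos (\<theta> x)), - 2 * cot (\<theta> x) * p x * q x)" for x
    by (simp add: cs_field_def)
  show ?thesis
  proof
    assume "llgs_solution \<alpha> \<beta> h \<mu> (\<lambda>x t. sph (\<phi> x + \<Omega> * t) (\<theta> x))"
    then obtain mt' mx' mxx where l: "\<And>x t. ((\<lambda>\<tau>. sph (\<psi> x \<tau>) (\<theta> x)) has_vector_derivative mt' x t) (at t)"
      "\<And>x t. ((\<lambda>y. sph (\<psi> y t) (\<theta> y)) has_vector_derivative mx' x t) (at x)"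
      "\<And>x t. ((\<lambda>y. mx' y t) has_vector_derivative mxx x t) (at x)"
      "\<And>x t. mt' x t = llgs_rhs \<alpha> \<beta> h \<mu> (sph (\<psi> x t) (\<theta> x)) (mt' x t) (mxx x t)"
      unfolding llgs_solution_def \<psi>_def by blast
    have mt': "mt' x t = (\<Omega> * sin (\<theta> x)) *\<^sub>R fr_ph (\<psi> x t)" for x t
      by (rule vector_derivative_unique_at[OF l(1) mt])
    have mx': "mx' = X" using vector_derivative_unique_at[OF l(2) mx] by (auto simp: fun_eq_iff)
    have eqs: "fr_ph (\<psi> x t) \<bullet> mxx x t = 0" "fr_th (\<psi> x t) (\<theta> x) \<bullet> mxx x t = sin (\<theta> x) * (h - \<Omega> - \<mu> * cos (\<theta> x))" for x t
      using l(4)[of x t] unfolding mt' llgs_rhs_frame[OF al \<Omega>] by auto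
    have Xd: "((\<lambda>y. X y t) has_vector_derivative mxx x t) (at x)" for x t using l(3) unfolding mx' .
    have p': "(p has_real_derivative sin (\<theta> x) * (h - \<Omega> + ((q x)\<^sup>2 - \<mu>) * cos (\<theta> x))) (at x)" for x
    proof -
      have "p = (\<lambda>y. fr_th (\<psi> y 0) (\<theta> y) \<bullet> X y 0)"
        by (simp add: fun_eq_iff X_def inner_add_right frame_inner)
      thus ?thesis using inner_deriv[OF de[of 0] Xd[of 0 x]] unfolding eqs
        by (simp add: X_def inner_add_right inner_add_left frame_inner algebra_simps power2_eq_square)
    qed
    have qs: "((\<lambda>y. q y * sin (\<theta> y)) has_real_derivative - (q x * p x * cos (\<theta> x))) (at x)" for x
    proof -
      have "(\<lambda>y. q y * sin (\<theta> y)) = (\<lambda>y. fr_ph (\<psi> y 0) \<bullet> X y 0)"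
        by (simp add: fun_eq_iff X_def inner_add_right frame_inner)
      thus ?thesis using inner_deriv[OF df[of 0] Xd[of 0 x]] unfolding eqs
        by (simp add: X_def inner_add_right inner_add_left frame_inner ir mult_ac)
    qed
    have q': "(q has_real_derivative - 2 * cot (\<theta> x) * p x * q x) (at x)" for x
    proof -
      have "q = (\<lambda>y. (q y * sin (\<theta> y)) / sin (\<theta> y))" using less_imp_neq[OF s0] by (simp add: fun_eq_iff)
      moreover have "((\<lambda>y. (q y * sin (\<theta> y)) / sin (\<theta> y)) has_real_derivative
         (- (q x * p x * cos (\<theta> x)) * sin (\<theta> x) - (q x * sin (\<theta> x)) * (cos (\<theta> x) * p x)) / (sin (\<theta> x) * sin (\<theta> x))) (at x)"
        by (rule DERIV_divide[OF qs DERIV_fun_sin[OF d(1)]]) (use s0[of x] in simp)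
      moreover have "(- (q x * p x * cos (\<theta> x)) * sin (\<theta> x) - (q x * sin (\<theta> x)) * (cos (\<theta> x) * p x)) / (sin (\<theta> x) * sin (\<theta> x))
         = - 2 * cot (\<theta> x) * p x * q x"
        using s0[of x] by (simp add: cot_def field_simps)
      ultimately show ?thesis by simp
    qed
    show "cs_solution h \<Omega> \<mu> (\<lambda>x. (\<theta> x, p x, q x))"
      unfolding cs_solution_def field has_vector_derivative_triple using d p' q' rng by (simp add: phase_space_def)
  next
    assume "cs_solution h \<Omega> \<mu> (\<lambda>x. (\<theta> x, p x, q x))"
    hence p': "(p has_real_derivative sin (\<theta> x) * (h - \<Omega> + ((q x)\<^sup>2 - \<mu>) * cos (\<theta> x))) (at x)"
      and q': "(q has_real_derivative - 2 * cot (\<theta> x) * p x * q x) (at x)" for x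
      unfolding cs_solution_def field has_vector_derivative_triple by auto
    define P where "P x = sin (\<theta> x) * (h - \<Omega> + ((q x)\<^sup>2 - \<mu>) * cos (\<theta> x))" for x
    define Z where "Z x = - (p x * q x * cos (\<theta> x))" for x
    have qs: "((\<lambda>y. q y * sin (\<theta> y)) has_real_derivative Z x) (at x)" for x
      using DERIV_mult[OF q'[of x] DERIV_fun_sin[OF d(1)[of x]]] s0[of x]
      by (simp add: Z_def cot_def field_simps)
    define W where "W x t = (p x *\<^sub>R ((- p x) *\<^sub>R sph (\<psi> x t) (\<theta> x) + (q x * cos (\<theta> x)) *\<^sub>R fr_ph (\<psi> x t)) + P x *\<^sub>R fr_th (\<psi> x t) (\<theta> x))
       + ((q x * sin (\<theta> x)) *\<^sub>R ((- q x) *\<^sub>R fr_rho (\<psi> x t)) + Z x *\<^sub>R fr_ph (\<psi> x t))" for x t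
    have Xd: "((\<lambda>y. X y t) has_vector_derivative W x t) (at x)" for x t
      unfolding X_def W_def P_def
      by (intro has_vector_derivative_add has_vector_derivative_scaleR p' qs de df)
    have 1: "fr_ph (\<psi> x t) \<bullet> W x t = 0" for x t
      by (simp add: W_def Z_def inner_add_right inner_diff_right frame_inner inner_rho algebra_simps)
    have 2: "fr_th (\<psi> x t) (\<theta> x) \<bullet> W x t = sin (\<theta> x) * (h - \<Omega> - \<mu> * cos (\<theta> x))" for x t
      by (simp add: W_def P_def inner_add_right inner_diff_right frame_inner inner_rho algebra_simps power2_eq_square)
    have "\<forall>x t. ((\<lambda>\<tau>. sph (\<psi> x \<tau>) (\<theta> x)) has_vector_derivative (\<Omega> * sin (\<theta> x)) *\<^sub>R fr_ph (\<psi> x t)) (at t) \<and>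
        ((\<lambda>y. sph (\<psi> y t) (\<theta> y)) has_vector_derivative X x t) (at x) \<and>
        ((\<lambda>y. X y t) has_vector_derivative W x t) (at x) \<and>
        (\<Omega> * sin (\<theta> x)) *\<^sub>R fr_ph (\<psi> x t) = llgs_rhs \<alpha> \<beta> h \<mu> (sph (\<psi> x t) (\<theta> x)) ((\<Omega> * sin (\<theta> x)) *\<^sub>R fr_ph (\<psi> x t)) (W x t)"
      unfolding llgs_rhs_frame[OF al \<Omega>] using mt mx Xd 1 2 by blast
    moreover have "\<forall>x t. norm (sph (\<psi> x t) (\<theta> x)) = 1" by (simp add: norm_sph)
    ultimately show "llgs_solution \<alpha> \<beta> h \<mu> (\<lambda>x t. sph (\<phi> x + \<Omega> * t) (\<theta> x))"
      unfolding llgs_solution_def \<psi>_def[symmetric]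
      by (intro conjI exI[of _ "\<lambda>x t. (\<Omega> * sin (\<theta> x)) *\<^sub>R fr_ph (\<psi> x t)"] exI[of _ X] exI[of _ W])
  qed
qed

text \<open>The orbit with height \<open>u\<close>, \<open>w = u'\<close> and \<open>q sin\<^sup>2 \<theta> = k\<close>; the sign of \<open>k\<close> is that of \<open>q\<close>.\<close>

definition lift :: "real \<Rightarrow> (real \<Rightarrow> real) \<Rightarrow> (real \<Rightarrow> real) \<Rightarrow> real \<Rightarrow> real \<times> real \<times> real" where
  "lift k u w = (\<lambda>\<xi>. (arccos (u \<xi>), - w \<xi> / sqrt (1 - (u \<xi>)\<^sup>2), k / (1 - (u \<xi>)\<^sup>2)))"

lemma one_minus_sq_pos: "- 1 < u \<Longrightarrow> u < 1 \<Longrightarrow> 0 < 1 - (u::real)\<^sup>2"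
  by (simp add: abs_square_less_1 abs_less_iff)

lemma cs_solution_first_integral:
  assumes "cs_solution h \<Omega> \<mu> \<gamma>"
  shows "\<exists>k. k \<noteq> 0 \<and> (\<forall>\<xi>. (sin (fst (\<gamma> \<xi>)))\<^sup>2 * snd (snd (\<gamma> \<xi>)) = k)"
    and "\<forall>\<xi>. 0 < fst (\<gamma> \<xi>) \<and> fst (\<gamma> \<xi>) < pi"
    and "\<forall>\<xi>. ((\<lambda>x. fst (\<gamma> x)) has_real_derivative fst (snd (\<gamma> \<xi>))) (at \<xi>)"
    and "\<forall>\<xi>. ((\<lambda>x. fst (snd (\<gamma> x))) has_real_derivative
      sin (fst (\<gamma> \<xi>)) * (h - \<Omega> + ((snd (snd (\<gamma> \<xi>)))\<^sup>2 - \<mu>) * cos (fst (\<gamma> \<xi>)))) (at \<xi>)"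
proof -
  define \<theta> p q where "\<theta> x = fst (\<gamma> x)" and "p x = fst (snd (\<gamma> x))" and "q x = snd (snd (\<gamma> x))" for x
  have \<gamma>: "\<gamma> = (\<lambda>x. (\<theta> x, p x, q x))" by (simp add: \<theta>_def p_def q_def)
  have r: "0 < \<theta> x \<and> \<theta> x < pi \<and> q x \<noteq> 0" and
    d: "(\<theta> has_real_derivative p x) (at x) \<and> (p has_real_derivative sin (\<theta> x) * (h - \<Omega> + ((q x)\<^sup>2 - \<mu>) * cos (\<theta> x))) (at x) \<and>
       (q has_real_derivative - 2 * cot (\<theta> x) * p x * q x) (at x)" for x
    using assms unfolding \<gamma> cs_solution_def cs_field_def phase_space_def case_prod_conv has_vector_derivative_triple by auto
  show "\<forall>\<xi>. 0 < fst (\<gamma> \<xi>) \<and> fst (\<gamma> \<xi>) < pi" using r by (simp add: \<theta>_def)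
  show "\<forall>\<xi>. ((\<lambda>x. fst (\<gamma> x)) has_real_derivative fst (snd (\<gamma> \<xi>))) (at \<xi>)"
    using d by (simp add: \<theta>_def[abs_def] p_def)
  show "\<forall>\<xi>. ((\<lambda>x. fst (snd (\<gamma> x))) has_real_derivative
      sin (fst (\<gamma> \<xi>)) * (h - \<Omega> + ((snd (snd (\<gamma> \<xi>)))\<^sup>2 - \<mu>) * cos (fst (\<gamma> \<xi>)))) (at \<xi>)"
    using d by (simp add: \<theta>_def[abs_def] p_def[abs_def] q_def)
  have s0: "sin (\<theta> x) > 0" for x using r by (intro sin_gt_zero) auto
  have "((\<lambda>x. (sin (\<theta> x))\<^sup>2 * q x) has_real_derivative 0) (at x)" for x
  proof -
    have "((\<lambda>x. (sin (\<theta> x))\<^sup>2 * q x) has_real_derivative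
      2 * sin (\<theta> x) * (cos (\<theta> x) * p x) * q x + (sin (\<theta> x))\<^sup>2 * (- 2 * cot (\<theta> x) * p x * q x)) (at x)"
      using d[of x] by (auto intro!: derivative_eq_intros simp: algebra_simps)
    moreover have "2 * sin (\<theta> x) * (cos (\<theta> x) * p x) * q x + (sin (\<theta> x))\<^sup>2 * (- 2 * cot (\<theta> x) * p x * q x) = 0"
      using s0[of x] by (simp add: cot_def field_simps power2_eq_square)
    ultimately show ?thesis by (simp only:)
  qed
  hence "(sin (\<theta> x))\<^sup>2 * q x = (sin (\<theta> 0))\<^sup>2 * q 0" for x
    using DERIV_isconst_all[of "\<lambda>x. (sin (\<theta> x))\<^sup>2 * q x" x 0] by blast
  moreover have "(sin (\<theta> 0))\<^sup>2 * q 0 \<noteq> 0" using s0[of 0] r[of 0] by simp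
  ultimately show "\<exists>k. k \<noteq> 0 \<and> (\<forall>\<xi>. (sin (fst (\<gamma> \<xi>)))\<^sup>2 * snd (snd (\<gamma> \<xi>)) = k)"
    unfolding \<theta>_def q_def by blast
qed

text \<open>Eliminating q by the first integral leaves a scalar second-order equation for \<theta>
  with conserved energy \<open>En\<close>. Multiplied by 2 sin^2 \<theta>, the energy relation
  becomes polynomial in u = cos \<theta>.\<close>

lemma cs_solution_imp_lift:
  assumes cs: "cs_solution h \<Omega> \<mu> \<gamma>"
  shows "\<exists>k E u w. k \<noteq> 0 \<and> profile (h - \<Omega>) \<mu> E k u w \<and> \<gamma> = lift k u w"
proof -
  define \<theta> p q where "\<theta> x = fst (\<gamma> x)" and "p x = fst (snd (\<gamma> x))" and "q x = snd (snd (\<gamma> x))" for x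
  define H where "H = h - \<Omega>"
  obtain k where k: "k \<noteq> 0" "\<And>x. (sin (\<theta> x))\<^sup>2 * q x = k"
    using cs_solution_first_integral(1)[OF cs] unfolding \<theta>_def q_def by blast
  have r: "0 < \<theta> x" "\<theta> x < pi" for x
    using cs_solution_first_integral(2)[OF cs] unfolding \<theta>_def by auto
  have d\<theta>: "(\<theta> has_real_derivative p x) (at x)" for x
    using cs_solution_first_integral(3)[OF cs] by (simp add: \<theta>_def[abs_def] p_def)
  have dp: "(p has_real_derivative sin (\<theta> x) * (H + ((q x)\<^sup>2 - \<mu>) * cos (\<theta> x))) (at x)" for x
    using cs_solution_first_integral(4)[OF cs] by (simp add: \<theta>_def[abs_def] p_def[abs_def] q_def H_def)
  define s c where "s x = sin (\<theta> x)" and "c x = cos (\<theta> x)" for x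
  have s0: "s x > 0" for x unfolding s_def using r by (intro sin_gt_zero) auto
  have sc: "(s x)\<^sup>2 = 1 - (c x)\<^sup>2" for x by (simp add: s_def c_def sin_squared_eq)
  have q: "q x = k / (s x)\<^sup>2" for x using k(2)[of x] s0[of x] by (simp add: s_def field_simps)
  have ds: "(s has_real_derivative c x * p x) (at x)" and dc: "(c has_real_derivative - (s x * p x)) (at x)" for x
    unfolding s_def[abs_def] c_def[abs_def] using d\<theta>[of x] by (auto intro!: derivative_eq_intros)
  define En where "En x = (p x)\<^sup>2 / 2 + H * c x - \<mu> / 2 * (c x)\<^sup>2 + k\<^sup>2 / (2 * (s x)\<^sup>2)" for x
  have "(En has_real_derivative 0) (at x)" for x
  proof -
    have "(En has_real_derivative p x * (s x * (H + ((q x)\<^sup>2 - \<mu>) * c x)) + H * (- (s x * p x)) - \<mu> / 2 * (2 * c x * (- (s x * p x)))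
        + (0 * (2 * (s x)\<^sup>2) - k\<^sup>2 * (2 * (2 * s x * (c x * p x)))) / ((2 * (s x)\<^sup>2) * (2 * (s x)\<^sup>2))) (at x)"
      unfolding En_def[abs_def]
      using dp[of x, folded s_def c_def] ds[of x] dc[of x] s0[of x]
      by (intro DERIV_add DERIV_diff DERIV_cmult DERIV_divide DERIV_const) (auto intro!: derivative_eq_intros)
    moreover have "p x * (s x * (H + ((q x)\<^sup>2 - \<mu>) * c x)) + H * (- (s x * p x)) - \<mu> / 2 * (2 * c x * (- (s x * p x)))
        + (0 * (2 * (s x)\<^sup>2) - k\<^sup>2 * (2 * (2 * s x * (c x * p x)))) / ((2 * (s x)\<^sup>2) * (2 * (s x)\<^sup>2)) = 0"
      unfolding q using s0[of x] by (simp add: field_simps power2_eq_square)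
    ultimately show ?thesis by simp
  qed
  hence En: "En x = En 0" for x using DERIV_isconst_all by blast
  define E where "E = En 0"
  define w where "w x = - (s x * p x)" for x
  have E: "2 * E - 2 * H * c x + \<mu> * (c x)\<^sup>2 = (p x)\<^sup>2 + k\<^sup>2 / (s x)\<^sup>2" for x
    using En[of x] by (simp add: E_def En_def)
  have "profile H \<mu> E k c w"
    unfolding profile_def
  proof (intro allI conjI)
    fix x
    have "(c x)\<^sup>2 < 1" using sc[of x] s0[of x] by (smt (verit) zero_less_power)
    thus "- 1 < c x" "c x < 1" by (auto simp: abs_square_less_1 abs_less_iff)
    show "(c has_real_derivative w x) (at x)" using dc by (simp add: w_def)
    have h: "hpot' H \<mu> E (c x) = - c x * (2 * E - 2 * H * c x + \<mu> * (c x)\<^sup>2) + (1 - (c x)\<^sup>2) * (\<mu> * c x - H)"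
      by (simp add: hpot'_def algebra_simps power2_eq_square power3_eq_cube)
    have "(w has_real_derivative - (c x * p x * p x + s x * (s x * (H + ((q x)\<^sup>2 - \<mu>) * c x)))) (at x)"
      unfolding w_def[abs_def] using ds[of x] dp[of x, folded s_def c_def] by (auto intro!: derivative_eq_intros simp: algebra_simps)
    moreover have "- (c x * p x * p x + s x * (s x * (H + ((q x)\<^sup>2 - \<mu>) * c x))) = hpot' H \<mu> E (c x)"
      unfolding h E sc[symmetric] q using s0[of x] by (simp add: field_simps power2_eq_square)
    ultimately show "(w has_real_derivative hpot' H \<mu> E (c x)) (at x)" by simp
    show "(w x)\<^sup>2 = pot H \<mu> E k (c x)"
      unfolding pot_def E sc[symmetric] w_def using s0[of x] by (simp add: field_simps power2_eq_square)
  qed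
  moreover have "\<gamma> = lift k c w"
  proof
    fix x
    have "sqrt (1 - (c x)\<^sup>2) = s x" unfolding sc[symmetric] using s0[of x] by simp
    moreover have "arccos (c x) = \<theta> x" unfolding c_def using r[of x] by (intro arccos_cos) auto
    ultimately have "lift k c w x = (\<theta> x, p x, q x)"
      unfolding lift_def q w_def sc[symmetric] using s0[of x] by simp
    thus "\<gamma> x = lift k c w x" by (simp add: \<theta>_def p_def q_def)
  qed
  ultimately show ?thesis using k(1) unfolding H_def by blast
qed

lemma lift_cs_solution:
  assumes pr: "profile (h - \<Omega>) \<mu> E k u w" and k: "k \<noteq> 0"
  shows "cs_solution h \<Omega> \<mu> (lift k u w)"
proof -
  define H where "H = h - \<Omega>"
  define s where "s x = sqrt (1 - (u x)\<^sup>2)" for x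
  have r: "- 1 < u x" "u x < 1" for x using profileD(1,2)[OF pr] by auto
  have pos: "1 - (u x)\<^sup>2 > 0" for x using one_minus_sq_pos r by blast
  have s0: "s x > 0" for x using pos by (simp add: s_def)
  have s2: "(s x)\<^sup>2 = 1 - (u x)\<^sup>2" for x using pos[of x] by (simp add: s_def)
  have du: "(u has_real_derivative w x) (at x)" and dw: "(w has_real_derivative hpot' H \<mu> E (u x)) (at x)"
    and w2: "(w x)\<^sup>2 = pot H \<mu> E k (u x)" for x using profileD(3-5)[OF pr] by (auto simp: H_def)
  have ds: "(s has_real_derivative - (u x * w x / s x)) (at x)" for x
  proof -
    have "((\<lambda>x. 1 - (u x)\<^sup>2) has_real_derivative - (2 * u x * w x)) (at x)"
      using du[of x] by (auto intro!: derivative_eq_intros)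
    from DERIV_chain2[OF DERIV_real_sqrt[OF pos[of x]] this]
    have "(s has_real_derivative inverse (s x) / 2 * - (2 * u x * w x)) (at x)" by (simp only: s_def[abs_def])
    moreover have "inverse (s x) / 2 * - (2 * u x * w x) = - (u x * w x / s x)" by (simp add: field_simps)
    ultimately show ?thesis by (simp only:)
  qed
  define \<theta> where "\<theta> x = arccos (u x)" for x
  define p where "p x = - w x / s x" for x
  define q where "q x = k / (s x)\<^sup>2" for x
  have lift: "lift k u w = (\<lambda>x. (\<theta> x, p x, q x))"
    unfolding \<theta>_def p_def q_def s2 unfolding lift_def s_def ..
  have c: "cos (\<theta> x) = u x" and sn: "sin (\<theta> x) = s x" for x
    using r[of x] by (simp_all add: \<theta>_def s_def cos_arccos sin_arccos)
  have \<theta>r: "0 < \<theta> x" "\<theta> x < pi" for x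
    using arccos_lt_bounded[of "u x"] r[of x] by (auto simp: \<theta>_def)
  have d\<theta>: "(\<theta> has_real_derivative p x) (at x)" for x
    using DERIV_chain2[OF DERIV_arccos[OF r] du] s0[of x]
    by (simp add: \<theta>_def[abs_def] p_def s_def field_simps)
  have dp: "(p has_real_derivative s x * (H + ((q x)\<^sup>2 - \<mu>) * u x)) (at x)" for x
  proof -
    have "(p has_real_derivative (- hpot' H \<mu> E (u x) * s x - - w x * (- (u x * w x / s x))) / (s x * s x)) (at x)"
      unfolding p_def[abs_def] using s0[of x] by (intro DERIV_divide DERIV_minus dw ds) auto
    moreover have "(- hpot' H \<mu> E (u x) * s x - - w x * (- (u x * w x / s x))) / (s x * s x) = s x * (H + ((q x)\<^sup>2 - \<mu>) * u x)"
    proof -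
      \<comment> \<open>Written with this factor of \<open>pot\<close>, the energy cancels from the
        equation for \<open>p\<close>.\<close>
      define Y where "Y = 2 * E - 2 * H * u x + \<mu> * (u x)\<^sup>2"
      have h: "hpot' H \<mu> E (u x) = - u x * Y + (s x)\<^sup>2 * (\<mu> * u x - H)"
        unfolding s2 Y_def hpot'_def by (simp add: algebra_simps power2_eq_square power3_eq_cube)
      have w: "(w x)\<^sup>2 = (s x)\<^sup>2 * Y - k\<^sup>2" by (simp add: w2 pot_def s2 Y_def)
      have "- hpot' H \<mu> E (u x) * s x - - w x * (- (u x * w x / s x)) = - hpot' H \<mu> E (u x) * s x - u x * (w x)\<^sup>2 / s x"
        by (simp add: power2_eq_square)
      also have "\<dots> = s x * s x * (s x * (H + ((q x)\<^sup>2 - \<mu>) * u x))"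
        unfolding h w q_def using s0[of x] by (simp add: field_simps power2_eq_square)
      finally show ?thesis using s0[of x] by simp
    qed
    ultimately show ?thesis by simp
  qed
  have dq: "(q has_real_derivative - 2 * cot (\<theta> x) * p x * q x) (at x)" for x
  proof -
    have "((\<lambda>x. (s x)\<^sup>2) has_real_derivative 2 * s x * (- (u x * w x / s x))) (at x)"
      using ds[of x] by (auto intro!: derivative_eq_intros)
    hence "(q has_real_derivative (0 * (s x)\<^sup>2 - k * (2 * s x * (- (u x * w x / s x)))) / ((s x)\<^sup>2 * (s x)\<^sup>2)) (at x)"
      unfolding q_def[abs_def] using s0[of x] by (intro DERIV_divide DERIV_const) auto
    moreover have "(0 * (s x)\<^sup>2 - k * (2 * s x * (- (u x * w x / s x)))) / ((s x)\<^sup>2 * (s x)\<^sup>2) = - 2 * cot (\<theta> x) * p x * q x"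
      using s0[of x] by (simp add: cot_def c sn p_def q_def field_simps power2_eq_square)
    ultimately show ?thesis by simp
  qed
  have "q x \<noteq> 0" for x using k s0[of x] by (simp add: q_def)
  thus ?thesis
    unfolding lift cs_solution_def cs_field_def case_prod_conv has_vector_derivative_triple phase_space_def
    using \<theta>r d\<theta> dp dq by (auto simp: c sn H_def)
qed

lemma lift_first_integral:
  assumes "profile H \<mu> E k u w"
  shows "first_integral (lift k u w \<xi>) = \<bar>k\<bar>"
proof -
  have r: "- 1 < u \<xi>" "u \<xi> < 1" using profileD(1,2)[OF assms] by auto
  have "(sin (arccos (u \<xi>)))\<^sup>2 = 1 - (u \<xi>)\<^sup>2"
    using r one_minus_sq_pos[OF r] by (simp add: sin_arccos)
  thus ?thesis using one_minus_sq_pos[OF r] by (simp add: lift_def first_integral_def abs_divide)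
qed

lemma lift_tendsto:
  assumes "(u \<longlongrightarrow> L) F" "(w \<longlongrightarrow> 0) F" and L: "- 1 < L" "L < 1"
  shows "(lift k u w \<longlongrightarrow> (arccos L, 0, k / (1 - L\<^sup>2))) F"
proof -
  have nz: "1 - L\<^sup>2 > 0" using one_minus_sq_pos[OF L] .
  have "((\<lambda>\<xi>. arccos (u \<xi>)) \<longlongrightarrow> arccos L) F"
    by (rule isCont_tendsto_compose[OF isCont_arccos[OF L] assms(1)])
  moreover have "((\<lambda>\<xi>. - w \<xi> / sqrt (1 - (u \<xi>)\<^sup>2)) \<longlongrightarrow> - 0 / sqrt (1 - L\<^sup>2)) F"
    using nz by (intro tendsto_intros assms) auto
  moreover have "((\<lambda>\<xi>. k / (1 - (u \<xi>)\<^sup>2)) \<longlongrightarrow> k / (1 - L\<^sup>2)) F"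
    using nz by (intro tendsto_intros assms) auto
  ultimately show ?thesis unfolding lift_def by (auto intro!: tendsto_Pair)
qed

lemma lift_fst: "profile H \<mu> E k u w \<Longrightarrow> cos (fst (lift k u w \<xi>)) = u \<xi>"
  using profileD(1,2)[of H \<mu> E k u w \<xi>] by (simp add: lift_def cos_arccos)

lemma lift_constant:
  assumes "profile H \<mu> E k u w"
  shows "lift k u w constant_on UNIV \<longleftrightarrow> u constant_on UNIV"
proof
  assume "lift k u w constant_on UNIV"
  then obtain y where "\<And>\<xi>. lift k u w \<xi> = y" by (auto simp: constant_on_def)
  hence "u \<xi> = cos (fst y)" for \<xi> using lift_fst[OF assms] by metis
  thus "u constant_on UNIV" by (auto simp: constant_on_def)
next
  assume "u constant_on UNIV"
  then obtain y where y: "\<And>\<xi>. u \<xi> = y" by (auto simp: constant_on_def)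
  have "u = (\<lambda>_. y)" using y by auto
  hence "(u has_real_derivative 0) (at \<xi>)" for \<xi> by simp
  hence "w \<xi> = 0" for \<xi> using profileD(3)[OF assms] DERIV_unique by blast
  thus "lift k u w constant_on UNIV" using y by (auto simp: constant_on_def lift_def)
qed

lemma equilibrium_iff:
  "(\<theta>, p, q) \<in> cs_equilibria h \<Omega> \<mu> \<longleftrightarrow>
    0 < \<theta> \<and> \<theta> < pi \<and> q \<noteq> 0 \<and> p = 0 \<and> h - \<Omega> = (\<mu> - q\<^sup>2) * cos \<theta>"
proof -
  have "sin \<theta> * (h - \<Omega> + (q\<^sup>2 - \<mu>) * cos \<theta>) = 0 \<longleftrightarrow> h - \<Omega> = (\<mu> - q\<^sup>2) * cos \<theta>" if "0 < \<theta>" "\<theta> < pi"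
  proof -
    have "sin \<theta> * (h - \<Omega> + (q\<^sup>2 - \<mu>) * cos \<theta>) = 0 \<longleftrightarrow> h - \<Omega> + (q\<^sup>2 - \<mu>) * cos \<theta> = 0"
      using sin_gt_zero[OF that] by simp
    also have "\<dots> \<longleftrightarrow> h - \<Omega> = (\<mu> - q\<^sup>2) * cos \<theta>" by (auto simp: algebra_simps)
    finally show ?thesis .
  qed
  thus ?thesis by (auto simp: cs_equilibria_def cs_field_def phase_space_def zero_prod_def)
qed

text \<open>Translates the non-periodic profiles back to the phase space: the double root is an
  equilibrium, the orbit is homoclinic to it, and nonnegativity of the quadratic Taylor coefficient
  becomes the weak stability inequality.\<close>

lemma cs_nonperiodic:
  assumes nc: "nonconst_cs_solution h \<Omega> \<mu> \<gamma>" and np: "\<not> periodic \<gamma>"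
  shows "\<exists>k E u w a L q. k \<noteq> 0 \<and> \<gamma> = lift k u w \<and> profile (h - \<Omega>) \<mu> E k u w \<and> w a = 0 \<and> u a \<noteq> L \<and> - 1 < L \<and> L < 1 \<and>
     q = k / (1 - L\<^sup>2) \<and> h - \<Omega> = (\<mu> - q\<^sup>2) * L \<and> 2 * E = q\<^sup>2 * (1 - L\<^sup>2) + 2 * (h - \<Omega>) * L - \<mu> * L\<^sup>2 \<and>
     (2 * q * L)\<^sup>2 \<le> (\<mu> - q\<^sup>2) * (1 - L\<^sup>2) \<and> q\<^sup>2 < \<mu> \<and> homoclinic_to h \<Omega> \<mu> (arccos L, 0, q) \<gamma>"
proof -
  have cs: "cs_solution h \<Omega> \<mu> \<gamma>" and ncn: "\<not> \<gamma> constant_on UNIV" using nc by (auto simp: nonconst_cs_solution_def)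
  obtain k E u w where k: "k \<noteq> 0" and pr: "profile (h - \<Omega>) \<mu> E k u w" and \<gamma>: "\<gamma> = lift k u w"
    using cs_solution_imp_lift[OF cs] by blast
  have nu: "\<not> u constant_on UNIV" using ncn lift_constant[OF pr] \<gamma> by simp
  have nu': "\<not> (\<exists>T>0. \<forall>\<xi>. u (\<xi> + T) = u \<xi> \<and> w (\<xi> + T) = w \<xi>)"
  proof
    assume "\<exists>T>0. \<forall>\<xi>. u (\<xi> + T) = u \<xi> \<and> w (\<xi> + T) = w \<xi>"
    then obtain T where "T > 0" "\<And>\<xi>. u (\<xi> + T) = u \<xi>" "\<And>\<xi>. w (\<xi> + T) = w \<xi>" by blast
    hence "periodic \<gamma>" unfolding periodic_def \<gamma> by (intro exI[of _ T]) (simp add: lift_def)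
    thus False using np by blast
  qed
  obtain a L where a: "w a = 0" "u a \<noteq> L" and L: "- 1 < L" "L < 1" and lim: "(u \<longlongrightarrow> L) at_top" "(u \<longlongrightarrow> L) at_bot"
    "(w \<longlongrightarrow> 0) at_top" "(w \<longlongrightarrow> 0) at_bot" and P: "pot (h - \<Omega>) \<mu> E k L = 0" "hpot' (h - \<Omega>) \<mu> E L = 0"
    and r0: "- 6 * \<mu> * L\<^sup>2 + 6 * (h - \<Omega>) * L + \<mu> - 2 * E \<ge> 0"
    using profile_nonperiodic[OF pr k nu nu'] by blast
  define q where "q = k / (1 - L\<^sup>2)"
  have s: "1 - L\<^sup>2 > 0" by (rule one_minus_sq_pos[OF L])
  have q0: "q \<noteq> 0" using k s by (simp add: q_def)
  have HE: "h - \<Omega> = (\<mu> - q\<^sup>2) * L" "2 * E = q\<^sup>2 * (1 - L\<^sup>2) + 2 * (h - \<Omega>) * L - \<mu> * L\<^sup>2"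
    using double_root_iff(1)[OF k L q_def] P by blast+
  have S: "(2 * q * L)\<^sup>2 \<le> (\<mu> - q\<^sup>2) * (1 - L\<^sup>2)"
    using double_root_iff(2)[OF k L q_def P] r0 by linarith
  have "0 \<le> (\<mu> - q\<^sup>2) * (1 - L\<^sup>2)" using S order_trans[OF zero_le_power2] by blast
  hence le: "q\<^sup>2 \<le> \<mu>" using s by (simp add: zero_le_mult_iff)
  \<comment> \<open>Equality would force L = 0 and h = \<Omega>, and then \<open>pot\<close> is -
    \<mu> u^4, which is never positive; the orbit would be constant.\<close>
  have "q\<^sup>2 \<noteq> \<mu>"
  proof
    assume e: "q\<^sup>2 = \<mu>"
    hence "(2 * q * L)\<^sup>2 \<le> 0" using S by simp
    hence L0: "L = 0" using q0 by simp
    have "(w \<xi>)\<^sup>2 = - \<mu> * (u \<xi>) ^ 4" for \<xi>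
      using HE e unfolding profileD(5)[OF pr] pot_def L0 by (simp add: q_def L0 algebra_simps power2_eq_square power4_eq_xxxx)
    moreover have "- \<mu> * (u \<xi>) ^ 4 \<le> 0" for \<xi> using e zero_le_power2[of q] by (simp add: mult_nonneg_nonneg)
    ultimately have "w \<xi> = 0" for \<xi> by (metis power2_less_eq_zero_iff)
    hence "(u has_real_derivative 0) (at \<xi>)" for \<xi> using profileD(3)[OF pr] by metis
    hence "u x = u y" for x y using DERIV_isconst_all by blast
    thus False using nu unfolding constant_on_def by blast
  qed
  hence "q\<^sup>2 < \<mu>" using le by simp
  moreover have "homoclinic_to h \<Omega> \<mu> (arccos L, 0, q) \<gamma>"
    unfolding homoclinic_to_def q_def using nc lim L by (auto simp: \<gamma> intro!: lift_tendsto)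
  ultimately show ?thesis using k \<gamma> pr a L q_def HE S by blast
qed

section \<open>The wavetrain curve through q = 0 and its intersections with the level curve\<close>

text \<open>The explicit form of the component of the wavetrain curves that meets q = 0. The bound
  on q^2 is where H / (\<mu> - q^2) lies strictly between -1 and 1.\<close>

definition axis_curve :: "real \<Rightarrow> real \<Rightarrow> (real \<times> real) set" where
  "axis_curve H \<mu> = {(q, \<theta>). 0 < \<theta> \<and> \<theta> < pi \<and> q\<^sup>2 < \<mu> - \<bar>H\<bar> \<and> cos \<theta> = H / (\<mu> - q\<^sup>2)}"

text \<open>The candidate is a graph over an interval, hence connected. No wavetrain has q^2 = \<mu>
  - |H|, since cos \<theta> would be 1 or -1 there, so the two lines q = r and q = -r separate it
  from the other branches.\<close>

lemma axis_components_eq: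
  assumes H: "\<bar>h - \<Omega>\<bar> < \<mu>"
  shows "axis_components h \<Omega> \<mu> = {axis_curve (h - \<Omega>) \<mu>}"
proof -
  define H' where "H' = h - \<Omega>"
  define W where "W = wavetrain_curves h \<Omega> \<mu>"
  define A where "A = axis_curve H' \<mu>"
  define r where "r = sqrt (\<mu> - \<bar>H'\<bar>)"
  have \<mu>: "\<bar>H'\<bar> < \<mu>" using H by (simp add: H'_def)
  have r: "r > 0" "r\<^sup>2 = \<mu> - \<bar>H'\<bar>" using \<mu> by (auto simp: r_def)
  have b: "\<bar>H' / (\<mu> - q\<^sup>2)\<bar> < 1" if "q\<^sup>2 < \<mu> - \<bar>H'\<bar>" for q
    using that by (simp add: abs_divide)
  have I: "q\<^sup>2 < \<mu> - \<bar>H'\<bar> \<longleftrightarrow> q \<in> {- r<..<r}" for q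
  proof -
    have "q\<^sup>2 < r\<^sup>2 \<longleftrightarrow> \<bar>q\<bar> < r"
      using r(1) power2_less_imp_less[of "\<bar>q\<bar>" r] power_strict_mono[of "\<bar>q\<bar>" r 2] by auto
    thus ?thesis unfolding r(2)[symmetric] by (auto simp: abs_less_iff)
  qed
  have Aimg: "A = (\<lambda>q. (q, arccos (H' / (\<mu> - q\<^sup>2)))) ` {- r<..<r}"
  proof (intro equalityI subsetI)
    fix x assume "x \<in> A"
    then obtain q \<theta> where x: "x = (q, \<theta>)" "0 < \<theta>" "\<theta> < pi" "q\<^sup>2 < \<mu> - \<bar>H'\<bar>" "cos \<theta> = H' / (\<mu> - q\<^sup>2)"
      by (auto simp: A_def axis_curve_def)
    have "arccos (cos \<theta>) = \<theta>" using x by (intro arccos_cos) auto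
    thus "x \<in> (\<lambda>q. (q, arccos (H' / (\<mu> - q\<^sup>2)))) ` {- r<..<r}" using x I by auto
  next
    fix x assume "x \<in> (\<lambda>q. (q, arccos (H' / (\<mu> - q\<^sup>2)))) ` {- r<..<r}"
    then obtain q where q: "q\<^sup>2 < \<mu> - \<bar>H'\<bar>" "x = (q, arccos (H' / (\<mu> - q\<^sup>2)))" using I by auto
    define z where "z = H' / (\<mu> - q\<^sup>2)"
    have "- 1 < z" "z < 1" using b[OF q(1), folded z_def] by auto
    thus "x \<in> A"
      using arccos_lt_bounded[of z] q by (simp add: A_def axis_curve_def cos_arccos flip: z_def)
  qed
  have Ac: "connected A"
    unfolding Aimg
  proof (intro connected_continuous_image continuous_intros connected_Ioo ballI)
    fix q assume "q \<in> {- r<..<r}"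
    hence q: "q\<^sup>2 < \<mu> - \<bar>H'\<bar>" using I by blast
    thus "\<mu> - q\<^sup>2 \<noteq> 0" by auto
    define z where "z = H' / (\<mu> - q\<^sup>2)"
    have "- 1 \<le> z \<and> z \<le> 1" using b[OF q, folded z_def] by auto
    thus "- 1 \<le> H' / (\<mu> - q\<^sup>2) \<and> H' / (\<mu> - q\<^sup>2) \<le> 1" unfolding z_def .
  qed
  have AW: "A \<subseteq> W" by (auto simp: A_def W_def axis_curve_def wavetrain_curves_def H'_def)
  have sep: "q\<^sup>2 \<noteq> \<mu> - \<bar>H'\<bar>" if "(q, \<theta>) \<in> W" for q \<theta>
  proof
    assume e: "q\<^sup>2 = \<mu> - \<bar>H'\<bar>"
    have w: "0 < \<theta>" "\<theta> < pi" "q\<^sup>2 \<noteq> \<mu>" "cos \<theta> = H' / (\<mu> - q\<^sup>2)"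
      using that by (auto simp: W_def wavetrain_curves_def H'_def)
    have "\<bar>cos \<theta>\<bar> = 1" using w(3) unfolding w(4) e by (simp add: abs_divide)
    moreover have "sin \<theta> > 0" using w by (intro sin_gt_zero) auto
    ultimately show False using sin_cos_squared_add[of \<theta>] by (metis abs_1 abs_square_eq_1 add_cancel_left_left less_irrefl power2_eq_1_iff power_eq_0_iff sin_cos_squared_add2 abs_eq_iff)
  qed
  define p where "p = (0 :: real, arccos (H' / \<mu>))"
  have pA: "p \<in> A" unfolding Aimg p_def using r by (intro image_eqI[of _ _ 0]) auto
  have sub: "K \<subseteq> A" if K: "K \<in> components W" "K \<inter> {(q, \<theta>). q = 0} \<noteq> {}" for K
  proof
    fix x assume x: "x \<in> K"
    have "\<exists>y\<in>K. fst y = 0" using K(2) by force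
    then obtain y where y: "y \<in> K" "fst y = 0" by blast
    have KW: "K \<subseteq> W" "connected K" using K in_components_subset in_components_connected by blast+
    have cf: "connected (fst ` K)" by (intro connected_continuous_image continuous_intros KW)
    have m: "fst x \<in> fst ` K" "fst y \<in> fst ` K" using x y by blast+
    have nr: "r \<notin> fst ` K" "- r \<notin> fst ` K" using sep KW r(2) by force+
    have "fst x \<in> {- r<..<r}"
    proof (rule ccontr)
      assume "fst x \<notin> {- r<..<r}"
      hence "fst x \<ge> r \<or> fst x \<le> - r" by auto
      thus False
      proof
        assume "fst x \<ge> r"
        moreover have "fst y \<le> r" using y(2) r(1) by simp
        ultimately have "r \<in> fst ` K" using connectedD_interval[OF cf m(2,1)] by blast
        thus False using nr by blast
      next
        assume "fst x \<le> - r"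
        moreover have "- r \<le> fst y" using y(2) r(1) by simp
        ultimately have "- r \<in> fst ` K" using connectedD_interval[OF cf m(1,2)] by blast
        thus False using nr by blast
      qed
    qed
    moreover have "x \<in> W" using x KW by blast
    ultimately show "x \<in> A" using I[of "fst x"] by (cases x) (auto simp: A_def W_def axis_curve_def wavetrain_curves_def H'_def)
  qed
  have eq: "K = A" if K: "K \<in> components W" "K \<inter> {(q, \<theta>). q = 0} \<noteq> {}" for K
  proof
    show "K \<subseteq> A" using sub[OF K] .
    have "K \<noteq> {}" using K by blast
    hence "K \<inter> A \<noteq> {}" using sub[OF K] by blast
    thus "A \<subseteq> K" using components_maximal[OF K(1) Ac AW] by blast
  qed
  have "connected_component_set W p \<in> components W" using pA AW by (intro componentsI) blast
  moreover have "p \<in> connected_component_set W p" using subsetD[OF AW pA] by (simp add: connected_component_refl)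
  moreover have "p \<in> {(q, \<theta>). q = 0}" by (simp add: p_def)
  ultimately have "connected_component_set W p \<in> axis_components h \<Omega> \<mu>"
    unfolding axis_components_def W_def[symmetric] by blast
  moreover have "axis_components h \<Omega> \<mu> \<subseteq> {A}" using eq unfolding axis_components_def W_def by auto
  ultimately have "axis_components h \<Omega> \<mu> = {A}" by (metis empty_iff subset_singletonD)
  thus ?thesis unfolding A_def H'_def .
qed

text \<open>The form without denominators. For q^2 < \<mu> the sharper bound \<mu> - |H| is
  automatic because |cos \<theta>| < 1.\<close>

lemma axis_curve_iff:
  assumes "\<bar>H\<bar> < \<mu>"
  shows "(q, \<theta>) \<in> axis_curve H \<mu> \<longleftrightarrow> 0 < \<theta> \<and> \<theta> < pi \<and> q\<^sup>2 < \<mu> \<and> H = (\<mu> - q\<^sup>2) * cos \<theta>"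
proof
  assume "(q, \<theta>) \<in> axis_curve H \<mu>"
  thus "0 < \<theta> \<and> \<theta> < pi \<and> q\<^sup>2 < \<mu> \<and> H = (\<mu> - q\<^sup>2) * cos \<theta>" by (auto simp: axis_curve_def)
next
  assume a: "0 < \<theta> \<and> \<theta> < pi \<and> q\<^sup>2 < \<mu> \<and> H = (\<mu> - q\<^sup>2) * cos \<theta>"
  have "\<bar>cos \<theta>\<bar> < 1"
  proof -
    have "sin \<theta> > 0" using a by (intro sin_gt_zero) auto
    hence "(cos \<theta>)\<^sup>2 < 1" using sin_cos_squared_add[of \<theta>] zero_less_power[of "sin \<theta>" 2] by linarith
    thus ?thesis by (simp add: abs_square_less_1)
  qed
  hence "\<bar>H\<bar> < \<mu> - q\<^sup>2" using a by (simp add: abs_mult)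
  thus "(q, \<theta>) \<in> axis_curve H \<mu>" using a by (simp add: axis_curve_def)
qed

lemma tangent_DERIV:
  fixes \<gamma> :: "real \<Rightarrow> real \<times> real"
  assumes "(\<gamma> has_vector_derivative v) (at 0)"
  shows "((\<lambda>s. fst (\<gamma> s)) has_real_derivative fst v) (at 0)" "((\<lambda>s. snd (\<gamma> s)) has_real_derivative snd v) (at 0)"
  using bounded_linear.has_vector_derivative[OF bounded_linear_fst assms] bounded_linear.has_vector_derivative[OF bounded_linear_snd assms]
  by (simp_all add: has_real_derivative_iff_has_vector_derivative)

text \<open>A function constant on \<open>S\<close> is eventually constant along every curve that
  defines a tangent vector. Assuming the derivative along curves allows it to be computed coordinate
  by coordinate.\<close>

lemma tangent_annihilated:
  fixes G :: "real \<times> real \<Rightarrow> real"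
  assumes v: "v \<in> tangent_vectors S a" and G: "\<And>x. x \<in> S \<Longrightarrow> G x = c"
    and d: "\<And>\<gamma>. \<gamma> 0 = a \<Longrightarrow> (\<gamma> has_vector_derivative v) (at 0) \<Longrightarrow> ((\<lambda>s::real. G (\<gamma> s)) has_real_derivative D) (at 0)"
  shows "D = 0"
proof -
  obtain \<gamma> where \<gamma>: "\<gamma> 0 = a" "\<forall>\<^sub>F s in nhds 0. \<gamma> s \<in> S" "(\<gamma> has_vector_derivative v) (at 0)"
    using v by (auto simp: tangent_vectors_def)
  have "\<forall>\<^sub>F s in nhds 0. G (\<gamma> s) = c" using \<gamma>(2) by eventually_elim (rule G)
  hence "((\<lambda>s. G (\<gamma> s)) has_real_derivative 0) (at 0)"
    by (subst DERIV_cong_ev[OF refl _ refl, where g="\<lambda>_. c"]) auto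
  thus ?thesis using d[OF \<gamma>(1,3)] DERIV_unique by blast
qed

text \<open>The curves are level sets of q sin^2 \<theta> and (\<mu> - q^2) cos \<theta>. Equality
  makes the two gradients proportional, so that all tangent vectors lie in one line
  \<open>?V\<close>, which does not contain (1, 0).\<close>

lemma transversal_nondegenerate:
  assumes H: "\<bar>H\<bar> < \<mu>" and C: "C > 0" and tr: "transversely_intersects (level_curve C) (axis_curve H \<mu>)"
    and a: "(q, \<theta>) \<in> level_curve C" "(q, \<theta>) \<in> axis_curve H \<mu>"
  shows "(\<mu> - q\<^sup>2) * (sin \<theta>)\<^sup>2 \<noteq> (2 * q * cos \<theta>)\<^sup>2"
proof
  assume deg: "(\<mu> - q\<^sup>2) * (sin \<theta>)\<^sup>2 = (2 * q * cos \<theta>)\<^sup>2"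
  have \<theta>: "0 < \<theta>" "\<theta> < pi" "q\<^sup>2 < \<mu>" "H = (\<mu> - q\<^sup>2) * cos \<theta>" using a(2) unfolding axis_curve_iff[OF H] by auto
  have s0: "sin \<theta> > 0" using \<theta> by (intro sin_gt_zero) auto
  have level: "q * (sin \<theta>)\<^sup>2 = C" if "(q, \<theta>) \<in> level_curve C" for q \<theta>
    using that sin_gt_zero[of \<theta>] by (auto simp: level_curve_def)
  let ?V = "{v :: real \<times> real. fst v * (sin \<theta>)\<^sup>2 + q * (2 * sin \<theta> * cos \<theta> * snd v) = 0}"
  have 1: "tangent_vectors (level_curve C) (q, \<theta>) \<subseteq> ?V"
  proof
    fix v assume v: "v \<in> tangent_vectors (level_curve C) (q, \<theta>)"
    have "fst v * (sin \<theta>)\<^sup>2 + q * (2 * sin \<theta> * cos \<theta> * snd v) = 0"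
    proof (rule tangent_annihilated[OF v, where G="\<lambda>x. fst x * (sin (snd x))\<^sup>2" and c=C])
      fix \<gamma> :: "real \<Rightarrow> real \<times> real" assume g: "\<gamma> 0 = (q, \<theta>)" "(\<gamma> has_vector_derivative v) (at 0)"
      show "((\<lambda>s. fst (\<gamma> s) * (sin (snd (\<gamma> s)))\<^sup>2) has_real_derivative fst v * (sin \<theta>)\<^sup>2 + q * (2 * sin \<theta> * cos \<theta> * snd v)) (at 0)"
        using tangent_DERIV[OF g(2)] g(1) by (auto intro!: derivative_eq_intros)
    qed (use level in auto)
    thus "v \<in> ?V" by simp
  qed
  have 2: "tangent_vectors (axis_curve H \<mu>) (q, \<theta>) \<subseteq> ?V"
  proof
    fix v assume v: "v \<in> tangent_vectors (axis_curve H \<mu>) (q, \<theta>)"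
    have "- (2 * q * fst v) * cos \<theta> + (\<mu> - q\<^sup>2) * (- sin \<theta> * snd v) = 0"
    proof (rule tangent_annihilated[OF v, where G="\<lambda>x. (\<mu> - (fst x)\<^sup>2) * cos (snd x)" and c=H])
      fix \<gamma> :: "real \<Rightarrow> real \<times> real" assume g: "\<gamma> 0 = (q, \<theta>)" "(\<gamma> has_vector_derivative v) (at 0)"
      show "((\<lambda>s. (\<mu> - (fst (\<gamma> s))\<^sup>2) * cos (snd (\<gamma> s))) has_real_derivative - (2 * q * fst v) * cos \<theta> + (\<mu> - q\<^sup>2) * (- sin \<theta> * snd v)) (at 0)"
        using tangent_DERIV[OF g(2)] g(1) by (auto intro!: derivative_eq_intros)
    qed (use axis_curve_iff[OF H] in auto)
    hence e: "(\<mu> - q\<^sup>2) * sin \<theta> * snd v = - (2 * q * cos \<theta> * fst v)" by (simp add: algebra_simps)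
    have "(\<mu> - q\<^sup>2) * (fst v * (sin \<theta>)\<^sup>2 + q * (2 * sin \<theta> * cos \<theta> * snd v)) =
        fst v * ((\<mu> - q\<^sup>2) * (sin \<theta>)\<^sup>2) + 2 * q * cos \<theta> * ((\<mu> - q\<^sup>2) * sin \<theta> * snd v)"
      by (simp add: algebra_simps)
    also have "\<dots> = 0" unfolding e deg by (simp add: power2_eq_square)
    finally show "v \<in> ?V" using \<theta>(3) by simp
  qed
  have sp: "subspace ?V" by (auto simp: subspace_def algebra_simps) (simp_all add: distrib_left[symmetric])
  have "span (tangent_vectors (level_curve C) (q, \<theta>) \<union> tangent_vectors (axis_curve H \<mu>) (q, \<theta>)) \<subseteq> ?V"
    using 1 2 by (intro span_minimal sp) auto
  moreover have "span (tangent_vectors (level_curve C) (q, \<theta>) \<union> tangent_vectors (axis_curve H \<mu>) (q, \<theta>)) = UNIV"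
    using tr a unfolding transversely_intersects_def by blast
  ultimately have "(1, 0) \<in> ?V" by blast
  thus False using s0 by simp
qed

text \<open>On the axis component the level curve reads \<open>q (1 - H\<^sup>2 / (\<mu> - q\<^sup>2)\<^sup>2) = C\<close>; the left-hand side is concave
  and its derivative has the sign of the stability quantity.\<close>

lemma level_axis_intersections:
  assumes H: "0 \<le> H" "H < \<mu>" and C: "C > 0"
    and ne: "level_curve C \<inter> axis_curve H \<mu> \<noteq> {}"
    and nd: "\<And>q \<theta>. (q, \<theta>) \<in> level_curve C \<Longrightarrow> (q, \<theta>) \<in> axis_curve H \<mu> \<Longrightarrow> (\<mu> - q\<^sup>2) * (sin \<theta>)\<^sup>2 \<noteq> (2 * q * cos \<theta>)\<^sup>2"
  shows "\<exists>q0 \<theta>0. (q0, \<theta>0) \<in> level_curve C \<and> (q0, \<theta>0) \<in> axis_curve H \<mu> \<and>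
     (2 * q0 * cos \<theta>0)\<^sup>2 < (\<mu> - q0\<^sup>2) * (sin \<theta>0)\<^sup>2 \<and>
     (\<forall>q \<theta>. (q, \<theta>) \<in> level_curve C \<and> (q, \<theta>) \<in> axis_curve H \<mu> \<and> (q, \<theta>) \<noteq> (q0, \<theta>0) \<longrightarrow>
        q0 < q \<and> (\<mu> - q\<^sup>2) * (sin \<theta>)\<^sup>2 < (2 * q * cos \<theta>)\<^sup>2)"
proof -
  have aH: "\<bar>H\<bar> < \<mu>" using H by simp
  define f where "f q = q * (1 - (H / (\<mu> - q\<^sup>2))\<^sup>2)" for q
  define f' where "f' q = 1 - H\<^sup>2 / (\<mu> - q\<^sup>2)\<^sup>2 - 4 * q\<^sup>2 * H\<^sup>2 / (\<mu> - q\<^sup>2) ^ 3" for q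
  define r where "r = sqrt (\<mu> - H)"
  have r: "r > 0" "r\<^sup>2 = \<mu> - H" using H by (auto simp: r_def)
  have dom: "q\<^sup>2 < \<mu> - H" "0 < \<mu> - q\<^sup>2" if "0 \<le> q" "q < r" for q
  proof -
    show "q\<^sup>2 < \<mu> - H" unfolding r(2)[symmetric] using that by (intro power_strict_mono) auto
    thus "0 < \<mu> - q\<^sup>2" using H by simp
  qed
  have pt: "(q, \<theta>) \<in> level_curve C \<and> (q, \<theta>) \<in> axis_curve H \<mu> \<longleftrightarrow>
      0 \<le> q \<and> q < r \<and> \<theta> = arccos (H / (\<mu> - q\<^sup>2)) \<and> f q = C" for q \<theta>
  proof
    assume l: "(q, \<theta>) \<in> level_curve C \<and> (q, \<theta>) \<in> axis_curve H \<mu>"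
    have \<theta>: "0 < \<theta>" "\<theta> < pi" "q\<^sup>2 < \<mu> - H" "cos \<theta> = H / (\<mu> - q\<^sup>2)" "q = C / (sin \<theta>)\<^sup>2"
      using l H by (auto simp: level_curve_def axis_curve_def)
    have s0: "sin \<theta> > 0" using \<theta> by (intro sin_gt_zero) auto
    have q0: "q > 0" using \<theta>(5) s0 C by simp
    have "q < r" using \<theta>(3) r by (metis power2_less_imp_less less_imp_le)
    moreover have "\<theta> = arccos (H / (\<mu> - q\<^sup>2))" using \<theta> arccos_cos[of \<theta>] by auto
    moreover have "f q = q * (sin \<theta>)\<^sup>2" by (simp add: f_def sin_squared_eq flip: \<theta>(4))
    hence "f q = C" using \<theta>(5) s0 by simp
    ultimately show "0 \<le> q \<and> q < r \<and> \<theta> = arccos (H / (\<mu> - q\<^sup>2)) \<and> f q = C" using q0 by auto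
  next
    assume a: "0 \<le> q \<and> q < r \<and> \<theta> = arccos (H / (\<mu> - q\<^sup>2)) \<and> f q = C"
    have d: "q\<^sup>2 < \<mu> - H" "0 < \<mu> - q\<^sup>2" using dom a by auto
    define x where "x = H / (\<mu> - q\<^sup>2)"
    have x: "- 1 < x" "x < 1" "0 \<le> x" using d H by (auto simp: x_def intro: less_le_trans[of _ 0])
    have \<theta>: "0 < \<theta>" "\<theta> < pi" "cos \<theta> = x" using a arccos_lt_bounded[of x] x by (auto simp: x_def[symmetric] cos_arccos)
    have s0: "sin \<theta> > 0" using \<theta> by (intro sin_gt_zero) auto
    have "f q = q * (sin \<theta>)\<^sup>2" by (simp add: f_def sin_squared_eq \<theta>(3) flip: x_def)
    hence "q = C / (sin \<theta>)\<^sup>2" using a s0 by (simp add: field_simps)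
    thus "(q, \<theta>) \<in> level_curve C \<and> (q, \<theta>) \<in> axis_curve H \<mu>"
      using \<theta> d H by (simp add: level_curve_def axis_curve_def x_def)
  qed
  have df: "(f has_real_derivative f' q) (at q)" if "0 \<le> q" "q < r" for q
  proof -
    have m: "\<mu> - q\<^sup>2 \<noteq> 0" using dom(2)[OF that] by simp
    have 1: "((\<lambda>q. \<mu> - q\<^sup>2) has_real_derivative - (2 * q)) (at q)" by (auto intro!: derivative_eq_intros)
    have 2: "((\<lambda>q. H / (\<mu> - q\<^sup>2)) has_real_derivative (0 * (\<mu> - q\<^sup>2) - H * - (2 * q)) / ((\<mu> - q\<^sup>2) * (\<mu> - q\<^sup>2))) (at q)"
      by (intro DERIV_divide DERIV_const 1 m)
    define x where "x = H / (\<mu> - q\<^sup>2)"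
    define y where "y = (0 * (\<mu> - q\<^sup>2) - H * - (2 * q)) / ((\<mu> - q\<^sup>2) * (\<mu> - q\<^sup>2))"
    define g where "g q = H / (\<mu> - q\<^sup>2)" for q
    have "(g has_real_derivative y) (at q)" using 2 unfolding y_def g_def[abs_def] .
    hence "((\<lambda>q. q * (1 - (g q)\<^sup>2)) has_real_derivative (1 - (g q)\<^sup>2) + q * - (2 * g q * y)) (at q)"
      by (auto intro!: derivative_eq_intros)
    hence "(f has_real_derivative (1 - x\<^sup>2) + q * - (2 * x * y)) (at q)"
      unfolding f_def[abs_def] g_def x_def .
    moreover have "(1 - x\<^sup>2) + q * - (2 * x * y) = f' q"
      using m by (simp add: f'_def x_def y_def field_simps power2_eq_square power3_eq_cube)
    ultimately show ?thesis by simp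
  qed
  have f'S: "(\<mu> - q\<^sup>2) * f' q = (\<mu> - q\<^sup>2) * (sin \<theta>)\<^sup>2 - (2 * q * cos \<theta>)\<^sup>2"
    if "(q, \<theta>) \<in> level_curve C" "(q, \<theta>) \<in> axis_curve H \<mu>" for q \<theta>
  proof -
    have \<theta>: "q\<^sup>2 < \<mu>" "H = (\<mu> - q\<^sup>2) * cos \<theta>" using that(2) unfolding axis_curve_iff[OF aH] by auto
    have m: "\<mu> - q\<^sup>2 \<noteq> 0" using \<theta> by simp
    have "H\<^sup>2 / (\<mu> - q\<^sup>2)\<^sup>2 = (cos \<theta>)\<^sup>2" using m by (simp add: \<theta>(2) power_mult_distrib)
    moreover have "4 * q\<^sup>2 * H\<^sup>2 / (\<mu> - q\<^sup>2) ^ 3 = 4 * q\<^sup>2 * (cos \<theta>)\<^sup>2 / (\<mu> - q\<^sup>2)"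
    proof -
      define m where "m = \<mu> - q\<^sup>2"
      have "4 * q\<^sup>2 * (m * cos \<theta>)\<^sup>2 / m ^ 3 = 4 * q\<^sup>2 * (cos \<theta>)\<^sup>2 / m"
        by (simp add: power2_eq_square power3_eq_cube)
      thus ?thesis unfolding \<theta>(2) m_def .
    qed
    ultimately have "f' q = (sin \<theta>)\<^sup>2 - 4 * q\<^sup>2 * (cos \<theta>)\<^sup>2 / (\<mu> - q\<^sup>2)" by (simp add: f'_def sin_squared_eq)
    thus ?thesis using m by (simp add: right_diff_distrib power_mult_distrib)
  qed
  obtain q1 \<theta>1 where "(q1, \<theta>1) \<in> level_curve C" "(q1, \<theta>1) \<in> axis_curve H \<mu>" using ne by auto
  hence q1: "0 \<le> q1" "q1 < r" "f q1 = C" using pt by auto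
  have cf: "continuous_on {0..q1} f"
    by (intro continuous_at_imp_continuous_on ballI DERIV_isCont[OF df]) (use q1 in auto)
  \<comment> \<open>Compactness provides a smallest intersection; beyond \<open>q1\<close> none can
    be smaller.\<close>
  define Z where "Z = {0..q1} \<inter> f -` {C}"
  have "closed Z" unfolding Z_def by (rule continuous_closed_preimage[OF cf]) auto
  hence "compact ({0..q1} \<inter> Z)" by (rule compact_Int_closed[OF compact_Icc])
  moreover have "{0..q1} \<inter> Z = Z" by (auto simp: Z_def)
  ultimately have "compact Z" by simp
  moreover have "q1 \<in> Z" using q1 by (simp add: Z_def)
  ultimately obtain q0 where q0: "q0 \<in> Z" "\<And>q. q \<in> Z \<Longrightarrow> q0 \<le> q" using compact_attains_inf[of Z] by blast
  have q0r: "0 \<le> q0" "q0 \<le> q1" "f q0 = C" using q0(1) by (auto simp: Z_def)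
  have min: "q0 \<le> q" if "0 \<le> q" "f q = C" for q
    using q0(2)[of q] that q0r by (cases "q \<le> q1") (auto simp: Z_def)
  have "f 0 = 0" by (simp add: f_def)
  hence q0pos: "q0 > 0" using q0r C by (cases "q0 = 0") auto
  have q0lt: "q0 < r" using q0r q1 by simp
  \<comment> \<open>A negative derivative would put \<open>f\<close> above C just to the left of
    \<open>q0\<close>. Since f 0 = 0 < C, the intermediate value theorem would give an earlier
    intersection.\<close>
  have f'0: "f' q0 \<ge> 0"
  proof (rule ccontr)
    assume "\<not> f' q0 \<ge> 0"
    hence "\<exists>d>0. \<forall>h>0. h < d \<longrightarrow> f q0 < f (q0 - h)"
      using DERIV_neg_dec_left[OF df[OF q0r(1) q0lt]] by simp
    then obtain d where d: "d > 0" "\<And>h. h > 0 \<Longrightarrow> h < d \<Longrightarrow> f q0 < f (q0 - h)" by blast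
    define x where "x = q0 - min (d / 2) (q0 / 2)"
    have x: "0 < x" "x < q0" "f x > C" using d(1) d(2)[of "min (d / 2) (q0 / 2)"] q0pos q0r by (auto simp: x_def min_def)
    have "\<exists>y\<ge>0. y \<le> x \<and> f y = C"
      using x \<open>f 0 = 0\<close> C q0r by (intro IVT' continuous_on_subset[OF cf]) auto
    then obtain y where "0 \<le> y" "y \<le> x" "f y = C" by blast
    thus False using min[of y] x by simp
  qed
  define \<theta>0 where "\<theta>0 = arccos (H / (\<mu> - q0\<^sup>2))"
  have p0: "(q0, \<theta>0) \<in> level_curve C" "(q0, \<theta>0) \<in> axis_curve H \<mu>"
    using pt[of q0 \<theta>0] q0r q0lt by (auto simp: \<theta>0_def)
  have "(\<mu> - q0\<^sup>2) * f' q0 \<ge> 0" using f'0 dom(2)[OF q0r(1) q0lt] by simp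
  hence S0: "(2 * q0 * cos \<theta>0)\<^sup>2 < (\<mu> - q0\<^sup>2) * (sin \<theta>0)\<^sup>2"
    unfolding f'S[OF p0] using nd[OF p0] by simp
  have "q0 < q \<and> (\<mu> - q\<^sup>2) * (sin \<theta>)\<^sup>2 < (2 * q * cos \<theta>)\<^sup>2"
    if l: "(q, \<theta>) \<in> level_curve C" "(q, \<theta>) \<in> axis_curve H \<mu>" "(q, \<theta>) \<noteq> (q0, \<theta>0)" for q \<theta>
  proof -
    have q: "0 \<le> q" "q < r" "\<theta> = arccos (H / (\<mu> - q\<^sup>2))" "f q = C" using pt l by auto
    have "q \<noteq> q0" using l(3) q(3) by (auto simp: \<theta>0_def)
    hence lt: "q0 < q" using min[OF q(1,4)] by simp
    \<comment> \<open>Rolle's theorem gives a critical point between two intersections; as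
      \<open>f'\<close> decreases strictly, it is negative at the right one.\<close>
    have "\<exists>x. q0 < x \<and> x < q \<and> (f has_real_derivative 0) (at x)"
    proof (rule Rolle[OF lt])
      show "f q0 = f q" using q q0r by simp
      show "continuous_on {q0..q} f"
        by (intro continuous_at_imp_continuous_on ballI DERIV_isCont[OF df]) (use q q0r in auto)
      show "f differentiable (at x)" if "q0 < x" "x < q" for x
        using df[of x] that q q0r by (auto simp: real_differentiable_def)
    qed
    then obtain x where x: "q0 < x" "x < q" "(f has_real_derivative 0) (at x)" by blast
    have x0: "f' x = 0" using DERIV_unique[OF df x(3)] x q q0r by auto
    \<comment> \<open>For H = 0 the derivative is constantly 1, so there could be no critical
      point.\<close>
    have H0: "H \<noteq> 0" using x0 by (auto simp: f'_def)
    have mx: "0 < \<mu> - x\<^sup>2" and mq: "0 < \<mu> - q\<^sup>2" using dom(2)[of x] dom(2)[of q] x q q0r by auto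
    have x2: "x\<^sup>2 < q\<^sup>2" using x q0r by (intro power_strict_mono) auto
    have "H\<^sup>2 / (\<mu> - x\<^sup>2)\<^sup>2 < H\<^sup>2 / (\<mu> - q\<^sup>2)\<^sup>2"
      using mq x2 H0 by (intro divide_strict_left_mono power_strict_mono mult_pos_pos) (auto simp: mx)
    moreover have "4 * x\<^sup>2 * H\<^sup>2 / (\<mu> - x\<^sup>2) ^ 3 \<le> 4 * q\<^sup>2 * H\<^sup>2 / (\<mu> - q\<^sup>2) ^ 3"
      using mq x2 mx by (intro frac_le mult_right_mono power_mono) auto
    ultimately have "f' q < f' x" by (simp add: f'_def)
    hence "(\<mu> - q\<^sup>2) * f' q < 0" using x0 mq by (simp add: mult_pos_neg)
    thus ?thesis unfolding f'S[OF l(1,2)] using lt by simp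
  qed
  thus ?thesis using p0 S0 by blast
qed

section \<open>Wavetrains, equilibria and the homoclinic pair\<close>

lemma wavetrain_solution:
  assumes al: "\<alpha> > 0" and \<theta>: "0 < \<theta>" "\<theta> < pi" and q: "q \<noteq> 0" and eq: "h - \<beta> / \<alpha> = (\<mu> - q\<^sup>2) * cos \<theta>"
  shows "llgs_solution \<alpha> \<beta> h \<mu> (wavetrain q (- \<beta> / \<alpha>) \<theta>)"
proof -
  define \<Omega> where "\<Omega> = \<beta> / \<alpha>"
  have dt: "((\<lambda>x. \<theta>) has_real_derivative 0) (at x)" for x :: real by simp
  have dq: "((\<lambda>x. q * x) has_real_derivative q) (at x)" for x :: real by (auto intro!: derivative_eq_intros)
  have e: "h - \<Omega> + (q\<^sup>2 - \<mu>) * cos \<theta> = 0" using eq by (simp add: \<Omega>_def algebra_simps)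
  have "cs_solution h \<Omega> \<mu> (\<lambda>x. (\<theta>, 0, q))"
    unfolding cs_solution_def cs_field_def case_prod_conv has_vector_derivative_triple
    using \<theta> q e by (simp add: phase_space_def)
  hence "llgs_solution \<alpha> \<beta> h \<mu> (\<lambda>x t. sph (q * x + \<Omega> * t) \<theta>)"
    using llgs_solution_iff_cs_solution[OF al \<Omega>_def dt dq \<theta> q] by blast
  thus ?thesis by (simp add: wavetrain_def[abs_def] \<Omega>_def)
qed

lemma stable_wavetrainI:
  assumes "\<alpha> > 0" "0 < \<theta>" "\<theta> < pi" "q \<noteq> 0" "h - \<beta> / \<alpha> = (\<mu> - q\<^sup>2) * cos \<theta>" "(2 * q * cos \<theta>)\<^sup>2 \<le> (\<mu> - q\<^sup>2) * (sin \<theta>)\<^sup>2"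
  shows "stable_wavetrain \<alpha> \<beta> h \<mu> q (- \<beta> / \<alpha>) \<theta>"
  unfolding stable_wavetrain_def
  using wavetrain_solution[OF assms(1-5)] wavetrain_spectrum_stable[OF assms(1) assms(5)[symmetric] refl assms(6)] by blast

lemma unstable_wavetrainI:
  assumes "\<alpha> > 0" "0 < \<theta>" "\<theta> < pi" "q \<noteq> 0" "h - \<beta> / \<alpha> = (\<mu> - q\<^sup>2) * cos \<theta>" "(\<mu> - q\<^sup>2) * (sin \<theta>)\<^sup>2 < (2 * q * cos \<theta>)\<^sup>2"
  shows "unstable_wavetrain \<alpha> \<beta> h \<mu> q (- \<beta> / \<alpha>) \<theta>"
  unfolding unstable_wavetrain_def
  using wavetrain_solution[OF assms(1-5)] wavetrain_spectrum_unstable[OF assms(1) assms(5)[symmetric] refl assms(6)] by blast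

lemma cs_equilibria_at_iff:
  assumes C: "C > 0"
  shows "(\<theta>, p, q) \<in> cs_equilibria_at h \<Omega> \<mu> C \<longleftrightarrow> (q, \<theta>) \<in> level_curve C \<and> p = 0 \<and> h - \<Omega> = (\<mu> - q\<^sup>2) * cos \<theta>"
proof
  assume a: "(\<theta>, p, q) \<in> cs_equilibria_at h \<Omega> \<mu> C"
  hence b: "0 < \<theta>" "\<theta> < pi" "p = 0" "h - \<Omega> = (\<mu> - q\<^sup>2) * cos \<theta>" "q > 0" "(sin \<theta>)\<^sup>2 * q = C"
    by (auto simp: cs_equilibria_at_def equilibrium_iff first_integral_def)
  have "sin \<theta> > 0" using b by (intro sin_gt_zero) auto
  hence "q = C / (sin \<theta>)\<^sup>2" using b(6) by (simp add: field_simps)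
  thus "(q, \<theta>) \<in> level_curve C \<and> p = 0 \<and> h - \<Omega> = (\<mu> - q\<^sup>2) * cos \<theta>" using b by (simp add: level_curve_def)
next
  assume a: "(q, \<theta>) \<in> level_curve C \<and> p = 0 \<and> h - \<Omega> = (\<mu> - q\<^sup>2) * cos \<theta>"
  hence b: "0 < \<theta>" "\<theta> < pi" "q = C / (sin \<theta>)\<^sup>2" by (auto simp: level_curve_def)
  have s: "sin \<theta> > 0" using b by (intro sin_gt_zero) auto
  have q: "q > 0" using s C by (simp add: b(3))
  have "(sin \<theta>)\<^sup>2 * q = C" using s by (simp add: b(3))
  thus "(\<theta>, p, q) \<in> cs_equilibria_at h \<Omega> \<mu> C"
    using a b(1,2) q by (simp add: cs_equilibria_at_def equilibrium_iff first_integral_def)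
qed

lemma wavetrain_curves_iff:
  "(q, \<theta>) \<in> wavetrain_curves h \<Omega> \<mu> \<longleftrightarrow> 0 < \<theta> \<and> \<theta> < pi \<and> q\<^sup>2 \<noteq> \<mu> \<and> h - \<Omega> = (\<mu> - q\<^sup>2) * cos \<theta>"
  by (auto simp: wavetrain_curves_def field_simps)

text \<open>Equilibria with q^2 = \<mu> exist only for h = \<Omega>, with \<theta> unrestricted by
  the equilibrium equation; the wavetrain curves omit them, hence the restricted target set.\<close>

lemma bij_betw_intersections:
  assumes C: "C > 0"
  shows "bij_betw (\<lambda>(q, \<theta>). (\<theta>, 0, q)) (level_curve C \<inter> wavetrain_curves h \<Omega> \<mu>)
         {(\<theta>, p, q). (\<theta>, p, q) \<in> cs_equilibria_at h \<Omega> \<mu> C \<and> q\<^sup>2 \<noteq> \<mu>}"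
  unfolding bij_betw_def
proof
  show "inj_on (\<lambda>(q, \<theta>). (\<theta>, 0::real, q)) (level_curve C \<inter> wavetrain_curves h \<Omega> \<mu>)" by (auto simp: inj_on_def)
  have r: "0 < \<theta> \<and> \<theta> < pi" if "(q, \<theta>) \<in> level_curve C" for q \<theta> using that by (simp add: level_curve_def)
  show "(\<lambda>(q, \<theta>). (\<theta>, 0, q)) ` (level_curve C \<inter> wavetrain_curves h \<Omega> \<mu>) =
      {(\<theta>, p, q). (\<theta>, p, q) \<in> cs_equilibria_at h \<Omega> \<mu> C \<and> q\<^sup>2 \<noteq> \<mu>}"
    unfolding cs_equilibria_at_iff[OF C] using r by (force simp: wavetrain_curves_iff image_iff)
qed

text \<open>The sign of k is that of q along the orbit. Passing to C = |k| puts the limit, reflected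
  if necessary, on the level curve with q > 0; all other conclusions involve q only through its
  square.\<close>

lemma cs_nonperiodic_curve:
  assumes nc: "nonconst_cs_solution h \<Omega> \<mu> \<gamma>" and np: "\<not> periodic \<gamma>" and fi: "\<And>\<xi>. first_integral (\<gamma> \<xi>) = C"
  shows "\<exists>k E u w a L. \<bar>k\<bar> = C \<and> k \<noteq> 0 \<and> \<gamma> = lift k u w \<and> profile (h - \<Omega>) \<mu> E k u w \<and> w a = 0 \<and> u a \<noteq> L \<and> - 1 < L \<and> L < 1 \<and>
     2 * E = (k / (1 - L\<^sup>2))\<^sup>2 * (1 - L\<^sup>2) + 2 * (h - \<Omega>) * L - \<mu> * L\<^sup>2 \<and>
     \<bar>h - \<Omega>\<bar> < \<mu> \<and> (C / (1 - L\<^sup>2), arccos L) \<in> level_curve C \<and> (C / (1 - L\<^sup>2), arccos L) \<in> axis_curve (h - \<Omega>) \<mu> \<and>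
     (2 * (C / (1 - L\<^sup>2)) * L)\<^sup>2 \<le> (\<mu> - (C / (1 - L\<^sup>2))\<^sup>2) * (sin (arccos L))\<^sup>2"
proof -
  obtain k E u w a L q where k: "k \<noteq> 0" "\<gamma> = lift k u w" "profile (h - \<Omega>) \<mu> E k u w" "w a = 0" "u a \<noteq> L"
    and L: "- 1 < L" "L < 1" and q: "q = k / (1 - L\<^sup>2)" and H: "h - \<Omega> = (\<mu> - q\<^sup>2) * L"
    and E: "2 * E = q\<^sup>2 * (1 - L\<^sup>2) + 2 * (h - \<Omega>) * L - \<mu> * L\<^sup>2"
    and S: "(2 * q * L)\<^sup>2 \<le> (\<mu> - q\<^sup>2) * (1 - L\<^sup>2)" and q\<mu>: "q\<^sup>2 < \<mu>"
    using cs_nonperiodic[OF nc np] by blast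
  have kC: "\<bar>k\<bar> = C" using lift_first_integral[OF k(3)] fi k(2) by metis
  have s: "1 - L\<^sup>2 > 0" by (rule one_minus_sq_pos[OF L])
  have q2: "(C / (1 - L\<^sup>2))\<^sup>2 = q\<^sup>2" using kC by (simp add: q power_divide flip: kC)
  have th: "0 < arccos L" "arccos L < pi" "cos (arccos L) = L" "(sin (arccos L))\<^sup>2 = 1 - L\<^sup>2"
    using arccos_lt_bounded[OF L] L s by (auto simp: cos_arccos sin_arccos)
  have "\<bar>h - \<Omega>\<bar> = (\<mu> - q\<^sup>2) * \<bar>L\<bar>" using H q\<mu> by (simp add: abs_mult)
  also have "\<dots> < (\<mu> - q\<^sup>2) * 1" using q\<mu> L by (intro mult_strict_left_mono) auto
  also have "\<dots> \<le> \<mu>" by simp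
  finally have H\<mu>: "\<bar>h - \<Omega>\<bar> < \<mu>" .
  have lc: "(C / (1 - L\<^sup>2), arccos L) \<in> level_curve C" using th by (simp add: level_curve_def)
  have ac: "(C / (1 - L\<^sup>2), arccos L) \<in> axis_curve (h - \<Omega>) \<mu>"
    unfolding axis_curve_iff[OF H\<mu>] q2 using th H q\<mu> by simp
  have S': "(2 * (C / (1 - L\<^sup>2)) * L)\<^sup>2 \<le> (\<mu> - (C / (1 - L\<^sup>2))\<^sup>2) * (sin (arccos L))\<^sup>2"
    using S unfolding q2 th power_mult_distrib by simp
  show ?thesis using k L E[unfolded q] kC H\<mu> lc ac S' by blast
qed

lemma reflect_lift: "reflect \<circ> lift k u w = lift (- k) u w"
  by (simp add: lift_def reflect_def fun_eq_iff)

text \<open>The pair consists of the explicit orbits on the two sides of \<open>L\<close>. A further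
  non-periodic orbit has a limit satisfying the weak stability inequality; by assumption only the
  given point does, which determines its energy and hence the orbit.\<close>

lemma homoclinic_pair:
  assumes C: "C > 0" and \<theta>: "(q, \<theta>) \<in> level_curve C" "(q, \<theta>) \<in> axis_curve (h - \<Omega>) \<mu>" and H: "\<bar>h - \<Omega>\<bar> < \<mu>"
    and S: "(2 * q * cos \<theta>)\<^sup>2 < (\<mu> - q\<^sup>2) * (sin \<theta>)\<^sup>2"
    and un: "\<And>q' \<theta>'. (q', \<theta>') \<in> level_curve C \<Longrightarrow> (q', \<theta>') \<in> axis_curve (h - \<Omega>) \<mu> \<Longrightarrow> (q', \<theta>') \<noteq> (q, \<theta>) \<Longrightarrow>
        (\<mu> - q'\<^sup>2) * (sin \<theta>')\<^sup>2 < (2 * q' * cos \<theta>')\<^sup>2"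
  shows "\<exists>\<gamma>\<^sub>1 \<gamma>\<^sub>2. homoclinic_to h \<Omega> \<mu> (\<theta>, 0, q) \<gamma>\<^sub>1 \<and> homoclinic_to h \<Omega> \<mu> (\<theta>, 0, q) \<gamma>\<^sub>2 \<and> \<not> translates \<gamma>\<^sub>1 \<gamma>\<^sub>2 \<and>
     (\<forall>\<gamma>. nonconst_cs_solution h \<Omega> \<mu> \<gamma> \<and> (\<forall>\<xi>. first_integral (\<gamma> \<xi>) = C) \<and>
        \<not> translates \<gamma> \<gamma>\<^sub>1 \<and> \<not> translates \<gamma> \<gamma>\<^sub>2 \<and> \<not> translates \<gamma> (reflect \<circ> \<gamma>\<^sub>1) \<and> \<not> translates \<gamma> (reflect \<circ> \<gamma>\<^sub>2)
          \<longrightarrow> periodic \<gamma>)"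
proof -
  define L where "L = cos \<theta>"
  define H' where "H' = h - \<Omega>"
  have \<theta>r: "0 < \<theta>" "\<theta> < pi" and q\<mu>: "q\<^sup>2 < \<mu>" and HL: "H' = (\<mu> - q\<^sup>2) * L"
    using \<theta>(2) unfolding axis_curve_iff[OF H] by (auto simp: L_def H'_def)
  have s0: "sin \<theta> > 0" using \<theta>r by (intro sin_gt_zero) auto
  have s2: "(sin \<theta>)\<^sup>2 = 1 - L\<^sup>2" by (simp add: L_def sin_squared_eq)
  have "L\<^sup>2 < 1" using s2 zero_less_power[OF s0, of 2] by simp
  hence L: "- 1 < L" "L < 1" by (auto simp: abs_square_less_1 abs_less_iff)
  have q: "q = C / (1 - L\<^sup>2)" using \<theta>(1) by (simp add: level_curve_def s2)
  have aL: "arccos L = \<theta>" unfolding L_def using \<theta>r by (intro arccos_cos) auto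
  have \<mu>: "\<mu> > 0" using q\<mu> zero_le_power2[of q] by linarith
  have C0: "C \<noteq> 0" using C by simp
  \<comment> \<open>The energy of the equilibrium, which makes \<open>L\<close> a double
    root.\<close>
  define E where "E = (q\<^sup>2 * (1 - L\<^sup>2) + 2 * H' * L - \<mu> * L\<^sup>2) / 2"
  have "H' = (\<mu> - q\<^sup>2) * L \<and> 2 * E = q\<^sup>2 * (1 - L\<^sup>2) + 2 * H' * L - \<mu> * L\<^sup>2" using HL by (simp add: E_def)
  hence P: "pot H' \<mu> E C L = 0" "hpot' H' \<mu> E L = 0" using double_root_iff(1)[OF C0 L q, of H' \<mu> E] by blast+
  define r0 where "r0 = - 6 * \<mu> * L\<^sup>2 + 6 * H' * L + \<mu> - 2 * E"
  have "r0 = (\<mu> - q\<^sup>2) * (1 - L\<^sup>2) - (2 * q * L)\<^sup>2"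
    unfolding r0_def by (rule double_root_iff(2)[OF C0 L q P])
  hence r0: "r0 > 0" using S by (simp add: s2 L_def)
  obtain u1 w1 where 1: "profile H' \<mu> E C u1 w1" "(u1 \<longlongrightarrow> L) at_top" "(u1 \<longlongrightarrow> L) at_bot" "(w1 \<longlongrightarrow> 0) at_top" "(w1 \<longlongrightarrow> 0) at_bot"
     "w1 0 = 0" "\<And>\<xi>. u1 \<xi> < L"
    using homoclinic_profile[OF P L C0 r0_def r0 \<mu>, of "-1"] by auto
  obtain u2 w2 where 2: "profile H' \<mu> E C u2 w2" "(u2 \<longlongrightarrow> L) at_top" "(u2 \<longlongrightarrow> L) at_bot" "(w2 \<longlongrightarrow> 0) at_top" "(w2 \<longlongrightarrow> 0) at_bot"
     "w2 0 = 0" "\<And>\<xi>. L < u2 \<xi>"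
    using homoclinic_profile[OF P L C0 r0_def r0 \<mu>, of 1] by auto
  have hom: "homoclinic_to h \<Omega> \<mu> (\<theta>, 0, q) (lift C u w)"
    if p: "profile H' \<mu> E C u w" and l: "(u \<longlongrightarrow> L) at_top" "(u \<longlongrightarrow> L) at_bot" "(w \<longlongrightarrow> 0) at_top" "(w \<longlongrightarrow> 0) at_bot"
      and ne: "u 0 \<noteq> L" for u w
  proof -
    have "\<not> u constant_on UNIV"
    proof
      assume "u constant_on UNIV"
      then obtain y where "\<And>\<xi>. u \<xi> = y" by (auto simp: constant_on_def)
      hence "u = (\<lambda>_. y)" by auto
      hence "y = L" using l(1) by (simp add: tendsto_const_iff)
      thus False using ne \<open>u = (\<lambda>_. y)\<close> by simp
    qed
    hence "nonconst_cs_solution h \<Omega> \<mu> (lift C u w)"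
      using lift_cs_solution[OF p[unfolded H'_def] C0] lift_constant[OF p] by (simp add: nonconst_cs_solution_def)
    thus ?thesis unfolding homoclinic_to_def
      using lift_tendsto[OF l(1,3) L, of C] lift_tendsto[OF l(2,4) L, of C] by (simp add: aL q)
  qed
  have h1: "homoclinic_to h \<Omega> \<mu> (\<theta>, 0, q) (lift C u1 w1)" using 1(7)[of 0] by (intro hom[OF 1(1-5)]) auto
  have h2: "homoclinic_to h \<Omega> \<mu> (\<theta>, 0, q) (lift C u2 w2)" using 2(7)[of 0] by (intro hom[OF 2(1-5)]) auto
  \<comment> \<open>The heights of the two orbits stay on opposite sides of
    \<open>L\<close>.\<close>
  have nt: "\<not> translates (lift C u1 w1) (lift C u2 w2)"
  proof
    assume "translates (lift C u1 w1) (lift C u2 w2)"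
    then obtain d where "lift C u1 w1 0 = lift C u2 w2 (0 + d)" unfolding translates_def by blast
    hence "u1 0 = u2 (0 + d)" by (metis lift_fst[OF 1(1)] lift_fst[OF 2(1)])
    thus False using 1(7)[of 0] 2(7)[of "0 + d"] by simp
  qed
  have "periodic \<gamma>" if nc: "nonconst_cs_solution h \<Omega> \<mu> \<gamma>" and fi: "\<And>\<xi>. first_integral (\<gamma> \<xi>) = C"
    and t: "\<not> translates \<gamma> (lift C u1 w1)" "\<not> translates \<gamma> (lift C u2 w2)"
      "\<not> translates \<gamma> (reflect \<circ> lift C u1 w1)" "\<not> translates \<gamma> (reflect \<circ> lift C u2 w2)" for \<gamma>
  proof (rule ccontr)
    assume np: "\<not> periodic \<gamma>"
    obtain k E' u w a L' where k: "\<bar>k\<bar> = C" "\<gamma> = lift k u w" "profile H' \<mu> E' k u w" "w a = 0" "u a \<noteq> L'" and L': "- 1 < L'" "L' < 1"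
      and E': "2 * E' = (k / (1 - L'\<^sup>2))\<^sup>2 * (1 - L'\<^sup>2) + 2 * H' * L' - \<mu> * L'\<^sup>2"
      and pt: "(C / (1 - L'\<^sup>2), arccos L') \<in> level_curve C" "(C / (1 - L'\<^sup>2), arccos L') \<in> axis_curve (h - \<Omega>) \<mu>"
      and S': "(2 * (C / (1 - L'\<^sup>2)) * L')\<^sup>2 \<le> (\<mu> - (C / (1 - L'\<^sup>2))\<^sup>2) * (sin (arccos L'))\<^sup>2"
      using cs_nonperiodic_curve[OF nc np fi] unfolding H'_def by blast
    \<comment> \<open>At every other intersection the strict reverse inequality holds, against the
      weak one at the limit of a non-periodic orbit.\<close>
    have "(C / (1 - L'\<^sup>2), arccos L') = (q, \<theta>)"
    proof (rule ccontr)
      assume "(C / (1 - L'\<^sup>2), arccos L') \<noteq> (q, \<theta>)"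
      from un[OF pt this] show False using S' L' by (simp add: cos_arccos)
    qed
    hence LL: "L' = L" using L' by (auto simp: L_def cos_arccos)
    have k2: "k\<^sup>2 = C\<^sup>2" using k(1) by (metis power2_abs)
    have "E' = E" using E' unfolding LL E_def q power_divide k2 by simp
    hence pr: "profile H' \<mu> E C u w" using k(3) by (simp add: profile_def pot_def k2)
    have "(\<forall>\<xi>. u \<xi> = u1 (\<xi> - a) \<and> w \<xi> = w1 (\<xi> - a)) \<or> (\<forall>\<xi>. u \<xi> = u2 (\<xi> - a) \<and> w \<xi> = w2 (\<xi> - a))"
      using homoclinic_profile_unique[OF P \<mu> 1(1,6,7) 2(1,6,7) pr k(4)] k(5) LL by simp
    hence "translates \<gamma> (lift k u1 w1) \<or> translates \<gamma> (lift k u2 w2)"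
      unfolding translates_def k(2) lift_def by (metis diff_conv_add_uminus)
    \<comment> \<open>The two signs of k account for the reflected pair.\<close>
    moreover have "k = C \<or> k = - C" using k(1) by linarith
    ultimately show False using t unfolding reflect_lift by auto
  qed
  thus ?thesis using h1 h2 nt by blast
qed

lemma cs_nonperiodic_homoclinic:
  assumes nc: "nonconst_cs_solution h \<Omega> \<mu> \<gamma>" and np: "\<not> periodic \<gamma>"
  shows "\<exists>e\<in>cs_equilibria h \<Omega> \<mu>. homoclinic_to h \<Omega> \<mu> e \<gamma>"
proof -
  obtain k L q where k: "k \<noteq> 0" and L: "- 1 < L" "L < 1" and q: "q = k / (1 - L\<^sup>2)" "h - \<Omega> = (\<mu> - q\<^sup>2) * L"
    and hom: "homoclinic_to h \<Omega> \<mu> (arccos L, 0, q) \<gamma>"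
    using cs_nonperiodic[OF nc np] by blast
  have "q \<noteq> 0" using k one_minus_sq_pos[OF L] by (simp add: q(1))
  hence "(arccos L, 0, q) \<in> cs_equilibria h \<Omega> \<mu>"
    using arccos_lt_bounded[OF L] L q(2) by (simp add: equilibrium_iff cos_arccos)
  thus ?thesis using hom by blast
qed

text \<open>The intersection analysis covers only the component through q = 0. There remain the
  equilibria with q^2 > \<mu>, on other branches, and those with q^2 = \<mu>, on no branch at all;
  both must still be shown unstable.\<close>

theorem theorem9:
  fixes \<alpha> \<beta> h \<mu> \<Omega> C :: real
  assumes "\<alpha> > 0" and "\<Omega> = \<beta> / \<alpha>" and "C > 0"
  shows
    "(\<forall>\<theta> p \<phi> q.
        (\<forall>x. (\<theta> has_real_derivative p x) (at x) \<and> (\<phi> has_real_derivative q x) (at x) \<and>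
             0 < \<theta> x \<and> \<theta> x < pi \<and> q x \<noteq> 0) \<longrightarrow>
        (llgs_solution \<alpha> \<beta> h \<mu> (\<lambda>x t. sph (\<phi> x + \<Omega> * t) (\<theta> x)) \<longleftrightarrow>
         cs_solution h \<Omega> \<mu> (\<lambda>x. (\<theta> x, p x, q x))))
     \<and> (\<forall>\<gamma>. cs_solution h \<Omega> \<mu> \<gamma> \<longrightarrow> (\<exists>D>0. \<forall>\<xi>. first_integral (\<gamma> \<xi>) = D))
     \<and> bij_betw (\<lambda>(q, \<theta>). (\<theta>, 0, q)) (level_curve C \<inter> wavetrain_curves h \<Omega> \<mu>)
         {(\<theta>, p, q). (\<theta>, p, q) \<in> cs_equilibria_at h \<Omega> \<mu> C \<and> q\<^sup>2 \<noteq> \<mu>}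
     \<and> (h \<noteq> \<Omega> \<longrightarrow>
          bij_betw (\<lambda>(q, \<theta>). (\<theta>, 0, q)) (level_curve C \<inter> wavetrain_curves h \<Omega> \<mu>)
            (cs_equilibria_at h \<Omega> \<mu> C))
     \<and> (0 \<le> h - \<Omega> \<and> h - \<Omega> < \<mu> \<longrightarrow>
          (\<exists>!K. K \<in> axis_components h \<Omega> \<mu>) \<and>
          (\<forall>K \<in> axis_components h \<Omega> \<mu>. transversely_intersects (level_curve C) K \<longrightarrow>
            (\<exists>q\<^sub>0 \<theta>\<^sub>0.
               (q\<^sub>0, \<theta>\<^sub>0) \<in> level_curve C \<inter> K \<and>
               (\<forall>(q, \<theta>) \<in> level_curve C \<inter> wavetrain_curves h \<Omega> \<mu>.
                  (q, \<theta>) \<noteq> (q\<^sub>0, \<theta>\<^sub>0) \<longrightarrow> q\<^sub>0 < q) \<and>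
               stable_wavetrain \<alpha> \<beta> h \<mu> q\<^sub>0 (- \<beta> / \<alpha>) \<theta>\<^sub>0 \<and>
               (\<forall>(q, \<theta>) \<in> level_curve C \<inter> wavetrain_curves h \<Omega> \<mu>.
                  (q, \<theta>) \<noteq> (q\<^sub>0, \<theta>\<^sub>0) \<longrightarrow> unstable_wavetrain \<alpha> \<beta> h \<mu> q (- \<beta> / \<alpha>) \<theta>) \<and>
               (\<forall>(\<theta>, p, q) \<in> cs_equilibria_at h \<Omega> \<mu> C.
                  (q, \<theta>) \<noteq> (q\<^sub>0, \<theta>\<^sub>0) \<longrightarrow> unstable_wavetrain \<alpha> \<beta> h \<mu> q (- \<beta> / \<alpha>) \<theta>) \<and>
               (\<exists>\<gamma>\<^sub>1 \<gamma>\<^sub>2.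
                  homoclinic_to h \<Omega> \<mu> (\<theta>\<^sub>0, 0, q\<^sub>0) \<gamma>\<^sub>1 \<and>
                  homoclinic_to h \<Omega> \<mu> (\<theta>\<^sub>0, 0, q\<^sub>0) \<gamma>\<^sub>2 \<and>
                  \<not> translates \<gamma>\<^sub>1 \<gamma>\<^sub>2 \<and>
                  (\<forall>\<gamma>. nonconst_cs_solution h \<Omega> \<mu> \<gamma> \<and> (\<forall>\<xi>. first_integral (\<gamma> \<xi>) = C) \<and>
                       \<not> translates \<gamma> \<gamma>\<^sub>1 \<and> \<not> translates \<gamma> \<gamma>\<^sub>2 \<and>
                       \<not> translates \<gamma> (reflect \<circ> \<gamma>\<^sub>1) \<and> \<not> translates \<gamma> (reflect \<circ> \<gamma>\<^sub>2)
                     \<longrightarrow> periodic \<gamma>)))))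
     \<and> (\<forall>\<gamma>. nonconst_cs_solution h \<Omega> \<mu> \<gamma> \<and>
              \<not> (\<exists>e \<in> cs_equilibria h \<Omega> \<mu>. homoclinic_to h \<Omega> \<mu> e \<gamma>) \<longrightarrow> periodic \<gamma>)
     \<and> (\<not> (\<bar>h - \<Omega>\<bar> < \<mu> \<and> (\<exists>K \<in> axis_components h \<Omega> \<mu>. level_curve C \<inter> K \<noteq> {})) \<longrightarrow>
          (\<forall>\<gamma>. nonconst_cs_solution h \<Omega> \<mu> \<gamma> \<and> (\<forall>\<xi>. first_integral (\<gamma> \<xi>) = C)
             \<longrightarrow> periodic \<gamma>))"
proof (intro conjI, goal_cases)
  case 1
  show ?case
    using llgs_solution_iff_cs_solution[OF assms(1,2)] by blast
next
  case 2
  show ?case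
  proof (intro allI impI)
    fix \<gamma> assume "cs_solution h \<Omega> \<mu> \<gamma>"
    then obtain k E u w where "k \<noteq> 0" "profile (h - \<Omega>) \<mu> E k u w" "\<gamma> = lift k u w"
      using cs_solution_imp_lift by blast
    thus "\<exists>D>0. \<forall>\<xi>. first_integral (\<gamma> \<xi>) = D" by (intro exI[of _ "\<bar>k\<bar>"]) (simp add: lift_first_integral)
  qed
next
  case 3
  show ?case
    by (rule bij_betw_intersections[OF assms(3)])
next
  case 4
  show ?case
  proof
    assume "h \<noteq> \<Omega>"
    hence "{(\<theta>, p, q). (\<theta>, p, q) \<in> cs_equilibria_at h \<Omega> \<mu> C \<and> q\<^sup>2 \<noteq> \<mu>} = cs_equilibria_at h \<Omega> \<mu> C"
      by (auto simp: cs_equilibria_at_iff[OF assms(3)])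
    thus "bij_betw (\<lambda>(q, \<theta>). (\<theta>, 0, q)) (level_curve C \<inter> wavetrain_curves h \<Omega> \<mu>) (cs_equilibria_at h \<Omega> \<mu> C)"
      using bij_betw_intersections[OF assms(3), of h \<Omega> \<mu>] by simp
  qed
next
  case 5
  show ?case
  proof (intro impI conjI ballI, goal_cases)
    case 1
    hence "\<bar>h - \<Omega>\<bar> < \<mu>" by simp
    from axis_components_eq[OF this] show ?case by simp
  next
    case (2 K)
    note a = 2(1) and tr = 2(3)
    have H: "\<bar>h - \<Omega>\<bar> < \<mu>" using a by simp
    have K: "K = axis_curve (h - \<Omega>) \<mu>" using 2(2) axis_components_eq[OF H] by simp
    have ne: "level_curve C \<inter> axis_curve (h - \<Omega>) \<mu> \<noteq> {}" using tr by (simp add: K transversely_intersects_def)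
    obtain q0 \<theta>0 where p0: "(q0, \<theta>0) \<in> level_curve C" "(q0, \<theta>0) \<in> axis_curve (h - \<Omega>) \<mu>"
      and S0: "(2 * q0 * cos \<theta>0)\<^sup>2 < (\<mu> - q0\<^sup>2) * (sin \<theta>0)\<^sup>2" and
      oth: "\<And>q \<theta>. (q, \<theta>) \<in> level_curve C \<Longrightarrow> (q, \<theta>) \<in> axis_curve (h - \<Omega>) \<mu> \<Longrightarrow> (q, \<theta>) \<noteq> (q0, \<theta>0) \<Longrightarrow>
        q0 < q \<and> (\<mu> - q\<^sup>2) * (sin \<theta>)\<^sup>2 < (2 * q * cos \<theta>)\<^sup>2"
      using level_axis_intersections[OF conjunct1[OF a] conjunct2[OF a] assms(3) ne
        transversal_nondegenerate[OF H assms(3) tr[unfolded K]]] by blast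
    have lev: "0 < \<theta> \<and> \<theta> < pi \<and> 0 < sin \<theta> \<and> 0 < q \<and> q * (sin \<theta>)\<^sup>2 = C" if "(q, \<theta>) \<in> level_curve C" for q \<theta>
    proof -
      have t: "0 < \<theta>" "\<theta> < pi" "q = C / (sin \<theta>)\<^sup>2" using that by (auto simp: level_curve_def)
      moreover have "0 < sin \<theta>" using t by (intro sin_gt_zero) auto
      ultimately show ?thesis using assms(3) by simp
    qed
    have q0\<mu>: "q0\<^sup>2 < \<mu>" and e0: "h - \<Omega> = (\<mu> - q0\<^sup>2) * cos \<theta>0" using p0(2) unfolding axis_curve_iff[OF H] by auto
    have main: "q0 < q \<and> (\<mu> - q\<^sup>2) * (sin \<theta>)\<^sup>2 < (2 * q * cos \<theta>)\<^sup>2 \<or> q\<^sup>2 = \<mu> \<and> (\<mu> - q\<^sup>2) * (sin \<theta>)\<^sup>2 < (2 * q * cos \<theta>)\<^sup>2"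
      if l: "(q, \<theta>) \<in> level_curve C" and e: "h - \<Omega> = (\<mu> - q\<^sup>2) * cos \<theta>" and n: "(q, \<theta>) \<noteq> (q0, \<theta>0)" for q \<theta>
    proof -
      note lv = lev[OF l]
      consider "q\<^sup>2 < \<mu>" | "q\<^sup>2 = \<mu>" | "q\<^sup>2 > \<mu>" by linarith
      thus ?thesis
      proof cases
        case 1
        hence "(q, \<theta>) \<in> axis_curve (h - \<Omega>) \<mu>" unfolding axis_curve_iff[OF H] using e lv by simp
        thus ?thesis using oth[OF l _ n] by blast
      next
        \<comment> \<open>Now h = \<Omega>, so \<theta>0 is the equator and q0 = C. A second point
          on the equator would have q = C = q0, against q0^2 < \<mu>; hence cos \<theta> is nonzero
          and the right-hand side is positive while the left one is zero.\<close>
        case 2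
        have H0: "h - \<Omega> = 0" using e 2 by simp
        have "cos \<theta>0 = 0" using e0 H0 q0\<mu> by simp
        hence q0C: "q0 = C" using lev[OF p0(1)] sin_cos_squared_add[of \<theta>0] by simp
        have "cos \<theta> \<noteq> 0"
        proof
          assume "cos \<theta> = 0"
          hence "q = C" using lv sin_cos_squared_add[of \<theta>] by simp
          thus False using 2 q0C q0\<mu> by simp
        qed
        hence "(2 * q * cos \<theta>)\<^sup>2 > 0" using lv by simp
        thus ?thesis using 2 by simp
      next
        \<comment> \<open>Beyond q^2 = \<mu> the left-hand side is negative, so instability is
          immediate.\<close>
        case 3
        have "q0 < q" using 3 q0\<mu> lv by (intro power2_less_imp_less[of q0 q]) auto
        moreover have "(\<mu> - q\<^sup>2) * (sin \<theta>)\<^sup>2 < 0" using 3 lv by (intro mult_neg_pos) auto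
        ultimately show ?thesis using zero_le_power2[of "2 * q * cos \<theta>"] by linarith
      qed
    qed
    have st: "stable_wavetrain \<alpha> \<beta> h \<mu> q0 (- \<beta> / \<alpha>) \<theta>0"
      using lev[OF p0(1)] e0 S0 assms(1,2) by (intro stable_wavetrainI) auto
    have us: "unstable_wavetrain \<alpha> \<beta> h \<mu> q (- \<beta> / \<alpha>) \<theta>"
      if "(q, \<theta>) \<in> level_curve C" "h - \<Omega> = (\<mu> - q\<^sup>2) * cos \<theta>" "(q, \<theta>) \<noteq> (q0, \<theta>0)" for q \<theta>
      using main[OF that] lev[OF that(1)] that assms(1,2) by (intro unstable_wavetrainI) auto
    have lt: "q0 < q" if "(q, \<theta>) \<in> level_curve C" "(q, \<theta>) \<in> wavetrain_curves h \<Omega> \<mu>" "(q, \<theta>) \<noteq> (q0, \<theta>0)" for q \<theta>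
      using main[OF that(1) _ that(3)] that(2) by (auto simp: wavetrain_curves_iff)
    show ?case
    proof (rule exI[of _ q0], rule exI[of _ \<theta>0], intro conjI)
      show "(q0, \<theta>0) \<in> level_curve C \<inter> K" using p0 K by simp
      show "\<forall>(q, \<theta>) \<in> level_curve C \<inter> wavetrain_curves h \<Omega> \<mu>. (q, \<theta>) \<noteq> (q0, \<theta>0) \<longrightarrow> q0 < q"
        using lt by blast
      show "stable_wavetrain \<alpha> \<beta> h \<mu> q0 (- \<beta> / \<alpha>) \<theta>0" by (rule st)
      show "\<forall>(q, \<theta>) \<in> level_curve C \<inter> wavetrain_curves h \<Omega> \<mu>.
          (q, \<theta>) \<noteq> (q0, \<theta>0) \<longrightarrow> unstable_wavetrain \<alpha> \<beta> h \<mu> q (- \<beta> / \<alpha>) \<theta>"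
        using us by (fastforce simp: wavetrain_curves_iff)
      show "\<forall>(\<theta>, p, q) \<in> cs_equilibria_at h \<Omega> \<mu> C.
          (q, \<theta>) \<noteq> (q0, \<theta>0) \<longrightarrow> unstable_wavetrain \<alpha> \<beta> h \<mu> q (- \<beta> / \<alpha>) \<theta>"
        using us cs_equilibria_at_iff[OF assms(3)] by fast
    qed (rule homoclinic_pair[OF assms(3) p0 H S0 conjunct2[OF oth]])
  qed
next
  case 6
  show ?case
    using cs_nonperiodic_homoclinic by blast
next
  case 7
  show ?case
  \<comment> \<open>A non-periodic orbit would have its limit, up to reflection, on both curves, and
    this limit forces |h - \<Omega>| < \<mu>.\<close>
  proof (intro impI allI, rule ccontr)
    fix \<gamma> assume n: "\<not> (\<bar>h - \<Omega>\<bar> < \<mu> \<and> (\<exists>K \<in> axis_components h \<Omega> \<mu>. level_curve C \<inter> K \<noteq> {}))"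
      and g: "nonconst_cs_solution h \<Omega> \<mu> \<gamma> \<and> (\<forall>\<xi>. first_integral (\<gamma> \<xi>) = C)" and p: "\<not> periodic \<gamma>"
    obtain L where H: "\<bar>h - \<Omega>\<bar> < \<mu>" and "(C / (1 - L\<^sup>2), arccos L) \<in> level_curve C" "(C / (1 - L\<^sup>2), arccos L) \<in> axis_curve (h - \<Omega>) \<mu>"
      using cs_nonperiodic_curve[OF conjunct1[OF g] p] g by blast
    hence "level_curve C \<inter> axis_curve (h - \<Omega>) \<mu> \<noteq> {}" by blast
    thus False using n H axis_components_eq[OF H] by blast
  qed
qed

end
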